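(* Let $m\ge 2$ be an integer. Let $v=\{v(x),x\in\mathbb{R}^k\}$ and $T\subset\mathbb{R}^k$ be as in the context, and suppose that Assumptions 1, 2 and 3 (stated in the context) hold. If $mQ\le (m-1)d$, where $Q=\sum_{j=1}^k\alpha_j^{-1}$ with $\alpha_j=(\gamma_j+1)^{-1}$, then $\{v(x),x\in T\}$ has no $m$-multiple points almost surely, i.e. almost surely there do not exist $m$ distinct points $x^1,\dots,x^m\in T$ with $v(x^1)=\dots=v(x^m)$.
   Context: Let $k,d\ge 1$ and let $v=\{v(x),x\in\mathbb{R}^k\}$ be a centered continuous $\mathbb{R}^d$-valued Gaussian random field on a probability space $(\Omega,\mathscr F,\mathbb P)$ whose components $v_1,\dots,v_d$ are i.i.d. A compact interval in $\mathbb{R}^k$ is a set $\prod_{j=1}^k[c_j,d_j]$ with $c_j<d_j$. Let $T\subset\mathbb{R}^k$ be a countable union of compact intervals. A point $z\in\mathbb{R}^d$ is an $m$-multiple point of $v$ on $T$ if with positive probability there are distinct $x^1,\dots,x^m\in T$ with $z=v(x^1)=\dots=v(x^m)$. For a random vector $X$, $\|X\|_{L^2}=(\mathrm E|X|^2)^{1/2}$, $|\cdot|$ the Euclidean norm. Assumption 1: There is a centered Gaussian random field $\{v(A,x):A\in\mathscr B(\mathbb{R}_+),x\in T\}$ ($\mathscr B(\mathbb{R}_+)$ the Borel sets of $[0,\infty)$) such that (a) for each $x\in T$, $A\mapsto v(A,x)$ is an $\mathbb{R}^d$-valued white noise (or more generally an independently scattered Gaussian noise with some control measure) with i.i.d.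 components, $v(\mathbb{R}_+,x)=v(x)$, and $v(A,\cdot)$, $v(B,\cdot)$ are independent whenever $A\cap B=\emptyset$; (b) there are constants $\gamma_1,\dots,\gamma_k>0$ such that for every compact interval $F\subset T$ there exist $c_0>0$, $a_0\ge 0$ with, for all $a_0\le a\le b\le\infty$ (with $b^{-1}=0$ if $b=\infty$) and all $x,y\in F$, $\|v([a,b),x)-v(x)-v([a,b),y)+v(y)\|_{L^2}\le c_0\big(\sum_{j=1}^k a^{\gamma_j}|x_j-y_j|+b^{-1}\big)$ and $\|v([0,a_0),x)-v([0,a_0),y)\|_{L^2}\le c_0\sum_{j=1}^k|x_j-y_j|$. Notation: $\alpha_j=(\gamma_j+1)^{-1}$, $Q=\sum_{j=1}^k\alpha_j^{-1}$, $\Delta(x,y)=\sum_{j=1}^k|x_j-y_j|^{\alpha_j}$, and $B_r(x)=\prod_{j=1}^k[x_j-r^{1/\alpha_j},x_j+r^{1/\alpha_j}]$. Assumption 2: For every compact interval $F\subset T$ there exist constants $0<\varepsilon_0\le1$, $c\ge 3$, $c'\ge 2c$ and $\delta_j\in(\alpha_j,1]$ ($j=1,\dots,k$) such that for every $0<\rho\le\varepsilon_0$ there is a finite constant $C$ (possibly depending on $F,\rho,\delta_j$) with the following property: for every $x\in F$ with $B_{c\rho}(x)\subset F$ there is $x'\in B_{c\rho}(x)$ such that for every $i=1,\dots,d$, $|\mathrm E((v_i(y)-v_i(\bar y))v_i(x'))|\le C\sum_{j=1}^k|y_j-\bar y_j|^{\delta_j}$ for all $y,\bar y$ in each of the cases: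 (i) $y,\bar y\in B_{2\rho}(x)$; (ii) $y,\bar y\in B_{2\rho}(\tilde x)$ for any $\tilde x$ with $B_{2\rho}(\tilde x)\subset F$ and $\Delta(x,\tilde x)\ge c'\rho$. Assumption 3: For any $m$ distinct points $x^1,\dots,x^m\in T$, the Gaussian vector $(v_1(x^1),\dots,v_1(x^m))$ is non-degenerate (equivalently, $v_1(x^1),\dots,v_1(x^m)$ are linearly independent). *)

theory Defs
  imports "HOL-Probability.Probability"
begin

definition centered_gaussian_rv :: "'w measure \<Rightarrow> ('w \<Rightarrow> real) \<Rightarrow> bool" where
  "centered_gaussian_rv M X \<longleftrightarrow> X \<in> borel_measurable M \<and>
     ((AE \<omega> in M. X \<omega> = 0) \<or> (\<exists>\<sigma>>0. distributed M lborel X (normal_density 0 \<sigma>)))"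

definition centered_gaussian_family :: "'w measure \<Rightarrow> 'i set \<Rightarrow> ('i \<Rightarrow> 'w \<Rightarrow> real) \<Rightarrow> bool" where
  "centered_gaussian_family M I X \<longleftrightarrow>
     (\<forall>F c. finite F \<and> F \<subseteq> I \<longrightarrow> centered_gaussian_rv M (\<lambda>\<omega>. \<Sum>i\<in>F. c i * X i \<omega>))"

definition borel_Rplus :: "real set set" where
  "borel_Rplus = {A. A \<in> sets borel \<and> A \<subseteq> {0..}}"

definition L2norm :: "'w measure \<Rightarrow> ('w \<Rightarrow> 'b::real_normed_vector) \<Rightarrow> real" where
  "L2norm M X = sqrt (\<integral>\<omega>. (norm (X \<omega>))\<^sup>2 \<partial>M)"

definition compact_interval :: "(real^'k) set \<Rightarrow> bool" where
  "compact_interval F \<longleftrightarrow> (\<exists>a b. (\<forall>j. a$j < b$j) \<and> F = cbox a b)"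

definition countable_union_of_compact_intervals :: "(real^'k) set \<Rightarrow> bool" where
  "countable_union_of_compact_intervals T \<longleftrightarrow>
     (\<exists>\<F>. countable \<F> \<and> (\<forall>F\<in>\<F>. compact_interval F) \<and> T = \<Union>\<F>)"

definition alpha :: "('k \<Rightarrow> real) \<Rightarrow> 'k \<Rightarrow> real" where
  "alpha \<gamma> j = 1 / (\<gamma> j + 1)"

definition Qdim :: "('k::finite \<Rightarrow> real) \<Rightarrow> real" where
  "Qdim \<gamma> = (\<Sum>j\<in>UNIV. 1 / alpha \<gamma> j)"

definition Delta :: "('k::finite \<Rightarrow> real) \<Rightarrow> real^'k \<Rightarrow> real^'k \<Rightarrow> real" where
  "Delta \<gamma> x y = (\<Sum>j\<in>UNIV. \<bar>x$j - y$j\<bar> powr alpha \<gamma> j)"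

definition Bbox :: "('k::finite \<Rightarrow> real) \<Rightarrow> real \<Rightarrow> real^'k \<Rightarrow> (real^'k) set" where
  "Bbox \<gamma> r x = {y. \<forall>j. \<bar>y$j - x$j\<bar> \<le> r powr (1 / alpha \<gamma> j)}"

definition centered_cont_gaussian_field_iid ::
  "'w measure \<Rightarrow> (real^'k \<Rightarrow> 'w \<Rightarrow> real^'d) \<Rightarrow> bool" where
  "centered_cont_gaussian_field_iid M v \<longleftrightarrow>
     centered_gaussian_family M UNIV (\<lambda>(x,i) \<omega>. v x \<omega> $ i) \<and>
     (AE \<omega> in M. continuous_on UNIV (\<lambda>x. v x \<omega>)) \<and>
     prob_space.indep_vars M (\<lambda>_. Pi\<^sub>M UNIV (\<lambda>_. borel)) (\<lambda>i \<omega>. (\<lambda>x. v x \<omega> $ i)) UNIV \<and>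
     (\<forall>i i'. distr M (Pi\<^sub>M UNIV (\<lambda>_. borel)) (\<lambda>\<omega> x. v x \<omega> $ i)
            = distr M (Pi\<^sub>M UNIV (\<lambda>_. borel)) (\<lambda>\<omega> x. v x \<omega> $ i'))"

text \<open>For fixed x: A |-> N A x is an R^d-valued independently scattered Gaussian noise on the
  Borel sets of R_+ (white noise in Walsh's sense with a control measure mu), with i.i.d.
  components.\<close>
definition indep_scattered_gaussian_noise ::
  "'w measure \<Rightarrow> (real set \<Rightarrow> 'w \<Rightarrow> real^'d) \<Rightarrow> bool" where
  "indep_scattered_gaussian_noise M W \<longleftrightarrow>
     (\<exists>\<mu>::real measure. sets \<mu> = sets borel \<and>
        (\<forall>A\<in>borel_Rplus. emeasure \<mu> A < \<infinity> \<and>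
           (\<forall>i. centered_gaussian_rv M (\<lambda>\<omega>. W A \<omega> $ i) \<and>
                (\<integral>\<omega>. (W A \<omega> $ i)\<^sup>2 \<partial>M) = measure \<mu> A))) \<and>
     (\<forall>A\<in>borel_Rplus. \<forall>B\<in>borel_Rplus. A \<inter> B = {} \<longrightarrow>
        (AE \<omega> in M. W (A \<union> B) \<omega> = W A \<omega> + W B \<omega>) \<and>
        prob_space.indep_var M borel (W A) borel (W B)) \<and>
     prob_space.indep_vars M (\<lambda>_. Pi\<^sub>M borel_Rplus (\<lambda>_. borel))
        (\<lambda>i \<omega>. restrict (\<lambda>A. W A \<omega> $ i) borel_Rplus) UNIV \<and>
     (\<forall>i i'. distr M (Pi\<^sub>M borel_Rplus (\<lambda>_. borel)) (\<lambda>\<omega>. restrict (\<lambda>A. W A \<omega> $ i) borel_Rplus)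
            = distr M (Pi\<^sub>M borel_Rplus (\<lambda>_. borel)) (\<lambda>\<omega>. restrict (\<lambda>A. W A \<omega> $ i') borel_Rplus))"

definition assumption1 ::
  "'w measure \<Rightarrow> (real^'k \<Rightarrow> 'w \<Rightarrow> real^'d) \<Rightarrow> (real^'k) set \<Rightarrow>
   (real set \<Rightarrow> real^'k \<Rightarrow> 'w \<Rightarrow> real^'d) \<Rightarrow> ('k \<Rightarrow> real) \<Rightarrow> bool" where
  "assumption1 M v T N \<gamma> \<longleftrightarrow>
     \<comment> \<open>(a)\<close>
     centered_gaussian_family M {(A,x,i). A \<in> borel_Rplus \<and> x \<in> T} (\<lambda>(A,x,i) \<omega>. N A x \<omega> $ i) \<and>
     (\<forall>x\<in>T. indep_scattered_gaussian_noise M (\<lambda>A. N A x)) \<and>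
     (\<forall>x\<in>T. AE \<omega> in M. N {0..} x \<omega> = v x \<omega>) \<and>
     (\<forall>A\<in>borel_Rplus. \<forall>B\<in>borel_Rplus. A \<inter> B = {} \<longrightarrow>
        prob_space.indep_var M (Pi\<^sub>M T (\<lambda>_. borel)) (\<lambda>\<omega>. restrict (\<lambda>x. N A x \<omega>) T)
                               (Pi\<^sub>M T (\<lambda>_. borel)) (\<lambda>\<omega>. restrict (\<lambda>x. N B x \<omega>) T)) \<and>
     \<comment> \<open>(b)\<close>
     (\<forall>j. \<gamma> j > 0) \<and>
     (\<forall>F. compact_interval F \<and> F \<subseteq> T \<longrightarrow>
        (\<exists>c0>0. \<exists>a0\<ge>0.
           (\<forall>a b x y. a0 \<le> a \<and> a \<le> b \<and> 0 < b \<and> x \<in> F \<and> y \<in> F \<longrightarrow>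
              L2norm M (\<lambda>\<omega>. N {a..<b} x \<omega> - v x \<omega> - N {a..<b} y \<omega> + v y \<omega>)
                \<le> c0 * ((\<Sum>j\<in>UNIV. a powr \<gamma> j * \<bar>x$j - y$j\<bar>) + 1 / b)) \<and>
           (\<forall>a x y. a0 \<le> a \<and> x \<in> F \<and> y \<in> F \<longrightarrow>
              L2norm M (\<lambda>\<omega>. N {a..} x \<omega> - v x \<omega> - N {a..} y \<omega> + v y \<omega>)
                \<le> c0 * (\<Sum>j\<in>UNIV. a powr \<gamma> j * \<bar>x$j - y$j\<bar>)) \<and>
           (\<forall>x y. x \<in> F \<and> y \<in> F \<longrightarrow>
              L2norm M (\<lambda>\<omega>. N {0..<a0} x \<omega> - N {0..<a0} y \<omega>)
                \<le> c0 * (\<Sum>j\<in>UNIV. \<bar>x$j - y$j\<bar>))))"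

definition assumption2 ::
  "'w measure \<Rightarrow> (real^'k \<Rightarrow> 'w \<Rightarrow> real^'d) \<Rightarrow> (real^'k) set \<Rightarrow> ('k \<Rightarrow> real) \<Rightarrow> bool" where
  "assumption2 M v T \<gamma> \<longleftrightarrow>
     (\<forall>F. compact_interval F \<and> F \<subseteq> T \<longrightarrow>
       (\<exists>\<epsilon>0 c c' \<delta>. 0 < \<epsilon>0 \<and> \<epsilon>0 \<le> 1 \<and> c \<ge> 3 \<and> c' \<ge> 2 * c \<and>
          (\<forall>j. alpha \<gamma> j < \<delta> j \<and> \<delta> j \<le> 1) \<and>
          (\<forall>\<rho>. 0 < \<rho> \<and> \<rho> \<le> \<epsilon>0 \<longrightarrow>
             (\<exists>C::real. \<forall>x\<in>F. Bbox \<gamma> (c * \<rho>) x \<subseteq> F \<longrightarrow>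
                (\<exists>x'\<in>Bbox \<gamma> (c * \<rho>) x. \<forall>i.
                   (\<forall>y ybar. y \<in> Bbox \<gamma> (2 * \<rho>) x \<and> ybar \<in> Bbox \<gamma> (2 * \<rho>) x \<longrightarrow>
                      \<bar>\<integral>\<omega>. (v y \<omega> $ i - v ybar \<omega> $ i) * v x' \<omega> $ i \<partial>M\<bar>
                        \<le> C * (\<Sum>j\<in>UNIV. \<bar>y$j - ybar$j\<bar> powr \<delta> j)) \<and>
                   (\<forall>xt. Bbox \<gamma> (2 * \<rho>) xt \<subseteq> F \<and> Delta \<gamma> x xt \<ge> c' * \<rho> \<longrightarrow>
                      (\<forall>y ybar. y \<in> Bbox \<gamma> (2 * \<rho>) xt \<and> ybar \<in> Bbox \<gamma> (2 * \<rho>) xt \<longrightarrow>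
                         \<bar>\<integral>\<omega>. (v y \<omega> $ i - v ybar \<omega> $ i) * v x' \<omega> $ i \<partial>M\<bar>
                           \<le> C * (\<Sum>j\<in>UNIV. \<bar>y$j - ybar$j\<bar> powr \<delta> j))))))))"

definition assumption3 ::
  "'w measure \<Rightarrow> (real^'k \<Rightarrow> 'w \<Rightarrow> real^'d) \<Rightarrow> (real^'k) set \<Rightarrow> nat \<Rightarrow> bool" where
  "assumption3 M v T m \<longleftrightarrow>
     (\<forall>xs::nat \<Rightarrow> real^'k. (\<forall>l<m. xs l \<in> T) \<and> inj_on xs {..<m} \<longrightarrow>
        (\<forall>i c. (\<exists>l<m. c l \<noteq> (0::real)) \<longrightarrow>
           \<not> (AE \<omega> in M. (\<Sum>l<m. c l * v (xs l) \<omega> $ i) = 0)))"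

end

theory Submission
  imports Defs
begin

text \<open>
  Fix pairwise separated small boxes and cut the noise at a high frequency \<open>2^\<nu>\<close>. The low-frequency
  part is smooth on cells of size below \<open>2^(-2\<nu>)\<close>, and, conditionally on the independent
  high-frequency part, it gives the increments between the boxes a bounded density. The oscillation of the
  high-frequency part on a cell of size \<open>r\<close> is governed by the noise at frequencies near \<open>1 / r\<close>, so it
  is nearly independent over well separated scales; at each scale it is below \<open>\<epsilon> r\<close> with a probability
  bounded below, hence with high probability some scale among a fixed number of them is good. Covering by the
  first good cells costs \<open>\<epsilon>^((m - 1) d)\<close> times the total volume when \<open>m Q \<le> (m - 1) d\<close>, and the cells
  without a good scale contribute little because they are rare and their number of hits has controlled moments.
\<close>

subsection \<open>Gaussian random variables\<close>

text \<open>At one scale \<open>2^(-n)\<close> there are about \<open>2^(n m Q)\<close> tuples of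
  cells, each hit with probability of order \<open>2^(-n (m - 1) d)\<close>. In the critical case
  \<open>m Q = (m - 1) d\<close> the product is merely bounded, so no fixed scale decides the
  matter; the gain has to come from cells whose oscillation is atypically small, by a factor
  \<open>\<epsilon>\<close>. The scale at which this happens is random and differs from cell to
  cell. Two facts keep it under control. Whether a cell is good depends only on the noise above the
  cut-off, whereas the density comes from the independent noise below it, so selection and hitting
  decouple. And weighting a cell by its share of the finest grid makes the first good cells along
  each branch a disjoint family, so many scales cost no more than one. Constants are chosen in the
  order \<open>\<epsilon>\<close>, truncation level, admissible probability of finding no good
  scale, number and spacing of scales, and the cut-off last: the finest level is then
  \<open>2 \<nu>\<close> plus a constant, and the low-frequency gain \<open>2^(-g \<nu>)\<close>,
  raised to a high moment, outweighs the number of cells.\<close>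

lemma centered_gaussian_rv_moments:
  assumes "prob_space M" "centered_gaussian_rv M X"
  shows "integrable M (\<lambda>\<omega>. X \<omega> ^ (2 * k))"
    and "(\<integral>\<omega>. X \<omega> ^ (2 * k) \<partial>M) = (\<integral>\<omega>. (X \<omega>)\<^sup>2 \<partial>M) ^ k * (fact (2 * k) / (2 ^ k * fact k))"
    and "(CLINT \<omega>|M. iexp (X \<omega>)) = exp (- (\<integral>\<omega>. (X \<omega>)\<^sup>2 \<partial>M) / 2)"
    and "integrable M X" and "(\<integral>\<omega>. X \<omega> \<partial>M) = 0"
proof -
  interpret prob_space M by fact
  have [measurable]: "X \<in> borel_measurable M"
    using assms(2) by (simp add: centered_gaussian_rv_def)
  consider "AE \<omega> in M. X \<omega> = 0" | \<sigma> where "\<sigma> > 0" "distributed M lborel X (normal_density 0 \<sigma>)"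
    using assms(2) by (auto simp: centered_gaussian_rv_def)
  then have "integrable M (\<lambda>\<omega>. X \<omega> ^ (2 * k)) \<and>
      (\<integral>\<omega>. X \<omega> ^ (2 * k) \<partial>M) = (\<integral>\<omega>. (X \<omega>)\<^sup>2 \<partial>M) ^ k * (fact (2 * k) / (2 ^ k * fact k)) \<and>
      (CLINT \<omega>|M. iexp (X \<omega>)) = exp (- (\<integral>\<omega>. (X \<omega>)\<^sup>2 \<partial>M) / 2) \<and>
      integrable M X \<and> (\<integral>\<omega>. X \<omega> \<partial>M) = 0"
  proof cases
    case 1
    have e: "(\<integral>\<omega>. X \<omega> ^ j \<partial>M) = (\<integral>\<omega>. 0 ^ j \<partial>M)" for j
      using 1 by (intro integral_cong_AE) auto
    have i: "integrable M (\<lambda>\<omega>. X \<omega> ^ j)" for j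
      using 1 by (subst integrable_cong_AE[of _ _ "\<lambda>\<omega>. 0 ^ j"]) auto
    have c: "(CLINT \<omega>|M. iexp (X \<omega>)) = (CLINT \<omega>|M. 1)"
      using 1 by (intro integral_cong_AE) auto
    \<comment> \<open>The case \<open>k = 0\<close> is separate because
      \<open>0 ^ 0 = 1\<close>.\<close>
    show ?thesis
      using e[of "2*k"] e[of 2] e[of 1] i[of "2*k"] i[of 1] c
      by (cases k) (auto simp: prob_space)
  next
    case 2
    note d = \<open>distributed M lborel X (normal_density 0 \<sigma>)\<close>
    have even: "integrable M (\<lambda>\<omega>. X \<omega> ^ (2 * j))"
        "(\<integral>\<omega>. X \<omega> ^ (2 * j) \<partial>M) = fact (2 * j) / ((2 / \<sigma>\<^sup>2)^j * fact j)" for j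
      using normal_moment_even[OF \<open>\<sigma> > 0\<close>, of 0 j]
        distributed_integrable[OF d, of "\<lambda>x. x ^ (2*j)"]
        distributed_integral[OF d, of "\<lambda>x. x ^ (2*j)"]
      by (auto simp: has_bochner_integral_iff normal_density_nonneg)
    have odd: "integrable M X" "(\<integral>\<omega>. X \<omega> \<partial>M) = 0"
      using normal_moment_odd[OF \<open>\<sigma> > 0\<close>, of 0 0]
        distributed_integrable[OF d, of "\<lambda>x. x"]
        distributed_integral[OF d, of "\<lambda>x. x"]
      by (auto simp: has_bochner_integral_iff normal_density_nonneg)
    have v: "(\<integral>\<omega>. (X \<omega>)\<^sup>2 \<partial>M) = \<sigma>\<^sup>2"
      using even(2)[of 1] by (simp add: fact_numeral)
    have "distributed M lborel (\<lambda>x. (X x - 0) / \<sigma>) std_normal_density"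
      using normal_standard_normal_convert[OF \<open>\<sigma> > 0\<close>, of X 0] d by simp
    then have ds: "distr M lborel (\<lambda>x. X x / \<sigma>) = std_normal_distribution"
      by (simp add: distributed_def)
    have "(CLINT \<omega>|M. iexp (X \<omega>)) = (CLINT \<omega>|M. iexp (\<sigma> * (X \<omega> / \<sigma>)))"
      using \<open>\<sigma> > 0\<close> by simp
    also have "\<dots> = (CLINT x|distr M lborel (\<lambda>x. X x / \<sigma>). iexp (\<sigma> * x))"
      by (subst integral_distr) auto
    also have "\<dots> = char std_normal_distribution \<sigma>"
      unfolding ds char_def by simp
    finally have ch: "(CLINT \<omega>|M. iexp (X \<omega>)) = exp (- \<sigma>\<^sup>2 / 2)"
      unfolding char_std_normal_distribution by simp
    show ?thesis
      using even[of k] odd ch v \<open>\<sigma> > 0\<close>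
      by (auto simp: power_divide power_mult field_simps)
  qed
  then show "integrable M (\<lambda>\<omega>. X \<omega> ^ (2 * k))"
    and "(\<integral>\<omega>. X \<omega> ^ (2 * k) \<partial>M) = (\<integral>\<omega>. (X \<omega>)\<^sup>2 \<partial>M) ^ k * (fact (2 * k) / (2 ^ k * fact k))"
    and "(CLINT \<omega>|M. iexp (X \<omega>)) = exp (- (\<integral>\<omega>. (X \<omega>)\<^sup>2 \<partial>M) / 2)"
    and "integrable M X" and "(\<integral>\<omega>. X \<omega> \<partial>M) = 0"
    by auto
qed

text \<open>One-dimensional uniqueness for weighted laws, reduced to probability laws by normalising.\<close>

lemma weighted_char_unique:
  fixes w :: "'a \<Rightarrow> real" and w' :: "'b \<Rightarrow> real"
  assumes "prob_space M" "prob_space M'"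
    and [measurable]: "X \<in> borel_measurable M" "X' \<in> borel_measurable M'"
      "w \<in> borel_measurable M" "w' \<in> borel_measurable M'" "B \<in> sets borel"
    and w: "\<And>\<omega>. 0 \<le> w \<omega>" "\<And>\<omega>. w \<omega> \<le> b" "\<And>\<omega>. 0 \<le> w' \<omega>" "\<And>\<omega>. w' \<omega> \<le> b"
    and eq: "\<And>\<theta>. (CLINT \<omega>|M. w \<omega> * iexp (\<theta> * X \<omega>)) = (CLINT \<omega>|M'. w' \<omega> * iexp (\<theta> * X' \<omega>))"
  shows "(LINT \<omega>|M. w \<omega> * indicator B (X \<omega>)) = (LINT \<omega>|M'. w' \<omega> * indicator B (X' \<omega>))"
proof -
  interpret M: prob_space M by fact
  interpret M': prob_space M' by fact
  have iw: "integrable M w" "integrable M' w'"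
    using w by (auto intro!: M.integrable_const_bound[of _ b] M'.integrable_const_bound[of _ b])
  define c where "c = (LINT \<omega>|M. w \<omega>)"
  have "complex_of_real (LINT \<omega>|M. w \<omega>) = of_real (LINT \<omega>|M'. w' \<omega>)"
    using eq[of 0] by simp
  then have c': "c = (LINT \<omega>|M'. w' \<omega>)" by (simp add: c_def)
  have c0: "0 \<le> c" unfolding c_def using w by (intro Bochner_Integration.integral_nonneg) auto
  \<comment> \<open>Total mass zero cannot be normalised; both weights then vanish almost
    everywhere.\<close>
  show ?thesis
  proof (cases "c = 0")
    case True
    have "AE \<omega> in M. w \<omega> = 0" "AE \<omega> in M'. w' \<omega> = 0"
      using True c' iw w
      by (simp_all add: c_def flip: integral_nonneg_eq_0_iff_AE[OF iw(1)] integral_nonneg_eq_0_iff_AE[OF iw(2)])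
    then have "(LINT \<omega>|M. w \<omega> * indicator B (X \<omega>)) = 0"
      "(LINT \<omega>|M'. w' \<omega> * indicator B (X' \<omega>)) = 0"
      by (auto intro!: integral_eq_zero_AE elim: eventually_mono)
    then show ?thesis by simp
  next
    case False
    then have cp: "c > 0" using c0 by simp
    define \<mu> where "\<mu> = distr (density M (\<lambda>\<omega>. w \<omega> / c)) borel X"
    define \<mu>' where "\<mu>' = distr (density M' (\<lambda>\<omega>. w' \<omega> / c)) borel X'"
    have p: "prob_space (density M (\<lambda>\<omega>. w \<omega> / c))" "prob_space (density M' (\<lambda>\<omega>. w' \<omega> / c))"
      using cp w iw c' by (auto intro!: prob_spaceI simp: emeasure_density nn_integral_eq_integral c_def)
    have "real_distribution \<mu>" "real_distribution \<mu>'"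
      using p by (auto simp: \<mu>_def \<mu>'_def real_distribution_def real_distribution_axioms_def
          intro!: prob_space.prob_space_distr)
    moreover have "char \<mu> = char \<mu>'"
    proof
      fix t
      have "char \<mu> t = (CLINT \<omega>|M. (w \<omega> / c) *\<^sub>R iexp (t * X \<omega>))"
        unfolding \<mu>_def char_def using w cp
        by (subst integral_distr, simp, simp) (subst integral_density, auto)
      also have "\<dots> = (CLINT \<omega>|M. w \<omega> * iexp (t * X \<omega>)) / c"
        by (simp add: scaleR_conv_of_real)
      also have "\<dots> = (CLINT \<omega>|M'. w' \<omega> * iexp (t * X' \<omega>)) / c"
        by (simp only: eq)
      also have "\<dots> = (CLINT \<omega>|M'. (w' \<omega> / c) *\<^sub>R iexp (t * X' \<omega>))"
        by (simp add: scaleR_conv_of_real)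
      also have "\<dots> = char \<mu>' t"
        unfolding \<mu>'_def char_def using w cp
        by (subst integral_distr, simp, simp) (subst integral_density, auto)
      finally show "char \<mu> t = char \<mu>' t" .
    qed
    ultimately have e: "\<mu> = \<mu>'" by (rule Levy_uniqueness)
    have "(LINT x|\<mu>. indicator B x) = (LINT \<omega>|M. (w \<omega> / c) * indicator B (X \<omega>))"
      unfolding \<mu>_def using w cp
      by (subst integral_distr, simp, simp) (subst integral_density, auto)
    moreover have "(LINT x|\<mu>'. indicator B x) = (LINT \<omega>|M'. (w' \<omega> / c) * indicator B (X' \<omega>))"
      unfolding \<mu>'_def using w cp
      by (subst integral_distr, simp, simp) (subst integral_density, auto)
    ultimately show ?thesis using e cp by simp
  qed
qed

lemma integral_lin3:
  assumes "complex_integrable P f" "complex_integrable P g" "complex_integrable P k"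
  shows "(CLINT \<omega>|P. f \<omega> + (\<alpha> * g \<omega> + \<beta> * k \<omega>)) =
    (CLINT \<omega>|P. f \<omega>) + (\<alpha> * (CLINT \<omega>|P. g \<omega>) + \<beta> * (CLINT \<omega>|P. k \<omega>))"
  using assms by simp

text \<open>Joint laws are reduced to one-dimensional Levy uniqueness, one coordinate at a time. In
  the claim of the proof the coordinates in \<open>F\<close> already carry indicators while the
  others still carry frequencies; \<open>F\<close> grows from the empty set, which is the
  hypothesis, to \<open>S\<close>, which is the conclusion.\<close>

lemma rectangle_prob_unique:
  fixes X :: "'s \<Rightarrow> 'a \<Rightarrow> real" and X' :: "'s \<Rightarrow> 'b \<Rightarrow> real"
  assumes "prob_space M" "prob_space M'" "finite S"
    and [measurable]: "\<And>s. s \<in> S \<Longrightarrow> X s \<in> borel_measurable M"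
      "\<And>s. s \<in> S \<Longrightarrow> X' s \<in> borel_measurable M'" "\<And>s. s \<in> S \<Longrightarrow> B s \<in> sets borel"
    and eq: "\<And>\<xi>. (CLINT \<omega>|M. iexp (\<Sum>s\<in>S. \<xi> s * X s \<omega>)) = (CLINT \<omega>|M'. iexp (\<Sum>s\<in>S. \<xi> s * X' s \<omega>))"
  shows "measure M {\<omega>\<in>space M. \<forall>s\<in>S. X s \<omega> \<in> B s} = measure M' {\<omega>\<in>space M'. \<forall>s\<in>S. X' s \<omega> \<in> B s}"
proof -
  interpret M: prob_space M by fact
  interpret M': prob_space M' by fact
  define h where "h F \<omega> = (\<Prod>s\<in>F. indicator (B s) (X s \<omega>) :: real)" for F \<omega>
  define h' where "h' F \<omega> = (\<Prod>s\<in>F. indicator (B s) (X' s \<omega>) :: real)" for F \<omega>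
  have h01: "0 \<le> h F \<omega>" "h F \<omega> \<le> 1" "0 \<le> h' F \<omega>'" "h' F \<omega>' \<le> 1" for F \<omega> \<omega>'
    by (auto simp: h_def h'_def intro!: prod_nonneg prod_le_1)
  have cosp: "0 \<le> 1 + cos x" "1 + cos x \<le> 2" for x :: real
    using cos_ge_minus_one[of x] cos_le_one[of x] by linarith+
  have claim: "(CLINT \<omega>|M. h F \<omega> * iexp (\<Sum>s\<in>S - F. \<xi> s * X s \<omega>)) =
    (CLINT \<omega>|M'. h' F \<omega> * iexp (\<Sum>s\<in>S - F. \<xi> s * X' s \<omega>))" if "F \<subseteq> S" for F \<xi>
    using finite_subset[OF that \<open>finite S\<close>] that
  proof (induction F arbitrary: \<xi> rule: finite_induct)
    case empty
    show ?case using eq[of \<xi>] by (simp add: h_def h'_def)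
  next
    case (insert s F)
    have sS: "s \<in> S" and FS: "F \<subseteq> S" using insert by auto
    note [measurable] = subsetD[OF FS]
    have fin: "finite (S - F)" "finite F" using \<open>finite S\<close> insert by auto
    define R where "R = S - insert s F"
    have SF: "S - F = insert s R" "s \<notin> R" "finite R" using sS insert fin by (auto simp: R_def)
    define T where "T \<omega> = (\<Sum>r\<in>R. \<xi> r * X r \<omega>)" for \<omega>
    define T' where "T' \<omega> = (\<Sum>r\<in>R. \<xi> r * X' r \<omega>)" for \<omega>
    have [measurable]: "h F \<in> borel_measurable M" "h' F \<in> borel_measurable M'"
      unfolding h_def h'_def by measurable
    have [measurable]: "T \<in> borel_measurable M" "T' \<in> borel_measurable M'"
      unfolding T_def T'_def by (auto simp: R_def)
    have [measurable]: "X s \<in> borel_measurable M" "X' s \<in> borel_measurable M'" "B s \<in> sets borel"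
      using sS by auto
    have IH: "(CLINT \<omega>|M. h F \<omega> * iexp (\<epsilon> * T \<omega> + \<theta> * X s \<omega>)) =
        (CLINT \<omega>|M'. h' F \<omega> * iexp (\<epsilon> * T' \<omega> + \<theta> * X' s \<omega>))" for \<epsilon> \<theta> :: real
    proof -
      have "(\<Sum>r\<in>R. (if r = s then \<theta> else \<epsilon> * \<xi> r) * f r) = \<epsilon> * (\<Sum>r\<in>R. \<xi> r * f r)" for f
        using SF by (auto simp: sum_distrib_left intro!: sum.cong)
      then show ?thesis
        using insert.IH[OF FS, of "\<lambda>r. if r = s then \<theta> else \<epsilon> * \<xi> r"] SF
        by (simp add: T_def T'_def add.commute)
    qed
    have int: "integrable M (\<lambda>\<omega>. of_real (h F \<omega>) * iexp (g \<omega>))"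
      if [measurable]: "g \<in> borel_measurable M" for g
      using h01 by (intro M.integrable_const_bound[of _ 1]) (auto simp: norm_mult)
    have int': "integrable M' (\<lambda>\<omega>. of_real (h' F \<omega>) * iexp (g \<omega>))"
      if [measurable]: "g \<in> borel_measurable M'" for g
      using h01 by (intro M'.integrable_const_bound[of _ 1]) (auto simp: norm_mult)
    have cosexp: "complex_of_real (1 + cos (t + \<psi>)) * iexp u =
        iexp u + (iexp \<psi> * iexp (t + u) + iexp (-\<psi>) * iexp (- t + u)) / 2" for t \<psi> u
    proof -
      have "complex_of_real (cos (t + \<psi>)) = (iexp (t + \<psi>) + iexp (- (t + \<psi>))) / 2"
        unfolding cos_of_real[symmetric] by (simp add: cos_exp_eq algebra_simps)
      moreover have "iexp \<psi> * iexp (t + u) = iexp (t + \<psi>) * iexp u"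
        "iexp (- \<psi>) * iexp (- t + u) = iexp (- (t + \<psi>)) * iexp u"
        by (simp_all flip: exp_add) (simp_all add: algebra_simps)
      ultimately show ?thesis
        by (simp only: of_real_add of_real_1) (simp add: algebra_simps add_divide_distrib)
    qed
    have hcos: "complex_of_real (x * (1 + cos (t + \<psi>))) * iexp u = of_real x * iexp u +
        (iexp \<psi> / 2 * (of_real x * iexp (t + u)) + iexp (-\<psi>) / 2 * (of_real x * iexp (- t + u)))" for x t u \<psi>
    proof -
      have "a * (A + (B * C + D * E) / 2) = a * A + (B / 2 * (a * C) + D / 2 * (a * E))" for a A B C D E :: complex
        by (simp add: algebra_simps add_divide_distrib)
      then show ?thesis
        unfolding of_real_mult mult.assoc cosexp by simp
    qed
    \<comment> \<open>The factor \<open>iexp (T \<omega>)\<close> of the untreated coordinates is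
      complex and cannot serve as a weight. The nonnegative weights
      \<open>h F * (1 + cos (T + \<psi>))\<close> replace it; expanding the cosine leaves the
      frequencies 0, 1 and -1 of \<open>T\<close>, all covered by the induction hypothesis.\<close>
    have w: "(LINT \<omega>|M. (h F \<omega> * (1 + cos (T \<omega> + \<psi>))) * indicator (B s) (X s \<omega>)) =
        (LINT \<omega>|M'. (h' F \<omega> * (1 + cos (T' \<omega> + \<psi>))) * indicator (B s) (X' s \<omega>))" for \<psi>
    proof (rule weighted_char_unique[OF assms(1,2), where b = 2])
      show "0 \<le> h F \<omega> * (1 + cos (T \<omega> + \<psi>))" for \<omega>
        using h01 cosp by (auto intro!: mult_nonneg_nonneg)
      show "0 \<le> h' F \<omega> * (1 + cos (T' \<omega> + \<psi>))" for \<omega>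
        using h01 cosp by (auto intro!: mult_nonneg_nonneg)
      show "h F \<omega> * (1 + cos (T \<omega> + \<psi>)) \<le> 2" for \<omega>
      proof -
        have "h F \<omega> * (1 + cos (T \<omega> + \<psi>)) \<le> 1 * 2"
          using h01 cosp
          by (intro mult_mono) auto
        then show ?thesis by simp
      qed
      show "h' F \<omega> * (1 + cos (T' \<omega> + \<psi>)) \<le> 2" for \<omega>
      proof -
        have "h' F \<omega> * (1 + cos (T' \<omega> + \<psi>)) \<le> 1 * 2"
          using h01 cosp
          by (intro mult_mono) auto
        then show ?thesis by simp
      qed
      fix \<theta>
      have e1: "complex_of_real (h F \<omega> * (1 + cos (T \<omega> + \<psi>))) * iexp (\<theta> * X s \<omega>) =
          of_real (h F \<omega>) * iexp (\<theta> * X s \<omega>) +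
          (iexp \<psi> / 2 * (of_real (h F \<omega>) * iexp (T \<omega> + \<theta> * X s \<omega>)) +
           iexp (-\<psi>) / 2 * (of_real (h F \<omega>) * iexp (- T \<omega> + \<theta> * X s \<omega>)))" for \<omega>
        by (rule hcos)
      have e2: "complex_of_real (h' F \<omega> * (1 + cos (T' \<omega> + \<psi>))) * iexp (\<theta> * X' s \<omega>) =
          of_real (h' F \<omega>) * iexp (\<theta> * X' s \<omega>) +
          (iexp \<psi> / 2 * (of_real (h' F \<omega>) * iexp (T' \<omega> + \<theta> * X' s \<omega>)) +
           iexp (-\<psi>) / 2 * (of_real (h' F \<omega>) * iexp (- T' \<omega> + \<theta> * X' s \<omega>)))" for \<omega>
        by (rule hcos)
      show "(CLINT \<omega>|M. complex_of_real (h F \<omega> * (1 + cos (T \<omega> + \<psi>))) * iexp (\<theta> * X s \<omega>)) =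
        (CLINT \<omega>|M'. complex_of_real (h' F \<omega> * (1 + cos (T' \<omega> + \<psi>))) * iexp (\<theta> * X' s \<omega>))"
      proof -
        have "complex_integrable M (\<lambda>\<omega>. of_real (h F \<omega>) * iexp (\<theta> * X s \<omega>))"
          "complex_integrable M (\<lambda>\<omega>. of_real (h F \<omega>) * iexp (T \<omega> + \<theta> * X s \<omega>))"
          "complex_integrable M (\<lambda>\<omega>. of_real (h F \<omega>) * iexp (- T \<omega> + \<theta> * X s \<omega>))"
          by (rule int; measurable)+
        note l = integral_lin3[OF this]
        have "complex_integrable M' (\<lambda>\<omega>. of_real (h' F \<omega>) * iexp (\<theta> * X' s \<omega>))"
          "complex_integrable M' (\<lambda>\<omega>. of_real (h' F \<omega>) * iexp (T' \<omega> + \<theta> * X' s \<omega>))"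
          "complex_integrable M' (\<lambda>\<omega>. of_real (h' F \<omega>) * iexp (- T' \<omega> + \<theta> * X' s \<omega>))"
          by (rule int'; measurable)+
        note l' = integral_lin3[OF this]
        show ?thesis
          unfolding e1 e2 l l'
          using IH[of 0 \<theta>] IH[of 1 \<theta>] IH[of "-1" \<theta>] by (simp only: mult_1 mult_zero_left add_0 mult_minus1)
      qed
    qed measurable
    have w0: "(LINT \<omega>|M. h F \<omega> * indicator (B s) (X s \<omega>)) =
        (LINT \<omega>|M'. h' F \<omega> * indicator (B s) (X' s \<omega>))"
      by (rule weighted_char_unique[OF assms(1,2), where b = 1])
         (use h01 IH[of 0] in auto)
    have hb: "h (insert s F) \<omega> = h F \<omega> * indicator (B s) (X s \<omega>)" for \<omega>
      using insert by (simp add: h_def mult.commute)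
    have hb': "h' (insert s F) \<omega> = h' F \<omega> * indicator (B s) (X' s \<omega>)" for \<omega>
      using insert by (simp add: h'_def mult.commute)
    have [measurable]: "h (insert s F) \<in> borel_measurable M" "h' (insert s F) \<in> borel_measurable M'"
      unfolding hb[abs_def] hb'[abs_def] by measurable
    have intc: "integrable M (\<lambda>\<omega>. h (insert s F) \<omega> * g \<omega>)"
      if [measurable]: "g \<in> borel_measurable M" and "\<And>\<omega>. \<bar>g \<omega>\<bar> \<le> 1" for g
      using h01 that(2) by (intro M.integrable_const_bound[of _ 1]) (auto simp: abs_mult intro!: mult_le_one)
    have intc': "integrable M' (\<lambda>\<omega>. h' (insert s F) \<omega> * g \<omega>)"
      if [measurable]: "g \<in> borel_measurable M'" and "\<And>\<omega>. \<bar>g \<omega>\<bar> \<le> 1" for g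
      using h01 that(2) by (intro M'.integrable_const_bound[of _ 1]) (auto simp: abs_mult intro!: mult_le_one)
    have cs: "(LINT \<omega>|M. h (insert s F) \<omega> * cos (T \<omega> + \<psi>)) =
        (LINT \<omega>|M'. h' (insert s F) \<omega> * cos (T' \<omega> + \<psi>))" for \<psi>
    proof -
      have "(LINT \<omega>|M. h (insert s F) \<omega> * cos (T \<omega> + \<psi>)) =
        (LINT \<omega>|M. (h F \<omega> * (1 + cos (T \<omega> + \<psi>))) * indicator (B s) (X s \<omega>) - h F \<omega> * indicator (B s) (X s \<omega>))"
        by (intro Bochner_Integration.integral_cong) (auto simp: hb algebra_simps)
      also have "\<dots> = (LINT \<omega>|M. (h F \<omega> * (1 + cos (T \<omega> + \<psi>))) * indicator (B s) (X s \<omega>)) -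
          (LINT \<omega>|M. h F \<omega> * indicator (B s) (X s \<omega>))"
        using intc[of "\<lambda>_. 1"] intc[of "\<lambda>\<omega>. cos (T \<omega> + \<psi>)"]
        by (intro Bochner_Integration.integral_diff) (auto simp: hb algebra_simps intro!: Bochner_Integration.integrable_add)
      also have "\<dots> = (LINT \<omega>|M'. (h' F \<omega> * (1 + cos (T' \<omega> + \<psi>))) * indicator (B s) (X' s \<omega>)) -
          (LINT \<omega>|M'. h' F \<omega> * indicator (B s) (X' s \<omega>))"
        by (simp only: w w0)
      also have "\<dots> = (LINT \<omega>|M'. (h' F \<omega> * (1 + cos (T' \<omega> + \<psi>))) * indicator (B s) (X' s \<omega>) - h' F \<omega> * indicator (B s) (X' s \<omega>))"
        using intc'[of "\<lambda>_. 1"] intc'[of "\<lambda>\<omega>. cos (T' \<omega> + \<psi>)"]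
        by (intro Bochner_Integration.integral_diff[symmetric]) (auto simp: hb' algebra_simps intro!: Bochner_Integration.integrable_add)
      also have "\<dots> = (LINT \<omega>|M'. h' (insert s F) \<omega> * cos (T' \<omega> + \<psi>))"
        by (intro Bochner_Integration.integral_cong) (auto simp: hb' algebra_simps)
      finally show ?thesis .
    qed
    \<comment> \<open>The phase \<open>- (pi / 2)\<close> turns the cosine into the sine; together
      with phase 0 it rebuilds the exponential.\<close>
    have sn: "(LINT \<omega>|M. h (insert s F) \<omega> * sin (T \<omega>)) = (LINT \<omega>|M'. h' (insert s F) \<omega> * sin (T' \<omega>))"
    proof -
      have "cos (x + - (pi / 2)) = sin x" for x by (simp add: cos_diff)
      then show ?thesis using cs[of "- (pi / 2)"] by simp
    qed
    have cmb: "of_real x * iexp t = of_real (x * cos t) + \<i> * of_real (x * sin t)" for x t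
      by (simp add: exp_Euler cos_of_real sin_of_real algebra_simps)
    show ?case
      unfolding R_def[symmetric] T_def[symmetric] T'_def[symmetric] cmb
      using cs[of 0] sn intc[of "\<lambda>\<omega>. cos (T \<omega>)"] intc[of "\<lambda>\<omega>. sin (T \<omega>)"]
         intc'[of "\<lambda>\<omega>. cos (T' \<omega>)"] intc'[of "\<lambda>\<omega>. sin (T' \<omega>)"]
      by (subst (1 2) Bochner_Integration.integral_add) (auto simp del: of_real_mult)
  qed
  have "(LINT \<omega>|M. h S \<omega>) = (LINT \<omega>|M'. h' S \<omega>)"
  proof -
    have "complex_of_real (LINT \<omega>|M. h S \<omega>) = of_real (LINT \<omega>|M'. h' S \<omega>)"
      using claim[of S] by simp
    then show ?thesis by (simp only: of_real_eq_iff)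
  qed
  moreover have "h S \<omega> = indicator {\<omega>\<in>space M. \<forall>s\<in>S. X s \<omega> \<in> B s} \<omega>" if "\<omega> \<in> space M" for \<omega>
    using that \<open>finite S\<close> by (auto simp: h_def indicator_def)
  then have "(LINT \<omega>|M. h S \<omega>) = measure M {\<omega>\<in>space M. \<forall>s\<in>S. X s \<omega> \<in> B s}"
    by (subst Bochner_Integration.integral_cong[OF refl]) (auto intro!: arg_cong[where f = "measure _"])
  moreover have "h' S \<omega> = indicator {\<omega>\<in>space M'. \<forall>s\<in>S. X' s \<omega> \<in> B s} \<omega>" if "\<omega> \<in> space M'" for \<omega>
    using that \<open>finite S\<close> by (auto simp: h'_def indicator_def)
  then have "(LINT \<omega>|M'. h' S \<omega>) = measure M' {\<omega>\<in>space M'. \<forall>s\<in>S. X' s \<omega> \<in> B s}"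
    by (subst Bochner_Integration.integral_cong[OF refl]) (auto intro!: arg_cong[where f = "measure _"])
  ultimately show ?thesis by simp
qed

subsection \<open>Linear spaces of Gaussian variables\<close>

text \<open>Elements are functions, not classes modulo null sets, and closure under linear
  combinations makes every finite family from \<open>G\<close> jointly Gaussian by mere membership.
  Identities that hold only almost surely, such as additivity of the noise, enter through integrals
  of squares.\<close>

locale gaussian_space = prob_space M for M :: "'w measure" +
  fixes G :: "('w \<Rightarrow> real) set"
  assumes gaussian: "f \<in> G \<Longrightarrow> centered_gaussian_rv M f"
    and zero: "(\<lambda>\<omega>. 0) \<in> G"
    and add: "f \<in> G \<Longrightarrow> g \<in> G \<Longrightarrow> (\<lambda>\<omega>. f \<omega> + g \<omega>) \<in> G"
    and scale: "f \<in> G \<Longrightarrow> (\<lambda>\<omega>. c * f \<omega>) \<in> G"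
begin

lemma meas [measurable]: "f \<in> G \<Longrightarrow> f \<in> borel_measurable M"
  using gaussian by (simp add: centered_gaussian_rv_def)

lemma diff: "f \<in> G \<Longrightarrow> g \<in> G \<Longrightarrow> (\<lambda>\<omega>. f \<omega> - g \<omega>) \<in> G"
  using add[OF _ scale[of g "-1"]] by simp

lemma lincomb: "(\<And>s. s \<in> S \<Longrightarrow> X s \<in> G) \<Longrightarrow> (\<lambda>\<omega>. \<Sum>s\<in>S. c s * X s \<omega>) \<in> G"
proof (induction S rule: infinite_finite_induct)
  case (insert x F)
  then show ?case using add[OF scale[of "X x" "c x"], of "\<lambda>\<omega>. \<Sum>s\<in>F. c s * X s \<omega>"] by simp
qed (auto intro: zero)

lemma integrable_square: "f \<in> G \<Longrightarrow> integrable M (\<lambda>\<omega>. (f \<omega>)\<^sup>2)"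
  using centered_gaussian_rv_moments(1)[OF prob_space_axioms gaussian, of f 1] by simp

lemma char: "f \<in> G \<Longrightarrow> (CLINT \<omega>|M. iexp (f \<omega>)) = exp (- (\<integral>\<omega>. (f \<omega>)\<^sup>2 \<partial>M) / 2)"
  using centered_gaussian_rv_moments(3)[OF prob_space_axioms gaussian] by simp

lemma var_add_le:
  assumes "f \<in> G" "g \<in> G"
  shows "(\<integral>\<omega>. (f \<omega> + g \<omega>)\<^sup>2 \<partial>M) \<le> 2 * (\<integral>\<omega>. (f \<omega>)\<^sup>2 \<partial>M) + 2 * (\<integral>\<omega>. (g \<omega>)\<^sup>2 \<partial>M)"
proof -
  have "(\<integral>\<omega>. (f \<omega> + g \<omega>)\<^sup>2 \<partial>M) \<le> (\<integral>\<omega>. 2 * (f \<omega>)\<^sup>2 + 2 * (g \<omega>)\<^sup>2 \<partial>M)"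
  proof (rule integral_mono)
    show "(f \<omega> + g \<omega>)\<^sup>2 \<le> 2 * (f \<omega>)\<^sup>2 + 2 * (g \<omega>)\<^sup>2" for \<omega>
      using sum_squares_ge_zero[of "f \<omega> - g \<omega>" 0] by (simp add: power2_eq_square algebra_simps)
  qed (use integrable_square assms add in auto)
  then show ?thesis using assms by (simp add: integrable_square)
qed

lemma var_diff_le:
  assumes "f \<in> G" "g \<in> G"
  shows "(\<integral>\<omega>. (f \<omega> - g \<omega>)\<^sup>2 \<partial>M) \<le> 2 * (\<integral>\<omega>. (f \<omega>)\<^sup>2 \<partial>M) + 2 * (\<integral>\<omega>. (g \<omega>)\<^sup>2 \<partial>M)"
  using var_add_le[OF assms(1) scale[OF assms(2), of "-1"]] by simp

text \<open>The fraction is the moment of order \<open>2 * q\<close> of a standard normal variable.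
  Only an upper bound on the variance is asked for, so degenerate variables are included.\<close>

lemma nn_moment:
  assumes "f \<in> G" "(\<integral>\<omega>. (f \<omega>)\<^sup>2 \<partial>M) \<le> b\<^sup>2"
  shows "(\<integral>\<^sup>+\<omega>. ennreal (\<bar>f \<omega>\<bar> ^ (2 * q)) \<partial>M) \<le> ennreal (fact (2 * q) / (2 ^ q * fact q) * b ^ (2 * q))"
proof -
  note m = centered_gaussian_rv_moments(1,2)[OF prob_space_axioms gaussian[OF assms(1)], of q]
  have "(\<integral>\<^sup>+\<omega>. ennreal (\<bar>f \<omega>\<bar> ^ (2 * q)) \<partial>M) = (\<integral>\<omega>. f \<omega> ^ (2 * q) \<partial>M)"
    using m(1) by (subst nn_integral_eq_integral) (auto simp: power_even_abs)
  also have "\<dots> \<le> ennreal (fact (2 * q) / (2 ^ q * fact q) * b ^ (2 * q))"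
    unfolding m(2) power_mult[of b] mult.commute[of "_ ^ q" "fact (2 * q) / _"] using assms(2)
    by (intro ennreal_leI mult_left_mono power_mono) auto
  finally show ?thesis .
qed

text \<open>If Y and Y' are independent copies, (Y - Y') / sqrt 2 has the law of Y.\<close>

lemma copies_rectangle:
  assumes "finite S" and X: "\<And>s. s \<in> S \<Longrightarrow> X s \<in> G"
  shows "measure (M \<Otimes>\<^sub>M M) {z\<in>space (M \<Otimes>\<^sub>M M). \<forall>s\<in>S. \<bar>X s (fst z) - X s (snd z)\<bar> \<le> \<beta> s} \<le>
    prob {\<omega>\<in>space M. \<forall>s\<in>S. \<bar>X s \<omega>\<bar> \<le> \<beta> s}"
proof -
  interpret P: pair_prob_space M M ..
  have [measurable]: "X s \<in> borel_measurable M" if "s \<in> S" for s using X[OF that] by simp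
  define X' where "X' s z = (X s (fst z) - X s (snd z)) / sqrt 2" for s z
  have [measurable]: "X' s \<in> borel_measurable (M \<Otimes>\<^sub>M M)" if "s \<in> S" for s
    unfolding X'_def using that by measurable
  have eq: "(CLINT \<omega>|M. iexp (\<Sum>s\<in>S. \<xi> s * X s \<omega>)) = (CLINT z|M \<Otimes>\<^sub>M M. iexp (\<Sum>s\<in>S. \<xi> s * X' s z))" for \<xi>
  proof -
    define f where "f \<omega> = (\<Sum>s\<in>S. \<xi> s * X s \<omega>)" for \<omega>
    have fG: "f \<in> G" unfolding f_def using X by (rule lincomb)
    then have [measurable]: "f \<in> borel_measurable M" by simp
    define V where "V = (\<integral>\<omega>. (f \<omega>)\<^sup>2 \<partial>M)"
    have sc: "(CLINT \<omega>|M. iexp (c * f \<omega>)) = exp (- (c\<^sup>2 * V) / 2)" for c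
      using char[OF scale[OF fG, of c]] by (simp add: power_mult_distrib V_def)
    have "iexp (\<Sum>s\<in>S. \<xi> s * X' s z) = iexp (1 / sqrt 2 * f (fst z)) * iexp (- 1 / sqrt 2 * f (snd z))" for z
    proof -
      have "(\<Sum>s\<in>S. \<xi> s * X' s z) = 1 / sqrt 2 * f (fst z) + (- 1 / sqrt 2) * f (snd z)"
        by (simp add: X'_def f_def sum_distrib_left sum_divide_distrib diff_divide_distrib right_diff_distrib
            sum_subtractf sum_negf)
      then show ?thesis by (simp only: of_real_add ring_distribs exp_add)
    qed
    then have "(CLINT z|M \<Otimes>\<^sub>M M. iexp (\<Sum>s\<in>S. \<xi> s * X' s z)) =
        (CLINT z|M \<Otimes>\<^sub>M M. iexp (1 / sqrt 2 * f (fst z)) * iexp (- 1 / sqrt 2 * f (snd z)))" by simp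
    also have "\<dots> = (CLINT \<omega>|M. CLINT \<omega>'|M. iexp (1 / sqrt 2 * f \<omega>) * iexp (- 1 / sqrt 2 * f \<omega>'))"
    proof (subst P.integral_fst'[symmetric])
      show "complex_integrable (M \<Otimes>\<^sub>M M) (\<lambda>z. iexp (1 / sqrt 2 * f (fst z)) * iexp (- 1 / sqrt 2 * f (snd z)))"
        by (intro P.P.integrable_const_bound[of _ 1]) (auto simp: norm_mult simp del: of_real_mult)
    qed simp
    also have "\<dots> = (CLINT \<omega>|M. iexp (1 / sqrt 2 * f \<omega>)) * (CLINT \<omega>'|M. iexp (- 1 / sqrt 2 * f \<omega>'))"
      by (simp only: integral_mult_right_zero integral_mult_left_zero)
    also have "\<dots> = exp (- (V / 2) / 2) * exp (- (V / 2) / 2)"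
      unfolding sc by (simp add: power_divide)
    also have "\<dots> = exp (- V / 2)" by (simp flip: exp_add of_real_mult)
    also have "\<dots> = (CLINT \<omega>|M. iexp (f \<omega>))"
      using sc[of 1] by simp
    finally show ?thesis by (simp add: f_def)
  qed
  have "prob {\<omega>\<in>space M. \<forall>s\<in>S. X s \<omega> \<in> {-\<beta> s..\<beta> s}} =
      measure (M \<Otimes>\<^sub>M M) {z\<in>space (M \<Otimes>\<^sub>M M). \<forall>s\<in>S. X' s z \<in> {-\<beta> s..\<beta> s}}"
    by (rule rectangle_prob_unique[OF prob_space_axioms P.P.prob_space_axioms \<open>finite S\<close> _ _ _ eq]) auto
  \<comment> \<open>Dividing by \<open>sqrt 2\<close> shrinks the difference, so leaving the
    division out only makes the event smaller.\<close>
  also have "\<dots> \<ge> measure (M \<Otimes>\<^sub>M M) {z\<in>space (M \<Otimes>\<^sub>M M). \<forall>s\<in>S. \<bar>X s (fst z) - X s (snd z)\<bar> \<le> \<beta> s}"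
  proof (rule P.P.finite_measure_mono)
    have *: "t / sqrt 2 \<in> {-b..b}" if "\<bar>t\<bar> \<le> b" for t b :: real
    proof -
      have "\<bar>t / sqrt 2\<bar> \<le> \<bar>t\<bar> / 1" unfolding abs_divide by (intro frac_le) auto
      then have "\<bar>t / sqrt 2\<bar> \<le> b" using that by simp
      then show ?thesis unfolding abs_le_iff atLeastAtMost_iff by linarith
    qed
    show "{z\<in>space (M \<Otimes>\<^sub>M M). \<forall>s\<in>S. \<bar>X s (fst z) - X s (snd z)\<bar> \<le> \<beta> s} \<subseteq>
        {z\<in>space (M \<Otimes>\<^sub>M M). \<forall>s\<in>S. X' s z \<in> {-\<beta> s..\<beta> s}}"
      unfolding X'_def by (blast intro: *)
  next
    show "{z \<in> space (M \<Otimes>\<^sub>M M). \<forall>s\<in>S. X' s z \<in> {- \<beta> s..\<beta> s}} \<in> sets (M \<Otimes>\<^sub>M M)"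
      using \<open>finite S\<close> by measurable
  qed
  finally show ?thesis by (simp add: abs_le_iff minus_le_iff conj_commute)
qed

text \<open>Pigeonhole with two independent copies. The event of probability 1/2 is cut into pieces
  on which every coordinate in \<open>K\<close> is known up to \<open>\<eta>\<close>. By
  Cauchy-Schwarz both copies fall into the same piece with probability at least 1/4 divided by the
  number of pieces; then they differ by at most \<open>\<eta>\<close> on \<open>K\<close> and by
  \<open>2 * \<beta>\<close> everywhere, and \<open>copies_rectangle\<close> returns to a single
  copy. No covariance enters, only the size of \<open>K\<close> and the ratio of \<open>b\<close> to
  \<open>\<eta>\<close>, which makes the bound uniform over processes.\<close>

lemma small_ball:
  fixes \<beta> :: "'i \<Rightarrow> real"
  assumes "countable L" "K \<subseteq> L" "finite K" and X: "\<And>l. l \<in> L \<Longrightarrow> X l \<in> G"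
    and half: "1 / 2 \<le> prob {\<omega>\<in>space M. \<forall>l\<in>L. \<bar>X l \<omega>\<bar> \<le> \<beta> l}"
    and b: "\<And>l. l \<in> K \<Longrightarrow> \<beta> l \<le> b" "0 < b" "0 < \<eta>"
  shows "1 / (4 * (2 * b / \<eta> + 2) ^ card K) \<le>
    prob {\<omega>\<in>space M. \<forall>l\<in>L. \<bar>X l \<omega>\<bar> \<le> (if l \<in> K then min \<eta> (2 * \<beta> l) else 2 * \<beta> l)}"
proof -
  interpret P: pair_prob_space M M ..
  define \<beta>' where "\<beta>' l = (if l \<in> K then min \<eta> (2 * \<beta> l) else 2 * \<beta> l)" for l
  have mX[measurable]: "X l \<in> borel_measurable M" if "l \<in> L" for l using X[OF that] by simp
  have mX0[measurable]: "X l \<in> borel_measurable M" if "l \<in> K" for l using mX that assms(2) by auto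
  define E where "E = {\<omega>\<in>space M. \<forall>l\<in>L. \<bar>X l \<omega>\<bar> \<le> \<beta> l}"
  have [measurable]: "E \<in> sets M" unfolding E_def using \<open>countable L\<close> by measurable
  define J where "J = {\<lfloor>- b / \<eta>\<rfloor>..\<lfloor>b / \<eta>\<rfloor>}"
  define I where "I = (\<Pi>\<^sub>E l\<in>K. J)"
  have finI: "finite I" unfolding I_def J_def using \<open>finite K\<close> by (intro finite_PiE) auto
  have "real (card J) \<le> 2 * b / \<eta> + 2"
  proof -
    have "real (card J) = of_int (\<lfloor>b / \<eta>\<rfloor> - \<lfloor>- b / \<eta>\<rfloor> + 1)"
      unfolding J_def using floor_mono[of "- b / \<eta>" "b / \<eta>"] b by (simp add: of_nat_nat field_simps)
    also have "\<dots> \<le> 2 * b / \<eta> + 2" 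
    proof -
      have "2 * b / \<eta> = b / \<eta> + b / \<eta>" "- b / \<eta> = - (b / \<eta>)" by simp_all
      then show ?thesis using floor_correct[of "b / \<eta>"] floor_correct[of "- b / \<eta>"] by (simp only: of_int_add of_int_diff of_int_1) linarith
    qed
    finally show ?thesis .
  qed
  then have cardI: "real (card I) \<le> (2 * b / \<eta> + 2) ^ card K"
    unfolding I_def using \<open>finite K\<close> by (simp add: card_PiE power_mono)
  define F where "F f = {\<omega>\<in>E. \<forall>l\<in>K. \<lfloor>X l \<omega> / \<eta>\<rfloor> = f l}" for f
  have F_meas[measurable]: "F f \<in> sets M" for f
  proof -
    have "F f = E \<inter> {\<omega>\<in>space M. \<forall>l\<in>K. \<lfloor>X l \<omega> / \<eta>\<rfloor> = f l}"
      by (auto simp: F_def E_def)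
    also have "\<dots> \<in> sets M" using \<open>finite K\<close> by measurable
    finally show ?thesis .
  qed
  have disj: "disjoint_family_on F I"
  proof (unfold disjoint_family_on_def, intro ballI impI)
    fix f g assume fg: "f \<in> I" "g \<in> I" "f \<noteq> g"
    show "F f \<inter> F g = {}"
    proof (rule ccontr)
      assume "F f \<inter> F g \<noteq> {}"
      then obtain \<omega> where "\<omega> \<in> F f" "\<omega> \<in> F g" by auto
      then have "f l = g l" if "l \<in> K" for l using that by (auto simp: F_def)
      then have "f = g" using fg by (auto simp: I_def intro: PiE_ext)
      with fg show False by simp
    qed
  qed
  have E_eq: "E = (\<Union>f\<in>I. F f)"
  proof
    show "E \<subseteq> (\<Union>f\<in>I. F f)"
    proof
      fix \<omega> assume \<omega>: "\<omega> \<in> E"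
      define f where "f = (\<lambda>l\<in>K. \<lfloor>X l \<omega> / \<eta>\<rfloor>)"
      have "\<lfloor>X l \<omega> / \<eta>\<rfloor> \<in> J" if lK: "l \<in> K" for l
      proof -
        have "\<bar>X l \<omega>\<bar> \<le> \<beta> l" using \<omega> lK assms(2) by (auto simp: E_def)
        then have "\<bar>X l \<omega>\<bar> \<le> b" using b(1)[OF lK] by simp
        then have "- b \<le> X l \<omega>" "X l \<omega> \<le> b" by auto
        then have "- b / \<eta> \<le> X l \<omega> / \<eta>" "X l \<omega> / \<eta> \<le> b / \<eta>"
          using b by (simp_all only: divide_right_mono less_imp_le)
        then show ?thesis unfolding J_def by (simp add: floor_mono)
      qed
      then have "f \<in> I" unfolding f_def I_def by auto
      moreover have "\<omega> \<in> F f" using \<omega> by (auto simp: F_def f_def)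
      ultimately show "\<omega> \<in> (\<Union>f\<in>I. F f)" by auto
    qed
  qed (auto simp: F_def)
  have sumF: "(\<Sum>f\<in>I. prob (F f)) = prob E"
    unfolding E_eq using disj finI by (intro finite_measure_finite_Union[symmetric]) auto
  have "(1 / 2)\<^sup>2 \<le> (\<Sum>f\<in>I. prob (F f))\<^sup>2"
    unfolding sumF using half by (intro power_mono) (auto simp: E_def)
  also have "\<dots> \<le> real (card I) * (\<Sum>f\<in>I. (prob (F f))\<^sup>2)"
    using sum_squared_le_sum_of_squares[of "\<lambda>f. prob (F f)" I] by (simp add: mult.commute)
  also have "\<dots> \<le> (2 * b / \<eta> + 2) ^ card K * (\<Sum>f\<in>I. (prob (F f))\<^sup>2)"
    using cardI by (intro mult_right_mono sum_nonneg) auto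
  finally have sq: "1 / (4 * (2 * b / \<eta> + 2) ^ card K) \<le> (\<Sum>f\<in>I. (prob (F f))\<^sup>2)"
  proof -
    assume "(1 / 2)\<^sup>2 \<le> (2 * b / \<eta> + 2) ^ card K * (\<Sum>f\<in>I. (prob (F f))\<^sup>2)"
    moreover have "0 < (2 * b / \<eta> + 2) ^ card K" using b by (auto intro!: zero_less_power add_pos_pos)
    ultimately show ?thesis by (simp add: field_simps power2_eq_square)
  qed
  \<comment> \<open>\<open>L\<close> may be infinite: the bound is shown for finite subsets, with a
    constant free of \<open>S\<close>, and passed to the limit along an enumeration of
    \<open>L\<close>.\<close>
  have fin: "1 / (4 * (2 * b / \<eta> + 2) ^ card K) \<le> prob {\<omega>\<in>space M. \<forall>l\<in>S. \<bar>X l \<omega>\<bar> \<le> \<beta>' l}"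
    if S: "finite S" "S \<subseteq> L" for S
  proof -
    note sq
    also have "(\<Sum>f\<in>I. (prob (F f))\<^sup>2) = (\<Sum>f\<in>I. measure (M \<Otimes>\<^sub>M M) (F f \<times> F f))"
      by (simp add: measure_def emeasure_pair_measure_Times enn2real_mult power2_eq_square)
    also have "\<dots> = measure (M \<Otimes>\<^sub>M M) (\<Union>f\<in>I. F f \<times> F f)"
      using disj finI by (intro P.P.finite_measure_finite_Union[symmetric])
        (auto simp: disjoint_family_on_def)
    also have "\<dots> \<le> measure (M \<Otimes>\<^sub>M M) {z\<in>space (M \<Otimes>\<^sub>M M). \<forall>l\<in>S. \<bar>X l (fst z) - X l (snd z)\<bar> \<le> \<beta>' l}"
    proof (rule P.P.finite_measure_mono)
      have "\<bar>X l \<omega> - X l \<omega>'\<bar> \<le> \<beta>' l" if "f \<in> I" "\<omega> \<in> F f" "\<omega>' \<in> F f" "l \<in> S" for f \<omega> \<omega>' l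
      proof -
        have "\<bar>X l \<omega>\<bar> \<le> \<beta> l" "\<bar>X l \<omega>'\<bar> \<le> \<beta> l" using that S by (auto simp: F_def E_def)
        then have 1: "\<bar>X l \<omega> - X l \<omega>'\<bar> \<le> 2 * \<beta> l" by linarith
        have "\<bar>X l \<omega> - X l \<omega>'\<bar> \<le> \<eta>" if lK: "l \<in> K"
        proof -
          have "\<lfloor>X l \<omega> / \<eta>\<rfloor> = \<lfloor>X l \<omega>' / \<eta>\<rfloor>" using \<open>\<omega> \<in> F f\<close> \<open>\<omega>' \<in> F f\<close> lK by (auto simp: F_def)
          then have "\<bar>X l \<omega> / \<eta> - X l \<omega>' / \<eta>\<bar> \<le> 1"
            using floor_correct[of "X l \<omega> / \<eta>"] floor_correct[of "X l \<omega>' / \<eta>"] by linarith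
          then have "\<bar>X l \<omega> - X l \<omega>'\<bar> / \<eta> \<le> 1"
            using b by (simp add: diff_divide_distrib[symmetric])
          then show ?thesis using b by (simp add: field_simps)
        qed
        with 1 show ?thesis by (simp add: \<beta>'_def)
      qed
      moreover have "F f \<subseteq> space M" for f by (auto simp: F_def E_def)
      ultimately show "(\<Union>f\<in>I. F f \<times> F f) \<subseteq> {z\<in>space (M \<Otimes>\<^sub>M M). \<forall>l\<in>S. \<bar>X l (fst z) - X l (snd z)\<bar> \<le> \<beta>' l}"
        by (fastforce simp: space_pair_measure)
    next
      have [measurable]: "X l \<in> borel_measurable M" if "l \<in> S" for l using mX that S by auto
      show "{z\<in>space (M \<Otimes>\<^sub>M M). \<forall>l\<in>S. \<bar>X l (fst z) - X l (snd z)\<bar> \<le> \<beta>' l} \<in> sets (M \<Otimes>\<^sub>M M)"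
        using S(1) by measurable
    qed
    also have "\<dots> \<le> prob {\<omega>\<in>space M. \<forall>l\<in>S. \<bar>X l \<omega>\<bar> \<le> \<beta>' l}"
      using S X by (intro copies_rectangle) auto
    finally show ?thesis .
  qed
  show ?thesis
  proof (cases "L = {}")
    case True
    then show ?thesis using fin[of "{}"] by simp
  next
    case False
    define A where "A n = {\<omega>\<in>space M. \<forall>l\<in>from_nat_into L ` {..n}. \<bar>X l \<omega>\<bar> \<le> \<beta>' l}" for n
    have sub: "from_nat_into L ` {..n} \<subseteq> L" for n using False by (auto intro: from_nat_into)
    have A_meas: "A n \<in> sets M" for n
    proof -
      have [measurable]: "X l \<in> borel_measurable M" if "l \<in> from_nat_into L ` {..n}" for l using mX subsetD[OF sub that] by auto
      show ?thesis unfolding A_def by measurable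
    qed
    have "(\<lambda>n. prob (A n)) \<longlonglongrightarrow> prob (\<Inter>n. A n)"
      using A_meas by (intro finite_Lim_measure_decseq) (auto simp: decseq_def A_def)
    moreover have "(\<Inter>n. A n) = {\<omega>\<in>space M. \<forall>l\<in>L. \<bar>X l \<omega>\<bar> \<le> \<beta>' l}"
    proof -
      have "L = from_nat_into L ` UNIV" using False assms(1) by (simp add: range_from_nat_into)
      then show ?thesis unfolding A_def by auto (metis atMost_iff image_eqI order_refl rangeE)
    qed
    moreover have "1 / (4 * (2 * b / \<eta> + 2) ^ card K) \<le> prob (A n)" for n
      unfolding A_def using sub by (intro fin) auto
    ultimately show ?thesis
      unfolding \<beta>'_def[symmetric] by (metis LIMSEQ_le_const)
  qed
qed

end

section \<open>Anti-concentration of nondegenerate Gaussian vectors\<close>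

lemma std_normal_exp_moment:
  assumes "0 \<le> t"
  shows "(LINT x|std_normal_distribution. exp (- (t * x\<^sup>2) / 2)) = 1 / sqrt (1 + t)"
proof -
  define \<sigma> where "\<sigma> = 1 / sqrt (1 + t)"
  have \<sigma>: "\<sigma> > 0" "\<sigma>\<^sup>2 = 1 / (1 + t)" using assms by (auto simp: \<sigma>_def power_divide)
  have e: "std_normal_density x * exp (- (t * x\<^sup>2) / 2) = \<sigma> * normal_density 0 \<sigma> x" for x
  proof -
    have "x\<^sup>2 / (2 * \<sigma>\<^sup>2) = x\<^sup>2 / 2 + t * x\<^sup>2 / 2" using assms by (simp add: \<sigma> field_simps)
    then have "exp (- x\<^sup>2 / (2 * \<sigma>\<^sup>2)) = exp (- x\<^sup>2 / 2) * exp (- (t * x\<^sup>2) / 2)"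
      by (simp flip: exp_add)
    moreover have "sqrt (2 * pi * \<sigma>\<^sup>2) = sqrt (2 * pi) * \<sigma>"
      using \<sigma>(1) by (simp add: real_sqrt_mult)
    ultimately show ?thesis
      using \<sigma>(1) by (simp add: normal_density_def)
  qed
  have "(LINT x|std_normal_distribution. exp (- (t * x\<^sup>2) / 2)) = (LINT x|lborel. std_normal_density x * exp (- (t * x\<^sup>2) / 2))"
    by (subst integral_density) (auto simp: normal_density_nonneg)
  also have "\<dots> = \<sigma>" unfolding e using \<sigma> by simp
  finally show ?thesis by (simp add: \<sigma>_def)
qed

context gaussian_space
begin

text \<open>The indicator is dominated by a Gaussian kernel, which is the Fourier transform of a Gaussian
  measure; after Fubini only the characteristic function of linear combinations is needed.\<close>

lemma anticoncentration:
  fixes w :: "'s \<Rightarrow> real"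
  assumes "finite S" and Z: "\<And>s. s \<in> S \<Longrightarrow> Z s \<in> G" and "\<kappa> > 0" "r > 0"
    and var: "\<And>\<xi>. \<kappa> * (\<Sum>s\<in>S. (\<xi> s)\<^sup>2) \<le> (\<integral>\<omega>. (\<Sum>s\<in>S. \<xi> s * Z s \<omega>)\<^sup>2 \<partial>M)"
  shows "prob {\<omega>\<in>space M. \<forall>s\<in>S. \<bar>Z s \<omega> + w s\<bar> \<le> r} \<le> (2 * r / sqrt \<kappa>) ^ card S"
proof -
  have [measurable]: "Z s \<in> borel_measurable M" if "s \<in> S" for s using Z[OF that] by simp
  interpret N: real_distribution std_normal_distribution by (rule real_dist_normal_dist)
  interpret PN: product_prob_space "\<lambda>_::'s. std_normal_distribution" by standard
  interpret FN: finite_product_prob_space "\<lambda>_::'s. std_normal_distribution" S by standard fact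
  define \<Xi> where "\<Xi> = (\<Pi>\<^sub>M s\<in>S. std_normal_distribution)"
  interpret \<Xi>: prob_space \<Xi> unfolding \<Xi>_def by (rule FN.prob_space_axioms)
  interpret P: pair_prob_space M \<Xi> ..
  have [measurable]: "(\<lambda>\<xi>. \<xi> s) \<in> borel_measurable \<Xi>" if "s \<in> S" for s
    unfolding \<Xi>_def using that by measurable
  define \<phi> where "\<phi> \<omega> \<xi> = (\<Sum>s\<in>S. \<xi> s * ((Z s \<omega> + w s) / r))" for \<omega> and \<xi> :: "'s \<Rightarrow> real"
  define k where "k \<omega> = (\<Prod>s\<in>S. exp (- ((Z s \<omega> + w s) / r)\<^sup>2 / 2))" for \<omega>
  have k_meas[measurable]: "k \<in> borel_measurable M" unfolding k_def by measurable
  have k01: "0 \<le> k \<omega>" "k \<omega> \<le> 1" for \<omega>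
    unfolding k_def by (auto intro!: prod_nonneg prod_le_1)
  have \<phi>_meas[measurable]: "(\<lambda>z. \<phi> (fst z) (snd z)) \<in> borel_measurable (M \<Otimes>\<^sub>M \<Xi>)"
    unfolding \<phi>_def by measurable
  have four: "complex_of_real (k \<omega>) = (CLINT \<xi>|\<Xi>. iexp (\<phi> \<omega> \<xi>))" for \<omega>
  proof -
    have "(CLINT \<xi>|\<Xi>. iexp (\<phi> \<omega> \<xi>)) = (CLINT \<xi>|\<Xi>. (\<Prod>s\<in>S. iexp (((Z s \<omega> + w s) / r) * \<xi> s)))"
      unfolding \<phi>_def using \<open>finite S\<close> by (simp add: sum_distrib_left exp_sum mult.commute)
    also have "\<dots> = (\<Prod>s\<in>S. CLINT x|std_normal_distribution. iexp (((Z s \<omega> + w s) / r) * x))"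
      unfolding \<Xi>_def using \<open>finite S\<close>
      by (intro PN.product_integral_prod) (auto intro!: N.integrable_const_bound[of _ 1] simp del: of_real_mult of_real_divide of_real_add)
    also have "\<dots> = (\<Prod>s\<in>S. char std_normal_distribution ((Z s \<omega> + w s) / r))"
      by (simp add: char_def)
    also have "\<dots> = complex_of_real (k \<omega>)"
      unfolding char_std_normal_distribution k_def by simp
    finally show ?thesis by simp
  qed
  have inner: "cmod (CLINT \<omega>|M. iexp (\<phi> \<omega> \<xi>)) \<le> (\<Prod>s\<in>S. exp (- ((\<kappa> / r\<^sup>2) * (\<xi> s)\<^sup>2) / 2))" for \<xi>
  proof -
    define f where "f \<omega> = (\<Sum>s\<in>S. (\<xi> s / r) * Z s \<omega>)" for \<omega>
    have fG: "f \<in> G" unfolding f_def using Z by (rule lincomb)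
    have "\<phi> \<omega> \<xi> = f \<omega> + (\<Sum>s\<in>S. \<xi> s * (w s / r))" for \<omega>
      by (simp add: \<phi>_def f_def sum.distrib[symmetric] add_divide_distrib algebra_simps)
    then have "iexp (\<phi> \<omega> \<xi>) = iexp (f \<omega>) * iexp (\<Sum>s\<in>S. \<xi> s * (w s / r))" for \<omega>
      by (simp only: of_real_add ring_distribs exp_add)
    then have "(CLINT \<omega>|M. iexp (\<phi> \<omega> \<xi>)) = (CLINT \<omega>|M. iexp (f \<omega>)) * iexp (\<Sum>s\<in>S. \<xi> s * (w s / r))"
      by (simp only: integral_mult_left_zero)
    then have "cmod (CLINT \<omega>|M. iexp (\<phi> \<omega> \<xi>)) = exp (- (\<integral>\<omega>. (f \<omega>)\<^sup>2 \<partial>M) / 2)"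
      by (simp only: norm_mult char[OF fG] norm_exp_i_times norm_of_real mult_1_right abs_exp_cancel)
    also have "\<dots> \<le> exp (- (\<kappa> * (\<Sum>s\<in>S. (\<xi> s / r)\<^sup>2)) / 2)"
      using var[of "\<lambda>s. \<xi> s / r"] by (simp add: f_def)
    also have "\<dots> = (\<Prod>s\<in>S. exp (- ((\<kappa> / r\<^sup>2) * (\<xi> s)\<^sup>2) / 2))"
      using \<open>finite S\<close> by (simp add: exp_sum[symmetric] sum_distrib_left sum_divide_distrib sum_negf power_divide)
    finally show ?thesis .
  qed
  have int: "complex_integrable (M \<Otimes>\<^sub>M \<Xi>) (\<lambda>(\<omega>, \<xi>). iexp (\<phi> \<omega> \<xi>))"
    by (intro P.P.integrable_const_bound[of _ 1]) (auto simp: case_prod_beta)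
  have "complex_of_real (LINT \<omega>|M. k \<omega>) = (CLINT \<omega>|M. CLINT \<xi>|\<Xi>. iexp (\<phi> \<omega> \<xi>))"
    by (simp add: four[symmetric])
  also have "\<dots> = (CLINT \<xi>|\<Xi>. CLINT \<omega>|M. iexp (\<phi> \<omega> \<xi>))"
    using P.Fubini_integral[OF int] by simp
  finally have "\<bar>LINT \<omega>|M. k \<omega>\<bar> = cmod (CLINT \<xi>|\<Xi>. CLINT \<omega>|M. iexp (\<phi> \<omega> \<xi>))"
    by (metis norm_of_real)
  also have "\<dots> \<le> (LINT \<xi>|\<Xi>. (\<Prod>s\<in>S. exp (- ((\<kappa> / r\<^sup>2) * (\<xi> s)\<^sup>2) / 2)))"
  proof -
    have i1: "complex_integrable \<Xi> (\<lambda>\<xi>. CLINT \<omega>|M. iexp (\<phi> \<omega> \<xi>))"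
      using P.integrable_snd[OF int] by simp
    have "0 \<le> \<kappa> / r\<^sup>2" using assms by simp
    then have "exp (- ((\<kappa> / r\<^sup>2) * y\<^sup>2) / 2) \<le> 1" for y :: real using \<open>\<kappa> > 0\<close> by simp
    then have i2: "integrable \<Xi> (\<lambda>\<xi>. \<Prod>s\<in>S. exp (- ((\<kappa> / r\<^sup>2) * (\<xi> s)\<^sup>2) / 2))"
      by (intro \<Xi>.integrable_const_bound[of _ 1] AE_I2) (auto intro!: prod_le_1 simp: abs_prod simp del: exp_le_one_iff)
    have "cmod (CLINT \<xi>|\<Xi>. CLINT \<omega>|M. iexp (\<phi> \<omega> \<xi>)) \<le> (LINT \<xi>|\<Xi>. cmod (CLINT \<omega>|M. iexp (\<phi> \<omega> \<xi>)))"
      by (rule integral_norm_bound)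
    also have "\<dots> \<le> (LINT \<xi>|\<Xi>. (\<Prod>s\<in>S. exp (- ((\<kappa> / r\<^sup>2) * (\<xi> s)\<^sup>2) / 2)))"
      using i1 i2 inner by (intro integral_mono) auto
    finally show ?thesis .
  qed
  also have "\<dots> = (\<Prod>s\<in>S. LINT x|std_normal_distribution. exp (- ((\<kappa> / r\<^sup>2) * x\<^sup>2) / 2))"
    unfolding \<Xi>_def using \<open>finite S\<close> \<open>\<kappa> > 0\<close>
    by (intro PN.product_integral_prod) (auto intro!: N.integrable_const_bound[of _ 1])
  also have "\<dots> = (1 / sqrt (1 + \<kappa> / r\<^sup>2)) ^ card S"
    using std_normal_exp_moment[of "\<kappa> / r\<^sup>2"] assms by simp
  also have "\<dots> \<le> (r / sqrt \<kappa>) ^ card S"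
  proof (rule power_mono)
    have "1 / sqrt (1 + \<kappa> / r\<^sup>2) \<le> 1 / sqrt (\<kappa> / r\<^sup>2)"
      using assms by (intro divide_left_mono) (auto intro!: mult_pos_pos add_pos_pos)
    also have "\<dots> = r / sqrt \<kappa>" using assms by (simp add: real_sqrt_divide)
    finally show "1 / sqrt (1 + \<kappa> / r\<^sup>2) \<le> r / sqrt \<kappa>" .
  qed (use assms in auto)
  finally have kb: "(LINT \<omega>|M. k \<omega>) \<le> (r / sqrt \<kappa>) ^ card S" by simp
  define A where "A = {\<omega>\<in>space M. \<forall>s\<in>S. \<bar>Z s \<omega> + w s\<bar> \<le> r}"
  have [measurable]: "A \<in> sets M" unfolding A_def using \<open>finite S\<close> by measurable
  have ki: "integrable M k" using k01 by (intro integrable_const_bound[of _ 1]) auto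
  have "prob A = (LINT \<omega>|M. indicator A \<omega>)" by simp
  also have "\<dots> \<le> (LINT \<omega>|M. 2 ^ card S * k \<omega>)"
  proof (rule integral_mono)
    fix \<omega> assume "\<omega> \<in> space M"
    show "indicator A \<omega> \<le> 2 ^ card S * k \<omega>"
    proof (cases "\<omega> \<in> A")
      case True
      \<comment> \<open>Each factor of the kernel is at least 1/2 on the event; this is the origin
        of the 2 in the bound.\<close>
      have "1 / 2 \<le> exp (- ((Z s \<omega> + w s) / r)\<^sup>2 / 2)" if "s \<in> S" for s
      proof -
        have "\<bar>(Z s \<omega> + w s) / r\<bar> \<le> 1" using True that \<open>r > 0\<close> by (auto simp: A_def)
        then have "((Z s \<omega> + w s) / r)\<^sup>2 \<le> 1" by (simp add: abs_square_le_1)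
        then have "1 + (- ((Z s \<omega> + w s) / r)\<^sup>2 / 2) \<ge> 1 / 2" by simp
        then show ?thesis using exp_ge_add_one_self order_trans by blast
      qed
      then have "(\<Prod>s\<in>S. 1 / 2) \<le> k \<omega>" unfolding k_def by (intro prod_mono) auto
      then have "(1 / 2) ^ card S \<le> k \<omega>" by simp
      then show ?thesis using True by (simp add: field_simps power_divide)
    next
      case False then show ?thesis using k01 by simp
    qed
  qed (use ki in \<open>auto simp: less_top[symmetric]\<close>)
  also have "\<dots> = 2 ^ card S * (LINT \<omega>|M. k \<omega>)" by simp
  also have "\<dots> \<le> 2 ^ card S * (r / sqrt \<kappa>) ^ card S" using kb by (intro mult_left_mono) auto
  also have "\<dots> = (2 * r / sqrt \<kappa>) ^ card S" by (simp add: power_mult_distrib power_divide)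
  finally show ?thesis by (simp add: A_def)
qed

end

subsection \<open>Anisotropic dyadic grids\<close>

text \<open>Since \<open>1 + \<gamma> j\<close> is the reciprocal of
  \<open>alpha \<gamma> j\<close>, a cell of level \<open>n\<close> has size of order
  \<open>2^(-n)\<close> in the anisotropic metric \<open>Delta\<close>. Rounding to a whole number
  of bisections keeps the grids nested and costs bounded factors only.\<close>

definition lev :: "('k \<Rightarrow> real) \<Rightarrow> nat \<Rightarrow> 'k \<Rightarrow> nat" where
  "lev \<gamma> n j = nat \<lfloor>real n * (1 + \<gamma> j)\<rfloor>"

definition coarsen :: "('k \<Rightarrow> real) \<Rightarrow> nat \<Rightarrow> nat \<Rightarrow> ('k \<Rightarrow> nat) \<Rightarrow> ('k \<Rightarrow> nat)" where
  "coarsen \<gamma> n n' i = (\<lambda>j. i j div 2 ^ (lev \<gamma> n' j - lev \<gamma> n j))"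

definition desc :: "('k \<Rightarrow> real) \<Rightarrow> nat \<Rightarrow> nat \<Rightarrow> ('k \<Rightarrow> nat) \<Rightarrow> ('k \<Rightarrow> nat) set" where
  "desc \<gamma> n t C = {i. coarsen \<gamma> n (n + t) i = C}"

text \<open>The clamping with \<^const>\<open>min\<close> keeps grid points of out-of-range indices inside the box.\<close>

definition pt :: "('k::finite \<Rightarrow> real) \<Rightarrow> real^'k \<Rightarrow> real^'k \<Rightarrow> nat \<Rightarrow> ('k \<Rightarrow> nat) \<Rightarrow> real^'k" where
  "pt \<gamma> a b n i = (\<chi> j. a$j + (b$j - a$j) * min 1 (real (i j) / 2 ^ lev \<gamma> n j))"

definition idx :: "('k::finite \<Rightarrow> real) \<Rightarrow> real^'k \<Rightarrow> real^'k \<Rightarrow> nat \<Rightarrow> real^'k \<Rightarrow> ('k \<Rightarrow> nat)" where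
  "idx \<gamma> a b n x = (\<lambda>j. nat \<lfloor>(x$j - a$j) / (b$j - a$j) * 2 ^ lev \<gamma> n j\<rfloor>)"

text \<open>The chaining increment between a grid point and the grid point of its parent cell. The
  path is an argument, so that the same expression serves for sample paths and, component by
  component, for Gaussian variables.\<close>

definition link :: "('k::finite \<Rightarrow> real) \<Rightarrow> real^'k \<Rightarrow> real^'k \<Rightarrow> nat \<Rightarrow> ('k \<Rightarrow> nat) \<Rightarrow> (real^'k \<Rightarrow> real) \<Rightarrow> real" where
  "link \<gamma> a b n i f = f (pt \<gamma> a b (Suc n) i) - f (pt \<gamma> a b n (coarsen \<gamma> n (Suc n) i))"

lemma Qdim_eq: "Qdim \<gamma> = (\<Sum>j\<in>UNIV. 1 + \<gamma> j)"
  by (simp add: Qdim_def alpha_def add.commute)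

locale grid =
  fixes \<gamma> :: "'k::finite \<Rightarrow> real"
  assumes \<gamma>_pos: "\<gamma> j > 0"
begin

lemma Qdim_pos: "Qdim \<gamma> > 0"
  unfolding Qdim_eq using \<gamma>_pos by (intro sum_pos) (auto intro: add_pos_pos)

lemma lev_bounds: "real (lev \<gamma> n j) \<le> real n * (1 + \<gamma> j)" "real n * (1 + \<gamma> j) < real (lev \<gamma> n j) + 1"
proof -
  have "0 \<le> real n * (1 + \<gamma> j)" using \<gamma>_pos[of j] by simp
  then show "real (lev \<gamma> n j) \<le> real n * (1 + \<gamma> j)" "real n * (1 + \<gamma> j) < real (lev \<gamma> n j) + 1"
    unfolding lev_def by (simp_all add: of_nat_nat)
qed

lemma lev_mono: "n \<le> n' \<Longrightarrow> lev \<gamma> n j \<le> lev \<gamma> n' j"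
  unfolding lev_def using \<gamma>_pos[of j] by (intro nat_mono floor_mono mult_right_mono) auto

lemma lev_ge: "n \<le> lev \<gamma> n j"
proof -
  have "real n \<le> real n * (1 + \<gamma> j)" using \<gamma>_pos[of j] by (simp add: algebra_simps)
  then show ?thesis unfolding lev_def by (simp add: le_nat_floor)
qed

lemma coarsen_trans:
  assumes "n \<le> n'" "n' \<le> n''"
  shows "coarsen \<gamma> n n' (coarsen \<gamma> n' n'' i) = coarsen \<gamma> n n'' i"
proof
  fix j
  have "lev \<gamma> n'' j - lev \<gamma> n j = (lev \<gamma> n'' j - lev \<gamma> n' j) + (lev \<gamma> n' j - lev \<gamma> n j)"
    using lev_mono[OF assms(1), of j] lev_mono[OF assms(2), of j] by simp
  then show "coarsen \<gamma> n n' (coarsen \<gamma> n' n'' i) j = coarsen \<gamma> n n'' i j"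
    by (simp add: coarsen_def div_mult2_eq power_add)
qed

lemma coarsen_self [simp]: "coarsen \<gamma> n n i = i"
  by (simp add: coarsen_def)

lemma desc_0 [simp]: "desc \<gamma> n 0 C = {C}"
  by (auto simp: desc_def)

lemma desc_eq: "desc \<gamma> n t C =
    (\<Pi>\<^sub>E j\<in>UNIV. {C j * 2 ^ (lev \<gamma> (n + t) j - lev \<gamma> n j)..<C j * 2 ^ (lev \<gamma> (n + t) j - lev \<gamma> n j) + 2 ^ (lev \<gamma> (n + t) j - lev \<gamma> n j)})"
proof -
  have "i div q = c \<longleftrightarrow> i \<in> {c * q..<c * q + q}" if "0 < q" for i q c :: nat
  proof
    show "i div q = c \<Longrightarrow> i \<in> {c * q..<c * q + q}"
      using div_mult_mod_eq[of i q] mod_less_divisor[OF that, of i] by auto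
    show "i \<in> {c * q..<c * q + q} \<Longrightarrow> i div q = c"
      by (intro div_nat_eqI) (auto simp: mult.commute)
  qed
  then show ?thesis
    unfolding desc_def coarsen_def fun_eq_iff PiE_UNIV_domain Pi_def by simp
qed

lemma finite_desc [simp, intro]: "finite (desc \<gamma> n t C)"
  unfolding desc_eq by (intro finite_PiE) auto

lemma card_desc: "card (desc \<gamma> n t C) = (\<Prod>j\<in>UNIV. 2 ^ (lev \<gamma> (n + t) j - lev \<gamma> n j))"
  unfolding desc_eq by (subst card_PiE) auto

text \<open>Because of rounding, the bisection numbers of the two levels differ by at most one more
  than \<open>t * (1 + \<gamma> j)\<close>, which costs one factor 2 per coordinate.\<close>

lemma card_desc_le: "real (card (desc \<gamma> n t C)) \<le> 2 ^ CARD('k) * 2 powr (real t * Qdim \<gamma>)"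
proof -
  have "real (card (desc \<gamma> n t C)) = (\<Prod>j\<in>UNIV. 2 ^ (lev \<gamma> (n + t) j - lev \<gamma> n j))"
    unfolding card_desc by simp
  also have "\<dots> \<le> (\<Prod>j\<in>UNIV. 2 * 2 powr (real t * (1 + \<gamma> j)))"
  proof (rule prod_mono, intro conjI)
    fix j
    have "real (lev \<gamma> (n + t) j - lev \<gamma> n j) \<le> 1 + real t * (1 + \<gamma> j)"
      using lev_bounds(1)[of "n + t" j] lev_bounds(2)[of n j] lev_mono[of n "n + t" j]
      by (simp add: of_nat_diff algebra_simps)
    then have "2 powr real (lev \<gamma> (n + t) j - lev \<gamma> n j) \<le> 2 powr (1 + real t * (1 + \<gamma> j))"
      by (intro powr_mono) auto
    then show "2 ^ (lev \<gamma> (n + t) j - lev \<gamma> n j) \<le> 2 * 2 powr (real t * (1 + \<gamma> j))"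
      by (simp add: powr_realpow powr_add)
  qed simp
  also have "\<dots> = 2 ^ CARD('k) * 2 powr (real t * Qdim \<gamma>)"
    by (simp add: prod.distrib Qdim_eq sum_distrib_left powr_sum)
  finally show ?thesis .
qed

lemma coarsen_desc: "i \<in> desc \<gamma> n (Suc t) C \<Longrightarrow> coarsen \<gamma> (n + t) (Suc (n + t)) i \<in> desc \<gamma> n t C"
  by (simp add: desc_def coarsen_trans)

lemma chain_bound:
  assumes "\<And>s i. i \<in> desc \<gamma> n (Suc s) C \<Longrightarrow> \<bar>link \<gamma> a b (n + s) i f\<bar> \<le> \<beta> s"
  shows "i \<in> desc \<gamma> n t C \<Longrightarrow> \<bar>f (pt \<gamma> a b (n + t) i) - f (pt \<gamma> a b n C)\<bar> \<le> (\<Sum>s<t. \<beta> s)"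
proof (induction t arbitrary: i)
  case (Suc t)
  let ?i = "coarsen \<gamma> (n + t) (Suc (n + t)) i"
  have "\<bar>f (pt \<gamma> a b (n + t) ?i) - f (pt \<gamma> a b n C)\<bar> \<le> (\<Sum>s<t. \<beta> s)"
    using Suc.prems by (intro Suc.IH coarsen_desc)
  moreover have "\<bar>link \<gamma> a b (n + t) i f\<bar> \<le> \<beta> t" using Suc.prems by (rule assms)
  ultimately show ?case by (simp add: link_def)
qed simp

lemma mesh_le: "1 / 2 ^ lev \<gamma> n j \<le> 2 * 2 powr - (real n * (1 + \<gamma> j))"
proof -
  have "1 / 2 ^ lev \<gamma> n j = 2 * 2 powr - (real (lev \<gamma> n j) + 1)"
    by (simp add: powr_diff powr_minus_divide powr_realpow)
  also have "2 powr - (real (lev \<gamma> n j) + 1) \<le> 2 powr - (real n * (1 + \<gamma> j))"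
    using lev_bounds(2)[of n j] by (intro powr_mono) auto
  finally show ?thesis by simp
qed

lemma pt_in_box:
  assumes "\<And>j. a$j < b$j"
  shows "pt \<gamma> a b n i \<in> cbox a b"
proof -
  have "a$j \<le> pt \<gamma> a b n i $ j \<and> pt \<gamma> a b n i $ j \<le> b$j" for j
  proof -
    define m where "m = min 1 (real (i j) / 2 ^ lev \<gamma> n j)"
    have "0 \<le> m" "m \<le> 1" by (auto simp: m_def)
    then have "0 \<le> (b$j - a$j) * m" "(b$j - a$j) * m \<le> (b$j - a$j) * 1"
      using assms[of j] by (auto intro!: mult_nonneg_nonneg mult_left_mono)
    moreover have "pt \<gamma> a b n i $ j = a$j + (b$j - a$j) * m" by (simp add: pt_def m_def)
    ultimately show ?thesis by simp
  qed
  then show ?thesis by (simp add: mem_box_cart)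
qed

text \<open>Child and parent point are at most one mesh of the coarser level apart, and clamping
  does not increase distances; the factor 2 is that of \<open>mesh_le\<close>.\<close>

lemma pt_link_dist:
  assumes "\<And>j. a$j < b$j"
  shows "\<bar>pt \<gamma> a b (Suc n) i $ j - pt \<gamma> a b n (coarsen \<gamma> n (Suc n) i) $ j\<bar>
    \<le> 2 * (b$j - a$j) * 2 powr - (real n * (1 + \<gamma> j))"
proof -
  define q where "q = (2::nat) ^ (lev \<gamma> (Suc n) j - lev \<gamma> n j)"
  have q: "real q > 0" by (simp add: q_def)
  have "lev \<gamma> (Suc n) j = lev \<gamma> n j + (lev \<gamma> (Suc n) j - lev \<gamma> n j)"
    using lev_mono[of n "Suc n" j] by simp
  then have p: "(2::real) ^ lev \<gamma> (Suc n) j = 2 ^ lev \<gamma> n j * real q"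
    unfolding q_def by (metis of_nat_numeral of_nat_power power_add)
  have 1: "real (i j div q) \<le> real (i j) / real q"
    using of_nat_div_le_of_nat[of "i j" q] by simp
  have 2: "real (i j) / real q \<le> real (i j div q) + 1"
  proof -
    have "i j < q * (i j div q + 1)" using q dividend_less_times_div[of q "i j"] by simp
    then have "real (i j) < real (q * (i j div q + 1))" by (simp only: of_nat_less_iff)
    then have "real (i j) < real q * (real (i j div q) + 1)" by (simp only: of_nat_mult of_nat_add of_nat_1)
    then show ?thesis using q by (simp add: pos_divide_le_eq mult.commute)
  qed
  have e: "real (i j) / 2 ^ lev \<gamma> (Suc n) j = real (i j) / real q / 2 ^ lev \<gamma> n j"
    unfolding p by simp
  have "\<bar>real (i j) / real q / 2 ^ lev \<gamma> n j - real (i j div q) / 2 ^ lev \<gamma> n j\<bar> \<le> 1 / 2 ^ lev \<gamma> n j"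
  proof -
    have *: "\<bar>A / P - B / P\<bar> \<le> 1 / P" if "B \<le> A" "A \<le> B + 1" "P > 0" for A B P :: real
      using that by (simp add: diff_divide_distrib[symmetric] divide_right_mono)
    show ?thesis by (rule *[OF 1 2]) simp
  qed
  moreover have "\<bar>x - y\<bar> \<le> d \<Longrightarrow> \<bar>min 1 x - min 1 y\<bar> \<le> d" for x y d :: real
    by linarith
  ultimately have m: "\<bar>min 1 (real (i j) / 2 ^ lev \<gamma> (Suc n) j) - min 1 (real (i j div q) / 2 ^ lev \<gamma> n j)\<bar> \<le> 1 / 2 ^ lev \<gamma> n j"
    unfolding e by blast
  have ab: "0 \<le> b$j - a$j" using assms[of j] by simp
  note mult_left_mono[OF m ab]
  also have "(b$j - a$j) * (1 / 2 ^ lev \<gamma> n j) \<le> (b$j - a$j) * (2 * 2 powr - (real n * (1 + \<gamma> j)))"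
    by (rule mult_left_mono[OF mesh_le ab])
  also have "\<dots> = 2 * (b$j - a$j) * 2 powr - (real n * (1 + \<gamma> j))" by (simp only: mult_ac)
  finally have bd: "(b$j - a$j) * \<bar>min 1 (real (i j) / 2 ^ lev \<gamma> (Suc n) j) - min 1 (real (i j div q) / 2 ^ lev \<gamma> n j)\<bar>
      \<le> 2 * (b$j - a$j) * 2 powr - (real n * (1 + \<gamma> j))" .
  have "pt \<gamma> a b (Suc n) i $ j = a$j + (b$j - a$j) * min 1 (real (i j) / 2 ^ lev \<gamma> (Suc n) j)"
    "pt \<gamma> a b n (coarsen \<gamma> n (Suc n) i) $ j = a$j + (b$j - a$j) * min 1 (real (i j div q) / 2 ^ lev \<gamma> n j)"
    by (simp_all only: pt_def coarsen_def q_def vec_lambda_beta)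
  then show ?thesis
    using bd ab by (simp only: add_diff_cancel_left right_diff_distrib[symmetric] abs_mult abs_of_nonneg)
qed

lemma idx_coarsen:
  assumes "n \<le> n'" "x \<in> cbox a b"
  shows "coarsen \<gamma> n n' (idx \<gamma> a b n' x) = idx \<gamma> a b n x"
proof
  fix j
  define u where "u = (x$j - a$j) / (b$j - a$j)"
  have u: "0 \<le> u" unfolding u_def using assms(2) by (auto simp: mem_box_cart intro!: divide_nonneg_nonneg order_trans[of "a$j" "x$j" "b$j"])
  define e where "e = lev \<gamma> n' j - lev \<gamma> n j"
  have "lev \<gamma> n' j = lev \<gamma> n j + e"
    unfolding e_def using lev_mono[OF assms(1), of j] by simp
  then have "(2::real) ^ lev \<gamma> n' j = 2 ^ lev \<gamma> n j * 2 ^ e"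
    by (simp only: power_add)
  then have "u * 2 ^ lev \<gamma> n j = u * 2 ^ lev \<gamma> n' j / real_of_int (2 ^ e)" by simp
  then have "\<lfloor>u * 2 ^ lev \<gamma> n j\<rfloor> = \<lfloor>u * 2 ^ lev \<gamma> n' j\<rfloor> div 2 ^ e"
    using floor_divide_real_eq_div[of "2 ^ e" "u * 2 ^ lev \<gamma> n' j"] by simp
  then have "nat \<lfloor>u * 2 ^ lev \<gamma> n j\<rfloor> = nat \<lfloor>u * 2 ^ lev \<gamma> n' j\<rfloor> div 2 ^ e"
    using u by (simp add: nat_div_distrib nat_power_eq)
  then show "coarsen \<gamma> n n' (idx \<gamma> a b n' x) j = idx \<gamma> a b n x j"
    by (simp add: coarsen_def idx_def u_def e_def)
qed

lemma idx_desc: "x \<in> cbox a b \<Longrightarrow> idx \<gamma> a b (n + t) x \<in> desc \<gamma> n t (idx \<gamma> a b n x)"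
  by (simp add: desc_def idx_coarsen)

text \<open>The right end point of a side gets the index \<open>2 ^ lev\<close>, one past the
  regular cells. One extra bit leaves room for it and keeps the bound a power of two, so that
  coarsening respects it exactly.\<close>

lemma idx_bounds:
  assumes "\<And>j. a$j < b$j" "x \<in> cbox a b"
  shows "idx \<gamma> a b n x j < 2 ^ (lev \<gamma> n j + 1)"
    and "\<bar>pt \<gamma> a b n (idx \<gamma> a b n x) $ j - x $ j\<bar> \<le> (b$j - a$j) / 2 ^ lev \<gamma> n j"
proof -
  define u where "u = (x$j - a$j) / (b$j - a$j)"
  define p where "p = (2::real) ^ lev \<gamma> n j"
  have p: "p \<ge> 1" by (simp add: p_def)
  have ab: "a$j < b$j" by fact
  have u: "0 \<le> u" "u \<le> 1" unfolding u_def using assms(2) ab by (auto simp: mem_box_cart)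
  have x: "x$j = a$j + (b$j - a$j) * u" using ab by (simp add: u_def)
  define c where "c = real (nat \<lfloor>u * p\<rfloor>)"
  have c: "c \<le> u * p" "u * p < c + 1" 
  proof -
    have "0 \<le> u * p" using u p by simp
    then have "c = of_int \<lfloor>u * p\<rfloor>" by (simp add: c_def)
    then show "c \<le> u * p" "u * p < c + 1" using floor_correct[of "u * p"] by simp_all
  qed
  have up: "u * p \<le> p" using u p by (simp add: mult_left_le_one_le)
  have "c < 2 * p" using c(1) up p by linarith
  then have "real (nat \<lfloor>u * p\<rfloor>) < real (2 ^ (lev \<gamma> n j + 1))" by (simp add: c_def p_def)
  then show "idx \<gamma> a b n x j < 2 ^ (lev \<gamma> n j + 1)"
    unfolding of_nat_less_iff by (simp add: idx_def u_def p_def)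
  have "c / p \<le> u" using c(1) p by (simp add: pos_divide_le_eq)
  moreover have "u \<le> (c + 1) / p" using c(2) p by (simp add: pos_le_divide_eq)
  then have "u \<le> c / p + 1 / p" by (simp add: add_divide_distrib)
  moreover from calculation have "min 1 (c / p) = c / p" using u by simp
  ultimately have "\<bar>min 1 (c / p) - u\<bar> \<le> 1 / p" by linarith
  then have "(b$j - a$j) * \<bar>min 1 (c / p) - u\<bar> \<le> (b$j - a$j) * (1 / p)"
    by (rule mult_left_mono) (use ab in simp)
  moreover have "pt \<gamma> a b n (idx \<gamma> a b n x) $ j - x $ j = (b$j - a$j) * (min 1 (c / p) - u)"
  proof -
    have "real (idx \<gamma> a b n x j) / 2 ^ lev \<gamma> n j = c / p" by (simp add: idx_def c_def p_def u_def)
    then have "pt \<gamma> a b n (idx \<gamma> a b n x) $ j = a$j + (b$j - a$j) * min 1 (c / p)" by (simp add: pt_def)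
    then show ?thesis by (subst x) (simp only: right_diff_distrib add_diff_cancel_left)
  qed
  ultimately show "\<bar>pt \<gamma> a b n (idx \<gamma> a b n x) $ j - x $ j\<bar> \<le> (b$j - a$j) / 2 ^ lev \<gamma> n j"
    using ab by (simp add: abs_mult p_def)
qed

lemma pt_idx_tendsto:
  assumes "\<And>j. a$j < b$j" "x \<in> cbox a b"
  shows "(\<lambda>n. pt \<gamma> a b n (idx \<gamma> a b n x)) \<longlonglongrightarrow> x"
proof (rule vec_tendstoI)
  fix j
  have "(\<lambda>n. (b$j - a$j) * (1 / 2) ^ n) \<longlonglongrightarrow> (b$j - a$j) * 0"
    by (intro tendsto_intros LIMSEQ_power_zero) auto
  then have "(\<lambda>n. (b$j - a$j) * (1 / 2) ^ n) \<longlonglongrightarrow> 0" by simp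
  moreover have le: "norm (pt \<gamma> a b n (idx \<gamma> a b n x) $ j - x $ j) \<le> (b$j - a$j) * (1 / 2) ^ n" for n
  proof -
    have "1 / (2::real) ^ lev \<gamma> n j \<le> 1 / 2 ^ n"
      using lev_ge[of n j] by (intro divide_left_mono power_increasing) auto
    then have "(b$j - a$j) * (1 / 2 ^ lev \<gamma> n j) \<le> (b$j - a$j) * (1 / 2 ^ n)"
      by (rule mult_left_mono) (use assms(1)[of j] in simp)
    then show ?thesis using idx_bounds(2)[OF assms, of n j] by (simp add: power_divide)
  qed
  ultimately have "(\<lambda>n. pt \<gamma> a b n (idx \<gamma> a b n x) $ j - x $ j) \<longlonglongrightarrow> 0"
    by (intro Lim_null_comparison[OF always_eventually[OF allI[OF le]]])
  then show "(\<lambda>n. pt \<gamma> a b n (idx \<gamma> a b n x) $ j) \<longlonglongrightarrow> x $ j"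
    by (simp add: LIM_zero_iff)
qed

text \<open>Continuity at \<open>x\<close> carries the bound along the cells that shrink to
  \<open>x\<close> over to \<open>x\<close> itself; all other estimates live on grid points.\<close>

lemma chain_limit:
  fixes f :: "real^'k \<Rightarrow> real"
  assumes ab: "\<And>j. a$j < b$j" "x \<in> cbox a b" and f: "isCont f x"
    and osc: "\<And>t i. i \<in> desc \<gamma> n t (idx \<gamma> a b n x) \<Longrightarrow>
      \<bar>f (pt \<gamma> a b (n + t) i) - f (pt \<gamma> a b n (idx \<gamma> a b n x))\<bar> \<le> B"
  shows "\<bar>f x - f (pt \<gamma> a b n (idx \<gamma> a b n x))\<bar> \<le> B"
proof -
  have "(\<lambda>t. pt \<gamma> a b (t + n) (idx \<gamma> a b (t + n) x)) \<longlonglongrightarrow> x"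
    using pt_idx_tendsto[OF ab] by (rule LIMSEQ_ignore_initial_segment)
  then have "(\<lambda>t. f (pt \<gamma> a b (n + t) (idx \<gamma> a b (n + t) x))) \<longlonglongrightarrow> f x"
    using isCont_tendsto_compose[OF f] by (simp add: add.commute)
  then have "(\<lambda>t. \<bar>f (pt \<gamma> a b (n + t) (idx \<gamma> a b (n + t) x)) - f (pt \<gamma> a b n (idx \<gamma> a b n x))\<bar>)
      \<longlonglongrightarrow> \<bar>f x - f (pt \<gamma> a b n (idx \<gamma> a b n x))\<bar>"
    by (intro tendsto_rabs tendsto_diff tendsto_const)
  moreover have "\<bar>f (pt \<gamma> a b (n + t) (idx \<gamma> a b (n + t) x)) - f (pt \<gamma> a b n (idx \<gamma> a b n x))\<bar> \<le> B" for t
    by (rule osc[OF idx_desc[OF ab(2)]])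
  ultimately show ?thesis by (intro LIMSEQ_le_const2) auto
qed

end

lemma powr_quarter: "(2::real) powr - (1 / 4) \<le> 7 / 8"
proof -
  have "(2 powr - (1 / 4)) ^ 4 = (2::real) powr - 1" by (simp add: powr_power)
  also have "\<dots> \<le> (7 / 8) ^ 4" by (simp add: powr_minus power4_eq_xxxx)
  finally show ?thesis by (subst (asm) power_mono_iff) auto
qed

text \<open>The ratio of the geometric series is at most 7/8, so its sum is at most 8. This is the
  factor 8 of the oscillation bounds.\<close>

lemma sum_powr_quarter:
  assumes "0 \<le> \<tau>" shows "(\<Sum>s<t. \<tau> * 2 powr - (real s / 4)) \<le> 8 * \<tau>"
proof -
  have "2 powr - (real s / 4) = (2 powr - (1 / 4)) ^ s" for s :: nat
    by (simp add: powr_power)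
  then have "(\<Sum>s<t. \<tau> * 2 powr - (real s / 4)) = \<tau> * (\<Sum>s<t. (2 powr - (1 / 4)) ^ s)"
    by (simp add: sum_distrib_left)
  also have "\<dots> \<le> \<tau> * (\<Sum>s<t. (7 / 8) ^ s)"
    using powr_quarter assms by (intro mult_left_mono sum_mono power_mono) auto
  also have "\<dots> \<le> \<tau> * 8"
    using assms by (intro mult_left_mono) (simp_all add: sum_gp_strict)
  finally show ?thesis by simp
qed

subsection \<open>Chaining and small oscillations\<close>

lemma power_le_imp_le_base_pos:
  fixes x y :: real
  shows "x ^ n \<le> y ^ n \<Longrightarrow> 0 \<le> y \<Longrightarrow> 0 < n \<Longrightarrow> x \<le> y"
  using power_strict_mono[of y x n] by linarith

locale boxes = gaussian_space M G + grid \<gamma>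
  for M :: "'w measure" and G and \<gamma> :: "'k::finite \<Rightarrow> real" +
  fixes m :: nat and a b :: "nat \<Rightarrow> real^'k"
  assumes ab: "l < m \<Longrightarrow> a l $ j < b l $ j"
begin

text \<open>Oscillation is tested at the countably many grid points below a tuple of cells, one cell
  per box. This makes the event measurable without any regularity of the single noise parts, whose
  paths are not assumed continuous.\<close>

definition oscf :: "(real^'k \<Rightarrow> real^'d) \<Rightarrow> nat \<Rightarrow> (nat \<Rightarrow> 'k \<Rightarrow> nat) \<Rightarrow> real \<Rightarrow> bool" where
  "oscf f n C \<delta> \<longleftrightarrow> (\<forall>l<m. \<forall>t. \<forall>i\<in>desc \<gamma> n t (C l). \<forall>e.
     \<bar>f (pt \<gamma> (a l) (b l) (n + t) i) $ e - f (pt \<gamma> (a l) (b l) n (C l)) $ e\<bar> \<le> \<delta>)"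

text \<open>A power of this weighted \<open>\<ell>\<^sup>p\<close> norm of the chaining increments dominates the oscillation, and
  its expectation is a plain sum of Gaussian moments.\<close>

definition chain_norm :: "nat \<Rightarrow> (real^'k \<Rightarrow> real^'d) \<Rightarrow> nat \<Rightarrow> (nat \<Rightarrow> 'k \<Rightarrow> nat) \<Rightarrow> ennreal" where
  "chain_norm q f n C = (\<Sum>s. \<Sum>l<m. \<Sum>i\<in>desc \<gamma> n (Suc s) (C l). \<Sum>e\<in>UNIV.
     ennreal ((2 powr (real s / 4) * \<bar>link \<gamma> (a l) (b l) (n + s) i (\<lambda>x. f x $ e)\<bar>) ^ (2 * q)))"

definition gproc :: "(real^'k \<Rightarrow> 'w \<Rightarrow> real^'d) \<Rightarrow> bool" where
  "gproc Y \<longleftrightarrow> (\<forall>l<m. \<forall>x\<in>cbox (a l) (b l). \<forall>e. (\<lambda>\<omega>. Y x \<omega> $ e) \<in> G)"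

text \<open>A link of the whole field at depth \<open>s\<close> has deviation of order
  \<open>2^(-n - s)\<close>. Only three quarters of the decay in \<open>s\<close> are demanded: the
  remaining quarter pays for the gain \<open>2^(-g h)\<close> in \<open>linkvar_rest\<close>, where
  \<open>g \<le> 1 / 4\<close>.\<close>

definition linkvar :: "(real^'k \<Rightarrow> 'w \<Rightarrow> real^'d) \<Rightarrow> nat \<Rightarrow> (nat \<Rightarrow> 'k \<Rightarrow> nat) \<Rightarrow> real \<Rightarrow> bool" where
  "linkvar Y n C B \<longleftrightarrow> (\<forall>l<m. \<forall>s. \<forall>i\<in>desc \<gamma> n (Suc s) (C l). \<forall>e.
     (\<integral>\<omega>. (link \<gamma> (a l) (b l) (n + s) i (\<lambda>x. Y x \<omega> $ e))\<^sup>2 \<partial>M) \<le> (B * 2 powr - (3 / 4 * real s))\<^sup>2)"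

definition chain_const :: "nat \<Rightarrow> nat \<Rightarrow> real" where
  "chain_const d q = real m * real d * (fact (2 * q) / (2 ^ q * fact q)) * 2 ^ CARD('k) * 2 powr Qdim \<gamma> * 2"

lemma chain_const_nonneg: "0 \<le> chain_const d q"
  by (simp add: chain_const_def)

lemma oscf_add:
  assumes "oscf f n C \<delta>" "oscf g n C \<delta>'"
  shows "oscf (\<lambda>x. f x + g x) n C (\<delta> + \<delta>')"
  unfolding oscf_def
proof (intro allI ballI impI)
  fix l t i e assume *: "l < m" "i \<in> desc \<gamma> n t (C l)"
  let ?x = "pt \<gamma> (a l) (b l) (n + t) i" and ?y = "pt \<gamma> (a l) (b l) n (C l)"
  have "\<bar>f ?x $ e - f ?y $ e\<bar> \<le> \<delta>" "\<bar>g ?x $ e - g ?y $ e\<bar> \<le> \<delta>'"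
    using assms * by (auto simp: oscf_def)
  then show "\<bar>(f ?x + g ?x) $ e - (f ?y + g ?y) $ e\<bar> \<le> \<delta> + \<delta>'" by simp
qed

lemma oscf_links:
  assumes "\<And>l s i e. l < m \<Longrightarrow> i \<in> desc \<gamma> n (Suc s) (C l) \<Longrightarrow> \<bar>link \<gamma> (a l) (b l) (n + s) i (\<lambda>x. f x $ e)\<bar> \<le> \<beta> s"
    and \<beta>: "\<And>t. (\<Sum>s<t. \<beta> s) \<le> \<delta>"
  shows "oscf f n C \<delta>"
  unfolding oscf_def
proof (intro allI ballI impI)
  fix l t i e assume *: "l < m" "i \<in> desc \<gamma> n t (C l)"
  have "\<bar>f (pt \<gamma> (a l) (b l) (n + t) i) $ e - f (pt \<gamma> (a l) (b l) n (C l)) $ e\<bar> \<le> (\<Sum>s<t. \<beta> s)"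
    by (rule chain_bound[where f = "\<lambda>x. f x $ e", OF assms(1)[OF *(1)] *(2)])
  also have "\<dots> \<le> \<delta>" by fact
  finally show "\<bar>f (pt \<gamma> (a l) (b l) (n + t) i) $ e - f (pt \<gamma> (a l) (b l) n (C l)) $ e\<bar> \<le> \<delta>" .
qed

lemma chain_norm_link_le:
  assumes "chain_norm q f n C \<le> ennreal (\<tau> ^ (2 * q))" "0 < q" "0 \<le> \<tau>" "l < m" "i \<in> desc \<gamma> n (Suc s) (C l)"
  shows "\<bar>link \<gamma> (a l) (b l) (n + s) i (\<lambda>x. f x $ e)\<bar> \<le> \<tau> * 2 powr - (real s / 4)"
proof -
  define g where "g s l i e = ennreal ((2 powr (real s / 4) * \<bar>link \<gamma> (a l) (b l) (n + s) i (\<lambda>x. f x $ e)\<bar>) ^ (2 * q))" for s l i e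
  have "g s l i e \<le> (\<Sum>e\<in>UNIV. g s l i e)" by (rule member_le_sum) auto
  also have "\<dots> \<le> (\<Sum>i\<in>desc \<gamma> n (Suc s) (C l). \<Sum>e\<in>UNIV. g s l i e)"
    using assms(5) by (intro member_le_sum[of i _ "\<lambda>i. \<Sum>e\<in>UNIV. g s l i e"]) auto
  also have "\<dots> \<le> (\<Sum>l<m. \<Sum>i\<in>desc \<gamma> n (Suc s) (C l). \<Sum>e\<in>UNIV. g s l i e)"
    using assms(4) by (intro member_le_sum[of l _ "\<lambda>l. \<Sum>i\<in>desc \<gamma> n (Suc s) (C l). \<Sum>e\<in>UNIV. g s l i e"]) auto
  also have "\<dots> \<le> chain_norm q f n C"
    unfolding chain_norm_def g_def[symmetric]
    using sum_le_suminf[OF summableI, of "{s}" "\<lambda>s. \<Sum>l<m. \<Sum>i\<in>desc \<gamma> n (Suc s) (C l). \<Sum>e\<in>UNIV. g s l i e"] by simp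
  finally have "g s l i e \<le> ennreal (\<tau> ^ (2 * q))" using assms(1) by simp
  then have "(2 powr (real s / 4) * \<bar>link \<gamma> (a l) (b l) (n + s) i (\<lambda>x. f x $ e)\<bar>) ^ (2 * q) \<le> \<tau> ^ (2 * q)"
    using assms(3) by (simp add: g_def)
  then have "2 powr (real s / 4) * \<bar>link \<gamma> (a l) (b l) (n + s) i (\<lambda>x. f x $ e)\<bar> \<le> \<tau>"
    by (rule power_le_imp_le_base_pos[OF _ assms(3)]) (use assms(2) in simp)
  then show ?thesis by (simp add: powr_minus field_simps)
qed

lemma chain_norm_oscf:
  assumes "chain_norm q f n C \<le> ennreal (\<tau> ^ (2 * q))" "0 < q" "0 \<le> \<tau>"
  shows "oscf f n C (8 * \<tau>)"
  by (rule oscf_links[where \<beta> = "\<lambda>s. \<tau> * 2 powr - (real s / 4)"])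
     (use chain_norm_link_le[OF assms] sum_powr_quarter[OF assms(3)] in auto)

lemma link_G:
  assumes "gproc Y" "l < m"
  shows "(\<lambda>\<omega>. link \<gamma> (a l) (b l) n i (\<lambda>x. Y x \<omega> $ e)) \<in> G"
  unfolding link_def using assms pt_in_box[OF ab]
  by (intro diff) (auto simp: gproc_def)

lemma gproc_meas:
  assumes "gproc Y" "l < m"
  shows "(\<lambda>\<omega>. Y (pt \<gamma> (a l) (b l) n i) \<omega> $ e) \<in> borel_measurable M"
  using assms pt_in_box[OF ab] by (intro meas) (auto simp: gproc_def)

lemma oscf_meas:
  assumes "gproc Y"
  shows "{\<omega>\<in>space M. oscf (\<lambda>x. Y x \<omega>) n C \<delta>} \<in> sets M"
proof -
  have [measurable]: "(\<lambda>\<omega>. Y (pt \<gamma> (a l) (b l) n i) \<omega> $ e) \<in> borel_measurable M" if "l \<in> {..<m}" for l n i e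
    using gproc_meas[OF assms] that by simp
  have "{\<omega>\<in>space M. oscf (\<lambda>x. Y x \<omega>) n C \<delta>} = {\<omega>\<in>space M. \<forall>l\<in>{..<m}. \<forall>t. \<forall>i\<in>desc \<gamma> n t (C l). \<forall>e\<in>UNIV.
     \<bar>Y (pt \<gamma> (a l) (b l) (n + t) i) \<omega> $ e - Y (pt \<gamma> (a l) (b l) n (C l)) \<omega> $ e\<bar> \<le> \<delta>}"
    by (auto simp: oscf_def)
  also have "\<dots> \<in> sets M" by measurable
  finally show ?thesis .
qed

lemma chain_norm_meas:
  assumes "gproc Y"
  shows "(\<lambda>\<omega>. chain_norm q (\<lambda>x. Y x \<omega>) n C) \<in> borel_measurable M"
proof -
  have [measurable]: "(\<lambda>\<omega>. link \<gamma> (a l) (b l) n i (\<lambda>x. Y x \<omega> $ e)) \<in> borel_measurable M" if "l \<in> {..<m}" for l n i e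
    using link_G[OF assms] that by (intro meas) simp
  show ?thesis unfolding chain_norm_def by measurable
qed

text \<open>At depth \<open>s\<close> there are at most a constant times \<open>2^(s Q)\<close>
  links, and each contributes at most a constant times \<open>B^(2 q) 2^(-s q)\<close> to the
  expectation. As \<open>q\<close> exceeds \<open>Q\<close> by at least one, the sum is dominated by
  a geometric series of ratio 1/2. \<open>chain_const\<close> collects the numbers of boxes and
  components, the Gaussian moment, the rounding and \<open>Suc\<close> factors from
  \<open>card_desc_le\<close>, and the value 2 of that series.\<close>

lemma chain_norm_moment:
  fixes Y :: "real^'k \<Rightarrow> 'w \<Rightarrow> real^'d"
  assumes Y: "gproc Y" and lv: "linkvar Y n C B" and B: "0 \<le> B" and q: "Qdim \<gamma> + 1 \<le> real q"
  shows "(\<integral>\<^sup>+\<omega>. chain_norm q (\<lambda>x. Y x \<omega>) n C \<partial>M) \<le> ennreal (chain_const CARD('d) q * B ^ (2 * q))"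
proof -
  have [measurable]: "(\<lambda>\<omega>. link \<gamma> (a l) (b l) n i (\<lambda>x. Y x \<omega> $ e)) \<in> borel_measurable M" if "l \<in> {..<m}" for l n i e
    using link_G[OF Y] that by (intro meas) simp
  define cq where "cq = fact (2 * q) / (2 ^ q * fact q :: real)"
  have cq: "cq \<ge> 0" by (simp add: cq_def)
  have trm: "(\<integral>\<^sup>+\<omega>. ennreal ((2 powr (real s / 4) * \<bar>link \<gamma> (a l) (b l) (n + s) i (\<lambda>x. Y x \<omega> $ e)\<bar>) ^ (2 * q)) \<partial>M)
      \<le> ennreal (cq * B ^ (2 * q) * 2 powr - (real s * real q))"
    if "l < m" "i \<in> desc \<gamma> n (Suc s) (C l)" for l s i e
  proof -
    have "(\<integral>\<^sup>+\<omega>. ennreal ((2 powr (real s / 4) * \<bar>link \<gamma> (a l) (b l) (n + s) i (\<lambda>x. Y x \<omega> $ e)\<bar>) ^ (2 * q)) \<partial>M) =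
      ennreal ((2 powr (real s / 4)) ^ (2 * q)) * (\<integral>\<^sup>+\<omega>. ennreal (\<bar>link \<gamma> (a l) (b l) (n + s) i (\<lambda>x. Y x \<omega> $ e)\<bar> ^ (2 * q)) \<partial>M)"
      using that by (subst nn_integral_cmult[symmetric]) (auto simp: power_mult_distrib ennreal_mult'')
    also have "\<dots> \<le> ennreal ((2 powr (real s / 4)) ^ (2 * q)) * ennreal (cq * (B * 2 powr - (3 / 4 * real s)) ^ (2 * q))"
      unfolding cq_def using that lv by (intro mult_left_mono nn_moment link_G[OF Y]) (auto simp: linkvar_def)
    also have "\<dots> = ennreal ((2 powr (real s / 4)) ^ (2 * q) * (cq * (B * 2 powr - (3 / 4 * real s)) ^ (2 * q)))"
      using cq B by (intro ennreal_mult[symmetric]) auto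
    also have "(2 powr (real s / 4)) ^ (2 * q) * (cq * (B * 2 powr - (3 / 4 * real s)) ^ (2 * q)) =
        cq * B ^ (2 * q) * (2 powr (real s / 4) * 2 powr - (3 / 4 * real s)) ^ (2 * q)"
      by (simp only: power_mult_distrib mult_ac)
    \<comment> \<open>The exponents \<open>1 / 4\<close> and \<open>- 3 / 4\<close> leave
      \<open>- 1 / 2\<close>, and \<open>2 * q\<close> factors of it give
      \<open>- q\<close>.\<close>
    also have "(2 powr (real s / 4) * 2 powr - (3 / 4 * real s)) ^ (2 * q) = 2 powr - (real s * real q)"
      unfolding powr_add[symmetric] by (subst powr_power) (auto intro!: arg_cong[where f = "\<lambda>x. 2 powr x"])
    finally show ?thesis .
  qed
  define c where "c = real m * real CARD('d) * cq * 2 ^ CARD('k) * 2 powr Qdim \<gamma> * B ^ (2 * q)"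
  have c: "c \<ge> 0" using cq B by (simp add: c_def)
  have "(\<integral>\<^sup>+\<omega>. chain_norm q (\<lambda>x. Y x \<omega>) n C \<partial>M) =
      (\<Sum>s. \<Sum>l<m. \<Sum>i\<in>desc \<gamma> n (Suc s) (C l). \<Sum>e\<in>UNIV. (\<integral>\<^sup>+\<omega>. ennreal ((2 powr (real s / 4) * \<bar>link \<gamma> (a l) (b l) (n + s) i (\<lambda>x. Y x \<omega> $ e)\<bar>) ^ (2 * q)) \<partial>M))"
    unfolding chain_norm_def by (simp add: nn_integral_suminf nn_integral_sum del: sum_ennreal)
  also have "\<dots> \<le> (\<Sum>s. ennreal (c * (1 / 2) ^ s))"
  proof (intro suminf_le summableI)
    fix s
    have "(\<Sum>l<m. \<Sum>i\<in>desc \<gamma> n (Suc s) (C l). \<Sum>e\<in>UNIV. (\<integral>\<^sup>+\<omega>. ennreal ((2 powr (real s / 4) * \<bar>link \<gamma> (a l) (b l) (n + s) i (\<lambda>x. Y x \<omega> $ e)\<bar>) ^ (2 * q)) \<partial>M))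
      \<le> (\<Sum>l<m. \<Sum>i\<in>desc \<gamma> n (Suc s) (C l). \<Sum>e\<in>(UNIV::'d set). ennreal (cq * B ^ (2 * q) * 2 powr - (real s * real q)))"
      by (intro sum_mono trm) auto
    also have "\<dots> = ennreal (\<Sum>l<m. real (card (desc \<gamma> n (Suc s) (C l))) * (real CARD('d) * (cq * B ^ (2 * q) * 2 powr - (real s * real q))))"
      using cq B by (simp add: sum_ennreal ennreal_mult ennreal_of_nat_eq_real_of_nat[symmetric] flip: sum_ennreal)
    also have "\<dots> \<le> ennreal (\<Sum>l<m. (2 ^ CARD('k) * 2 powr (real (Suc s) * Qdim \<gamma>)) * (real CARD('d) * (cq * B ^ (2 * q) * 2 powr - (real s * real q))))"
      using cq B by (intro ennreal_leI sum_mono mult_right_mono card_desc_le) auto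
    also have "\<dots> = ennreal (c * (2 powr (real s * Qdim \<gamma>) * 2 powr - (real s * real q)))"
      by (simp add: c_def powr_add algebra_simps)
    also have "\<dots> \<le> ennreal (c * (1 / 2) ^ s)"
    proof (intro ennreal_leI mult_left_mono c)
      have "real s * Qdim \<gamma> + - (real s * real q) = real s * (Qdim \<gamma> - real q)" by (simp add: algebra_simps)
      also have "\<dots> \<le> real s * (-1)" using q by (intro mult_left_mono) auto
      finally have "2 powr (real s * Qdim \<gamma> + - (real s * real q)) \<le> 2 powr - real s" by (intro powr_mono) auto
      then show "2 powr (real s * Qdim \<gamma>) * 2 powr - (real s * real q) \<le> (1 / 2) ^ s"
        by (simp add: powr_diff powr_minus_divide powr_realpow power_divide)
    qed
    finally show "(\<Sum>l<m. \<Sum>i\<in>desc \<gamma> n (Suc s) (C l). \<Sum>e\<in>UNIV. (\<integral>\<^sup>+\<omega>. ennreal ((2 powr (real s / 4) * \<bar>link \<gamma> (a l) (b l) (n + s) i (\<lambda>x. Y x \<omega> $ e)\<bar>) ^ (2 * q)) \<partial>M)) \<le> ennreal (c * (1 / 2) ^ s)" .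
  qed
  also have "\<dots> = ennreal (\<Sum>s. c * (1 / 2) ^ s)"
    using c by (intro suminf_ennreal2 summable_mult summable_geometric) auto
  also have "(\<Sum>s. c * (1 / 2) ^ s) = c * 2"
    by (subst suminf_mult) (auto simp: suminf_geometric)
  also have "c * 2 = chain_const CARD('d) q * B ^ (2 * q)"
    by (simp add: c_def chain_const_def cq_def)
  finally show ?thesis .
qed

lemma chain_norm_tail:
  fixes Y :: "real^'k \<Rightarrow> 'w \<Rightarrow> real^'d"
  assumes Y: "gproc Y" and lv: "linkvar Y n C B" and B: "0 \<le> B" and q: "Qdim \<gamma> + 1 \<le> real q" and "0 < \<tau>"
  shows "prob {\<omega>\<in>space M. \<not> chain_norm q (\<lambda>x. Y x \<omega>) n C \<le> ennreal (\<tau> ^ (2 * q))} \<le> chain_const CARD('d) q * (B / \<tau>) ^ (2 * q)"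
proof -
  note [measurable] = chain_norm_meas[OF Y]
  have t: "0 < \<tau> ^ (2 * q)" using \<open>0 < \<tau>\<close> by simp
  define c where "c = inverse (\<tau> ^ (2 * q))"
  have c: "c > 0" using t by (simp add: c_def)
  have "emeasure M {\<omega>\<in>space M. \<not> chain_norm q (\<lambda>x. Y x \<omega>) n C \<le> ennreal (\<tau> ^ (2 * q))} \<le>
      emeasure M ({\<omega>\<in>space M. 1 \<le> ennreal c * chain_norm q (\<lambda>x. Y x \<omega>) n C})"
  proof (intro emeasure_mono)
    have "1 \<le> ennreal c * r" if "\<not> r \<le> ennreal (\<tau> ^ (2 * q))" for r
    proof -
      have "1 = ennreal c * ennreal (\<tau> ^ (2 * q))" using t \<open>0 < \<tau>\<close> by (simp add: c_def ennreal_mult'[symmetric])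
      also have "\<dots> \<le> ennreal c * r" using that by (intro mult_left_mono) auto
      finally show ?thesis .
    qed
    then show "{\<omega>\<in>space M. \<not> chain_norm q (\<lambda>x. Y x \<omega>) n C \<le> ennreal (\<tau> ^ (2 * q))} \<subseteq>
      {\<omega>\<in>space M. 1 \<le> ennreal c * chain_norm q (\<lambda>x. Y x \<omega>) n C}" by auto
  qed measurable
  also have "\<dots> \<le> ennreal c * (\<integral>\<^sup>+\<omega>. chain_norm q (\<lambda>x. Y x \<omega>) n C * indicator (space M) \<omega> \<partial>M)"
    by (rule nn_integral_Markov_inequality) measurable
  also have "(\<integral>\<^sup>+\<omega>. chain_norm q (\<lambda>x. Y x \<omega>) n C * indicator (space M) \<omega> \<partial>M) = (\<integral>\<^sup>+\<omega>. chain_norm q (\<lambda>x. Y x \<omega>) n C \<partial>M)"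
    by (intro nn_integral_cong) simp
  also have "ennreal c * \<dots> \<le> ennreal c * ennreal (chain_const CARD('d) q * B ^ (2 * q))"
    by (intro mult_left_mono chain_norm_moment assms) auto
  also have "\<dots> = ennreal (chain_const CARD('d) q * (B / \<tau>) ^ (2 * q))"
    using c by (simp add: ennreal_mult'[symmetric] c_def power_divide) (simp add: divide_inverse mult_ac)
  finally show ?thesis
    using chain_const_nonneg[of "CARD('d)" q] B \<open>0 < \<tau>\<close> by (simp add: emeasure_eq_measure)
qed

text \<open>\<open>q\<close> may be taken as large as desired, so a deviation \<open>B\<close> that
  is small against \<open>\<delta>\<close> makes a large oscillation rare at any polynomial rate.
  This is applied to the low frequencies and to the noise outside a band.\<close>

lemma oscf_tail:
  fixes Y :: "real^'k \<Rightarrow> 'w \<Rightarrow> real^'d"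
  assumes Y: "gproc Y" and lv: "linkvar Y n C B" and B: "0 \<le> B" and q: "Qdim \<gamma> + 1 \<le> real q" and "0 < \<delta>"
  shows "prob {\<omega>\<in>space M. \<not> oscf (\<lambda>x. Y x \<omega>) n C \<delta>} \<le> chain_const CARD('d) q * (8 * B / \<delta>) ^ (2 * q)"
proof -
  have q0: "0 < q" using q Qdim_pos by linarith
  note [measurable] = chain_norm_meas[OF Y]
  have "prob {\<omega>\<in>space M. \<not> oscf (\<lambda>x. Y x \<omega>) n C \<delta>} \<le>
      prob {\<omega>\<in>space M. \<not> chain_norm q (\<lambda>x. Y x \<omega>) n C \<le> ennreal ((\<delta> / 8) ^ (2 * q))}"
    using chain_norm_oscf[OF _ q0, of _ n C "\<delta> / 8"] \<open>0 < \<delta>\<close>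
    by (intro finite_measure_mono) auto
  also have "\<dots> \<le> chain_const CARD('d) q * (B / (\<delta> / 8)) ^ (2 * q)"
    using \<open>0 < \<delta>\<close> by (intro chain_norm_tail assms) auto
  finally show ?thesis by (simp add: mult.commute)
qed

text \<open>The lower bound is uniform in the cell and in the process: this is what makes it
  possible to wait for a good scale.\<close>

lemma small_osc:
  assumes "0 < \<epsilon>" "0 < B"
  obtains p where "0 < p"
    "\<And>(Y :: real^'k \<Rightarrow> 'w \<Rightarrow> real^'d) n C. gproc Y \<Longrightarrow> linkvar Y n C (B * 2 powr - real n) \<Longrightarrow>
       p \<le> prob {\<omega>\<in>space M. oscf (\<lambda>x. Y x \<omega>) n C (\<epsilon> * 2 powr - real n)}"
proof -
  obtain q :: nat where q: "Qdim \<gamma> + 1 \<le> real q" using real_arch_simple by blast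
  have q0: "0 < q" using q Qdim_pos by linarith
  \<comment> \<open>With the threshold \<open>\<tau> = B * K\<close> Markov's inequality leaves
    probability at most 1/2 for exceeding it, which supplies the event of probability 1/2 that
    \<open>small_ball\<close> starts from.\<close>
  define K where "K = 2 * chain_const CARD('d) q + 1"
  have K: "K \<ge> 1" using chain_const_nonneg[of "CARD('d)" q] by (simp add: K_def)
  define \<tau> where "\<tau> = B * K"
  have \<tau>: "0 < \<tau>" using K assms by (simp add: \<tau>_def)
  have half: "chain_const CARD('d) q * (B / \<tau>) ^ (2 * q) \<le> 1 / 2"
  proof -
    have "(B / \<tau>) ^ (2 * q) = (1 / K) ^ (2 * q)" using assms by (simp add: \<tau>_def)
    also have "\<dots> \<le> (1 / K) ^ 1" using K q0 by (intro power_decreasing) auto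
    finally have "chain_const CARD('d) q * (B / \<tau>) ^ (2 * q) \<le> chain_const CARD('d) q * (1 / K)"
      using chain_const_nonneg by (intro mult_left_mono) auto
    also have "\<dots> \<le> 1 / 2" using K by (simp add: K_def field_simps)
    finally show ?thesis .
  qed
  \<comment> \<open>Links at depth \<open>S0\<close> or more are kept within twice their threshold;
    their sum, with the factor 8 of the series, uses half of \<open>\<epsilon>\<close>. The first
    \<open>S0\<close> levels share the other half, \<open>\<eta>\<close> each.\<close>
  obtain S0 :: nat where S0: "16 * \<tau> * 2 powr - (real S0 / 4) \<le> \<epsilon> / 2"
  proof -
    have "(\<lambda>s. 16 * \<tau> * 2 powr - (real s / 4)) \<longlonglongrightarrow> 16 * \<tau> * 0"
      by (intro tendsto_intros) real_asymp
    then have "\<forall>\<^sub>F s in sequentially. 16 * \<tau> * 2 powr - (real s / 4) < \<epsilon> / 2"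
      using assms by (intro order_tendstoD(2)) auto
    then show ?thesis using that by (auto simp: eventually_sequentially intro: less_imp_le)
  qed
  define \<eta> where "\<eta> = \<epsilon> / (2 * real S0 + 1)"
  have \<eta>: "0 < \<eta>" "real S0 * \<eta> \<le> \<epsilon> / 2" using assms by (simp_all add: \<eta>_def field_simps)
  \<comment> \<open>An upper bound for the number of links of depth below \<open>S0\<close>, uniform
    in the level and in the cells.\<close>
  define NN where "NN = S0 * (m * (nat \<lceil>2 ^ CARD('k) * 2 powr (real S0 * Qdim \<gamma>)\<rceil> * CARD('d)))"
  define p where "p = 1 / (4 * (2 * \<tau> / \<eta> + 2) ^ NN)"
  have base: "1 \<le> 2 * \<tau> / \<eta> + 2" using \<tau> \<eta> by (simp add: add_increasing)
  have p0: "0 < p" using base by (auto simp: p_def intro!: divide_pos_pos mult_pos_pos)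
  have "p \<le> prob {\<omega>\<in>space M. oscf (\<lambda>x. Y x \<omega>) n C (\<epsilon> * 2 powr - real n)}"
    if Y: "gproc Y" and lv: "linkvar Y n C (B * 2 powr - real n)"
    for Y :: "real^'k \<Rightarrow> 'w \<Rightarrow> real^'d" and n C
  proof -
    define w where "w = 2 powr - real n"
    have w: "w > 0" by (simp add: w_def)
    define \<Lambda> :: "(nat \<times> nat \<times> ('k \<Rightarrow> nat) \<times> 'd) set" where "\<Lambda> = {(s, l, i, e). l < m \<and> i \<in> desc \<gamma> n (Suc s) (C l)}"
    define \<Lambda>0 where "\<Lambda>0 = (SIGMA s:{..<S0}. SIGMA l:{..<m}. desc \<gamma> n (Suc s) (C l) \<times> (UNIV :: 'd set))"
    have \<Lambda>0_alt: "(s, l, i, e) \<in> \<Lambda>0 \<longleftrightarrow> (s, l, i, e) \<in> \<Lambda> \<and> s < S0" for s l i e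
      by (auto simp: \<Lambda>_def \<Lambda>0_def)
    define X where "X = (\<lambda>(s, l, i, e) \<omega>. link \<gamma> (a l) (b l) (n + s) i (\<lambda>x. Y x \<omega> $ e))"
    define \<beta> :: "nat \<times> nat \<times> ('k \<Rightarrow> nat) \<times> 'd \<Rightarrow> real" where "\<beta> = (\<lambda>(s, l, i, e). \<tau> * w * 2 powr - (real s / 4))"
    have cnt: "countable \<Lambda>" by (rule countable_subset[of _ UNIV]) auto
    have sub: "\<Lambda>0 \<subseteq> \<Lambda>" by (auto simp: \<Lambda>_def \<Lambda>0_def)
    have fin: "finite \<Lambda>0" unfolding \<Lambda>0_def by (intro finite_SigmaI) auto
    have card: "card \<Lambda>0 \<le> NN"
    proof -
      have d: "card (desc \<gamma> n (Suc s) (C l)) \<le> nat \<lceil>2 ^ CARD('k) * 2 powr (real S0 * Qdim \<gamma>)\<rceil>" if "s < S0" for s l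
      proof -
        have "real (card (desc \<gamma> n (Suc s) (C l))) \<le> 2 ^ CARD('k) * 2 powr (real (Suc s) * Qdim \<gamma>)"
          by (rule card_desc_le)
        also have "\<dots> \<le> 2 ^ CARD('k) * 2 powr (real S0 * Qdim \<gamma>)"
          using that Qdim_pos by (intro mult_left_mono powr_mono mult_right_mono) auto
        finally show ?thesis by linarith
      qed
      have "card \<Lambda>0 = (\<Sum>s<S0. \<Sum>l<m. card (desc \<gamma> n (Suc s) (C l)) * CARD('d))"
        unfolding \<Lambda>0_def by (simp add: card_cartesian_product)
      also have "\<dots> \<le> (\<Sum>s<S0. \<Sum>l<m. nat \<lceil>2 ^ CARD('k) * 2 powr (real S0 * Qdim \<gamma>)\<rceil> * CARD('d))"
        using d by (intro sum_mono mult_right_mono) auto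
      also have "\<dots> = NN" by (simp add: NN_def)
      finally show ?thesis .
    qed
    have XG: "X l \<in> G" if "l \<in> \<Lambda>" for l
      using that link_G[OF Y] by (auto simp: \<Lambda>_def X_def)
    have [measurable]: "X l \<in> borel_measurable M" if "l \<in> \<Lambda>" for l using XG[OF that] by simp
    have "1 / 2 \<le> prob {\<omega>\<in>space M. chain_norm q (\<lambda>x. Y x \<omega>) n C \<le> ennreal ((\<tau> * w) ^ (2 * q))}"
    proof -
      note [measurable] = chain_norm_meas[OF Y]
      have "prob {\<omega>\<in>space M. \<not> chain_norm q (\<lambda>x. Y x \<omega>) n C \<le> ennreal ((\<tau> * w) ^ (2 * q))} \<le>
          chain_const CARD('d) q * ((B * w) / (\<tau> * w)) ^ (2 * q)"
        using lv w \<tau> assms by (intro chain_norm_tail Y q) (auto simp: w_def)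
      also have "\<dots> \<le> 1 / 2" using half w by simp
      finally show ?thesis by (subst (asm) prob_neg) auto
    qed
    also have "\<dots> \<le> prob {\<omega>\<in>space M. \<forall>l\<in>\<Lambda>. \<bar>X l \<omega>\<bar> \<le> \<beta> l}"
    proof (rule finite_measure_mono)
      show "{\<omega>\<in>space M. chain_norm q (\<lambda>x. Y x \<omega>) n C \<le> ennreal ((\<tau> * w) ^ (2 * q))} \<subseteq> {\<omega>\<in>space M. \<forall>l\<in>\<Lambda>. \<bar>X l \<omega>\<bar> \<le> \<beta> l}"
        using chain_norm_link_le[OF _ q0, where \<tau> = "\<tau> * w"] \<tau> w by (auto simp: \<Lambda>_def X_def \<beta>_def)
      show "{\<omega>\<in>space M. \<forall>l\<in>\<Lambda>. \<bar>X l \<omega>\<bar> \<le> \<beta> l} \<in> sets M" using cnt by measurable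
    qed
    finally have h: "1 / 2 \<le> prob {\<omega>\<in>space M. \<forall>l\<in>\<Lambda>. \<bar>X l \<omega>\<bar> \<le> \<beta> l}" .
    have "p \<le> 1 / (4 * (2 * \<tau> / \<eta> + 2) ^ card \<Lambda>0)"
      unfolding p_def using base card by (intro divide_left_mono mult_left_mono power_increasing mult_pos_pos zero_less_power) auto
    \<comment> \<open>All thresholds scale with \<open>w\<close>, so the ratio that
      \<open>small_ball\<close> sees, and with it \<open>p\<close>, does not depend on
      \<open>n\<close>.\<close>
    also have "\<dots> = 1 / (4 * (2 * (\<tau> * w) / (\<eta> * w) + 2) ^ card \<Lambda>0)" using w by simp
    also have "\<dots> \<le> prob {\<omega>\<in>space M. \<forall>l\<in>\<Lambda>. \<bar>X l \<omega>\<bar> \<le> (if l \<in> \<Lambda>0 then min (\<eta> * w) (2 * \<beta> l) else 2 * \<beta> l)}"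
    proof (rule small_ball[OF cnt sub fin XG h])
      show "0 < \<tau> * w" "0 < \<eta> * w" using \<tau> \<eta> w by auto
      have "2 powr - (real s / 4) \<le> 2 powr 0" for s by (intro powr_mono) auto
      then show "\<beta> l \<le> \<tau> * w" for l
        using \<tau> w by (auto simp: \<beta>_def case_prod_beta mult_left_le)
    qed
    also have "\<dots> \<le> prob {\<omega>\<in>space M. oscf (\<lambda>x. Y x \<omega>) n C (\<epsilon> * w)}"
    proof (intro finite_measure_mono oscf_meas[OF Y] subsetI, safe)
      fix \<omega> assume H: "\<forall>l\<in>\<Lambda>. \<bar>X l \<omega>\<bar> \<le> (if l \<in> \<Lambda>0 then min (\<eta> * w) (2 * \<beta> l) else 2 * \<beta> l)"
      define \<beta>' where "\<beta>' s = (if s < S0 then \<eta> * w else 2 * (\<tau> * w * 2 powr - (real s / 4)))" for s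
      show "oscf (\<lambda>x. Y x \<omega>) n C (\<epsilon> * w)"
      proof (rule oscf_links[where \<beta> = \<beta>'])
        fix l s i e assume "l < m" "i \<in> desc \<gamma> n (Suc s) (C l)"
        then have "(s, l, i, e) \<in> \<Lambda>" by (simp add: \<Lambda>_def)
        with H have "\<bar>X (s, l, i, e) \<omega>\<bar> \<le> (if s < S0 then min (\<eta> * w) (2 * \<beta> (s, l, i, e)) else 2 * \<beta> (s, l, i, e))"
          using \<Lambda>0_alt[of s l i e] by auto
        then show "\<bar>link \<gamma> (a l) (b l) (n + s) i (\<lambda>x. Y x \<omega> $ e)\<bar> \<le> \<beta>' s"
          by (auto simp: X_def \<beta>_def \<beta>'_def split: if_splits)
      next
        fix t
        have "(\<Sum>s<t. \<beta>' s) \<le> (\<Sum>s<S0 + t. \<beta>' s)"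
          using \<eta> w \<tau> by (intro sum_mono2) (auto simp: \<beta>'_def)
        also have "\<dots> = (\<Sum>s<S0. \<beta>' s) + (\<Sum>s<t. \<beta>' (S0 + s))"
          by (induction t) (auto simp: algebra_simps)
        also have "(\<Sum>s<S0. \<beta>' s) = real S0 * (\<eta> * w)" by (simp add: \<beta>'_def)
        also have "(\<Sum>s<t. \<beta>' (S0 + s)) = (\<Sum>s<t. (2 * \<tau> * w * 2 powr - (real S0 / 4)) * 2 powr - (real s / 4))"
          by (intro sum.cong) (auto simp: \<beta>'_def powr_add[symmetric] add_divide_distrib)
        also have "\<dots> \<le> 8 * (2 * \<tau> * w * 2 powr - (real S0 / 4))"
          using \<tau> w by (intro sum_powr_quarter) auto
        also have "\<dots> = (16 * \<tau> * 2 powr - (real S0 / 4)) * w" by simp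
        also have "\<dots> \<le> \<epsilon> / 2 * w" using S0 w by (intro mult_right_mono) auto
        also have "real S0 * (\<eta> * w) \<le> \<epsilon> / 2 * w" using \<eta>(2) w by (simp add: mult.assoc[symmetric])
        finally show "(\<Sum>s<t. \<beta>' s) \<le> \<epsilon> * w" by simp
      qed
    qed
    finally show ?thesis by (simp add: w_def)
  qed
  with p0 show ?thesis by (rule that)
qed

end

subsection \<open>Increments of the noise at different scales\<close>

text \<open>Chebyshev's inequality for the number \<open>S\<close> of events that occur: pairwise
  independence bounds its variance by its mean \<open>\<mu>\<close>, and where none occurs
  \<open>S\<close> deviates from the mean by \<open>\<mu>\<close>. Pairwise independence is what the
  independence of noise on two disjoint sets provides directly.\<close>

lemma (in prob_space) pairwise_indep_none_le:
  fixes E :: "nat \<Rightarrow> 'a set"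
  assumes E[measurable]: "\<And>i. i < n \<Longrightarrow> E i \<in> events" and p: "\<And>i. i < n \<Longrightarrow> p \<le> prob (E i)" "0 < p" "0 < n"
    and ind: "\<And>i j. i < n \<Longrightarrow> j < n \<Longrightarrow> i \<noteq> j \<Longrightarrow> prob (E i \<inter> E j) = prob (E i) * prob (E j)"
  shows "prob {\<omega>\<in>space M. \<forall>i<n. \<omega> \<notin> E i} \<le> 1 / (real n * p)"
proof -
  define \<mu> where "\<mu> = (\<Sum>i<n. prob (E i))"
  have \<mu>: "real n * p \<le> \<mu>" unfolding \<mu>_def using sum_bounded_below[of "{..<n}" p "\<lambda>i. prob (E i)"] p by simp
  have \<mu>0: "0 < real n * p" using p by simp
  define S where "S \<omega> = (\<Sum>i<n. indicator (E i) \<omega> :: real)" for \<omega>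
  have Sb: "0 \<le> S \<omega>" "S \<omega> \<le> real n" for \<omega>
    unfolding S_def using sum_bounded_above[of "{..<n}" "\<lambda>i. indicator (E i) \<omega>" "1::real"]
    by (auto intro!: sum_nonneg simp: indicator_def)
  have S2: "(S \<omega>)\<^sup>2 = (\<Sum>i<n. \<Sum>j<n. indicator (E i \<inter> E j) \<omega>)" for \<omega>
    unfolding S_def power2_eq_square sum_product by (simp add: indicator_inter_arith)
  have [measurable]: "S \<in> borel_measurable M" unfolding S_def by (intro borel_measurable_sum) auto
  have i1: "integrable M S" using Sb by (intro integrable_const_bound[of _ "real n"]) auto
  have i2: "integrable M (\<lambda>\<omega>. (S \<omega>)\<^sup>2)"
    using Sb by (intro integrable_const_bound[of _ "(real n)\<^sup>2"]) (auto simp: power_mono)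
  have e1: "(\<integral>\<omega>. S \<omega> \<partial>M) = \<mu>"
    unfolding S_def \<mu>_def by (subst Bochner_Integration.integral_sum) (auto simp: less_top[symmetric])
  have e2: "(\<integral>\<omega>. (S \<omega>)\<^sup>2 \<partial>M) = (\<Sum>i<n. \<Sum>j<n. prob (E i \<inter> E j))"
  proof -
    have ii: "integrable M (indicator (E i \<inter> E j) :: _ \<Rightarrow> real)" if "i < n" "j < n" for i j
      using that by (auto simp: less_top[symmetric])
    have "(\<integral>\<omega>. (\<Sum>j<n. indicator (E i \<inter> E j) \<omega>) \<partial>M) = (\<Sum>j<n. prob (E i \<inter> E j))" if "i < n" for i
      using ii[OF that] E that
      by (subst Bochner_Integration.integral_sum) (auto intro!: sum.cong arg_cong[where f = prob] dest: sets.sets_into_space)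
    then show ?thesis
      unfolding S2 using ii
      by (subst Bochner_Integration.integral_sum) (auto intro!: Bochner_Integration.integrable_sum)
  qed
  have "(\<Sum>i<n. \<Sum>j<n. prob (E i \<inter> E j)) \<le> (\<Sum>i<n. prob (E i) + (\<Sum>j<n. prob (E i) * prob (E j)))"
  proof (rule sum_mono)
    fix i assume i: "i \<in> {..<n}"
    have "(\<Sum>j<n. prob (E i \<inter> E j)) = prob (E i) + (\<Sum>j\<in>{..<n} - {i}. prob (E i \<inter> E j))"
      using i by (subst sum.remove[of _ i]) auto
    also have "(\<Sum>j\<in>{..<n} - {i}. prob (E i \<inter> E j)) = (\<Sum>j\<in>{..<n} - {i}. prob (E i) * prob (E j))"
      using i by (intro sum.cong ind) auto
    also have "\<dots> \<le> (\<Sum>j<n. prob (E i) * prob (E j))"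
      by (intro sum_mono2) auto
    finally show "(\<Sum>j<n. prob (E i \<inter> E j)) \<le> prob (E i) + (\<Sum>j<n. prob (E i) * prob (E j))" by simp
  qed
  also have "\<dots> = \<mu> + \<mu>\<^sup>2" by (simp add: sum.distrib \<mu>_def power2_eq_square sum_product)
  finally have v: "(\<integral>\<omega>. (S \<omega>)\<^sup>2 \<partial>M) \<le> \<mu> + \<mu>\<^sup>2" unfolding e2 .
  define A where "A = {\<omega>\<in>space M. \<forall>i<n. \<omega> \<notin> E i}"
  have A[measurable]: "A \<in> events"
  proof -
    have "A = space M - (\<Union>i<n. E i)" by (auto simp: A_def)
    also have "\<dots> \<in> events" by (intro sets.Diff sets.finite_UN) auto
    finally show ?thesis .
  qed
  have "\<mu>\<^sup>2 * prob A = (\<integral>\<omega>. \<mu>\<^sup>2 * indicator A \<omega> \<partial>M)" by simp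
  also have "\<dots> \<le> (\<integral>\<omega>. (S \<omega>)\<^sup>2 - 2 * \<mu> * S \<omega> + \<mu>\<^sup>2 \<partial>M)"
  proof (intro integral_mono)
    show "\<mu>\<^sup>2 * indicator A \<omega> \<le> (S \<omega>)\<^sup>2 - 2 * \<mu> * S \<omega> + \<mu>\<^sup>2" for \<omega>
    proof (cases "\<omega> \<in> A")
      case True
      then have "S \<omega> = 0" by (auto simp: S_def A_def)
      then show ?thesis using True by simp
    next
      case False
      have "(S \<omega> - \<mu>)\<^sup>2 \<ge> 0" by simp
      then show ?thesis using False by (simp add: power2_diff mult_ac)
    qed
  qed (use i1 i2 in \<open>auto simp: less_top[symmetric] intro!: Bochner_Integration.integrable_add Bochner_Integration.integrable_diff\<close>)
  also have "\<dots> = (\<integral>\<omega>. (S \<omega>)\<^sup>2 \<partial>M) - 2 * \<mu> * \<mu> + \<mu>\<^sup>2"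
    using i1 i2 e1 by (simp add: prob_space)
  also have "\<dots> \<le> \<mu>" using v by (simp add: power2_eq_square)
  finally have "\<mu> * (\<mu> * prob A) \<le> \<mu> * 1" by (simp add: power2_eq_square mult_ac)
  then have "\<mu> * prob A \<le> 1" using \<mu> \<mu>0 by (simp only: mult_le_cancel_left_pos less_le_trans)
  then have "prob A \<le> 1 / \<mu>" using \<mu> \<mu>0 by (simp add: pos_le_divide_eq mult.commute)
  also have "\<dots> \<le> 1 / (real n * p)" using \<mu> \<mu>0 by (intro divide_left_mono) auto
  finally show ?thesis by (simp add: A_def)
qed

lemma (in gaussian_space) var_cong_AE:
  fixes f g :: "_ \<Rightarrow> real"
  assumes "AE \<omega> in M. f \<omega> = g \<omega>" "f \<in> borel_measurable M" "g \<in> borel_measurable M"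
  shows "(\<integral>\<omega>. (f \<omega>)\<^sup>2 \<partial>M) = (\<integral>\<omega>. (g \<omega>)\<^sup>2 \<partial>M)"
  using assms by (intro integral_cong_AE) auto

lemma borel_Rplus_intervals [simp]:
  "{0..<x} \<in> borel_Rplus" "{0..} \<in> borel_Rplus" "0 \<le> x \<Longrightarrow> {x..} \<in> borel_Rplus" "0 \<le> x \<Longrightarrow> {x..<y} \<in> borel_Rplus"
  by (auto simp: borel_Rplus_def)

text \<open>The quantitative input of the covering argument, expressed on links. On level
  \<open>n\<close> the noise below \<open>2^t\<close> varies less than the full noise by a factor
  \<open>2^(-g (n - t))\<close> (\<open>E1\<close>), a band around \<open>2^n\<close> reproduces the
  full increments up to such a factor and a cut-off error (\<open>E2\<close>), and the full
  increments have size \<open>2^(-n)\<close> (\<open>E3\<close>). By \<open>nondeg\<close> the low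
  frequencies alone form a nondegenerate vector at any choice of one point per box.\<close>

locale nondegenerate_boxes = boxes M G \<gamma> m a b
  for M :: "'w measure" and G and \<gamma> :: "'k::finite \<Rightarrow> real" and m a b +
  fixes N :: "real set \<Rightarrow> real^'k \<Rightarrow> 'w \<Rightarrow> real^'d" and T :: "(real^'k) set"
    and c1 g \<kappa> :: real and t0 :: nat
  assumes m2: "2 \<le> m"
    and box_T: "l < m \<Longrightarrow> cbox (a l) (b l) \<subseteq> T"
    and N_G: "A \<in> borel_Rplus \<Longrightarrow> x \<in> T \<Longrightarrow> (\<lambda>\<omega>. N A x \<omega> $ e) \<in> G"
    and N_indep: "A \<in> borel_Rplus \<Longrightarrow> B \<in> borel_Rplus \<Longrightarrow> A \<inter> B = {} \<Longrightarrow>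
      indep_var (Pi\<^sub>M T (\<lambda>_. borel)) (\<lambda>\<omega>. restrict (\<lambda>x. N A x \<omega>) T)
                (Pi\<^sub>M T (\<lambda>_. borel)) (\<lambda>\<omega>. restrict (\<lambda>x. N B x \<omega>) T)"
    and N_add: "A \<in> borel_Rplus \<Longrightarrow> B \<in> borel_Rplus \<Longrightarrow> A \<inter> B = {} \<Longrightarrow> x \<in> T \<Longrightarrow>
      AE \<omega> in M. N (A \<union> B) x \<omega> = N A x \<omega> + N B x \<omega>"
    and pos: "0 < c1" "0 < g" "g \<le> 1 / 4" "0 < \<kappa>"
    and E1: "l < m \<Longrightarrow> t0 \<le> t \<Longrightarrow> t \<le> n \<Longrightarrow>
      (\<integral>\<omega>. (link \<gamma> (a l) (b l) n i (\<lambda>x. N {0..<2^t} x \<omega> $ e))\<^sup>2 \<partial>M)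
        \<le> (c1 * 2 powr (- real n - g * (real n - real t)))\<^sup>2"
    and E2: "l < m \<Longrightarrow> t0 \<le> t \<Longrightarrow> t \<le> n \<Longrightarrow> t \<le> s \<Longrightarrow>
      (\<integral>\<omega>. (link \<gamma> (a l) (b l) n i (\<lambda>x. N {2^t..<2^s} x \<omega> $ e) - link \<gamma> (a l) (b l) n i (\<lambda>x. N {0..} x \<omega> $ e))\<^sup>2 \<partial>M)
        \<le> (c1 * (2 powr (- real n - g * (real n - real t)) + 2 powr - real s))\<^sup>2"
    and E3: "l < m \<Longrightarrow> t0 \<le> n \<Longrightarrow>
      (\<integral>\<omega>. (link \<gamma> (a l) (b l) n i (\<lambda>x. N {0..} x \<omega> $ e))\<^sup>2 \<partial>M) \<le> (c1 * 2 powr - real n)\<^sup>2"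
    and nondeg: "t0 \<le> t \<Longrightarrow> (\<And>l. l < m \<Longrightarrow> z l \<in> cbox (a l) (b l)) \<Longrightarrow>
      \<kappa> * (\<Sum>l<m. \<Sum>e\<in>UNIV. (c l e)\<^sup>2) \<le> (\<integral>\<omega>. (\<Sum>l<m. \<Sum>e\<in>UNIV. c l e * N {0..<2^t} (z l) \<omega> $ e)\<^sup>2 \<partial>M)"
    and crit: "real m * Qdim \<gamma> \<le> real ((m - 1) * CARD('d))"
begin

abbreviation (input) LN :: "real set \<Rightarrow> nat \<Rightarrow> nat \<Rightarrow> ('k \<Rightarrow> nat) \<Rightarrow> 'd \<Rightarrow> 'w \<Rightarrow> real" where
  "LN A l n i e \<omega> \<equiv> link \<gamma> (a l) (b l) n i (\<lambda>x. N A x \<omega> $ e)"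

abbreviation var :: "('w \<Rightarrow> real) \<Rightarrow> real" where
  "var f \<equiv> (\<integral>\<omega>. (f \<omega>)\<^sup>2 \<partial>M)"

lemma pt_T: "l < m \<Longrightarrow> pt \<gamma> (a l) (b l) n i \<in> T"
  using pt_in_box[OF ab] box_T by blast

lemma gproc_N: "A \<in> borel_Rplus \<Longrightarrow> gproc (N A)"
  unfolding gproc_def using N_G box_T by blast

lemma LN_G: "A \<in> borel_Rplus \<Longrightarrow> l < m \<Longrightarrow> LN A l n i e \<in> G"
  by (intro link_G gproc_N)

lemma LN_add:
  assumes "A \<in> borel_Rplus" "B \<in> borel_Rplus" "A \<inter> B = {}" "l < m"
  shows "AE \<omega> in M. LN (A \<union> B) l n i e \<omega> = LN A l n i e \<omega> + LN B l n i e \<omega>"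
  using N_add[OF assms(1-3) pt_T[OF assms(4), of "Suc n" i]]
    N_add[OF assms(1-3) pt_T[OF assms(4), of n "coarsen \<gamma> n (Suc n) i"]]
  by eventually_elim (simp add: link_def)

lemma LN_all:
  assumes "l < m"
  shows "AE \<omega> in M. LN {0..} l n i e \<omega> = LN {0..<2^t} l n i e \<omega> + LN {2^t..} l n i e \<omega>"
proof -
  have "{0..<2^t} \<union> {2^t..} = {0::real..}" by (auto intro: order_trans[of 0 "2^t"])
  moreover have "{0..<2^t} \<inter> {2^t..} = ({} :: real set)" by auto
  ultimately show ?thesis using LN_add[of "{0..<2^t}" "{2^t..}" l n i e] assms by simp
qed

lemma LN_low:
  assumes "l < m" "t \<le> s"
  shows "AE \<omega> in M. LN {0..<2^s} l n i e \<omega> = LN {0..<2^t} l n i e \<omega> + LN {2^t..<2^s} l n i e \<omega>"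
proof -
  have *: "{0..<x} \<union> {x..<y} = {0..<y}" "{0..<x} \<inter> {x..<y} = {}" if "0 \<le> x" "x \<le> y" for x y :: real
    using that by auto
  have "(2::real)^t \<le> 2^s" using assms by (intro power_increasing) auto
  note * = *[OF _ this, simplified]
  show ?thesis using LN_add[of "{0..<2^t}" "{2^t..<2^s}" l n i e] assms(1) by (simp add: *)
qed

section \<open>Link variances by frequency range\<close>

lemma linkvarI:
  assumes "\<And>l s i e. l < m \<Longrightarrow> var (\<lambda>\<omega>. link \<gamma> (a l) (b l) (n + s) i (\<lambda>x. Y x \<omega> $ e)) \<le> (B * 2 powr - (3 / 4 * real s))\<^sup>2"
  shows "linkvar Y n C B"
  using assms by (simp add: linkvar_def)

lemma sq_le:
  fixes X c u w :: real
  assumes "X \<le> (c * u)\<^sup>2" "0 \<le> c" "0 \<le> u" "u \<le> w"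
  shows "X \<le> (c * w)\<^sup>2"
proof -
  have "(c * u)\<^sup>2 \<le> (c * w)\<^sup>2" using assms by (intro power_mono mult_left_mono) auto
  with assms(1) show ?thesis by linarith
qed

text \<open>A level beyond \<open>2 * t\<close> is at distance at least \<open>t\<close> from the
  cut-off, and \<open>E1\<close> converts this distance into the gain \<open>2^(-g t)\<close>. For
  this reason the scales start at twice the exponent of the cut-off.\<close>

lemma linkvar_low:
  assumes "t0 \<le> t" "2 * t \<le> n"
  shows "linkvar (N {0..<2^t}) n C (c1 * 2 powr (- real n - g * real t))"
proof (rule linkvarI)
  fix l s i e assume l: "l < m"
  have "var (LN {0..<2^t} l (n + s) i e) \<le> (c1 * (2 powr (- real n - g * real t) * 2 powr - (3 / 4 * real s)))\<^sup>2"
  proof (rule sq_le[OF E1])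
    have "g * real t \<le> g * (real (n + s) - real t)" using assms pos by (intro mult_left_mono) auto
    then show "2 powr (- real (n + s) - g * (real (n + s) - real t)) \<le> 2 powr (- real n - g * real t) * 2 powr - (3 / 4 * real s)"
      unfolding powr_add[symmetric] by (intro powr_mono) auto
  qed (use l assms pos in auto)
  then show "var (LN {0..<2^t} l (n + s) i e) \<le> (c1 * 2 powr (- real n - g * real t) * 2 powr - (3 / 4 * real s))\<^sup>2"
    by (simp only: mult.assoc)
qed

lemma linkvar_up:
  assumes "t0 \<le> t" "2 * t \<le> n"
  shows "linkvar (N {2^t..}) n C (2 * c1 * 2 powr - real n)"
proof (rule linkvarI)
  fix l s i e assume l: "l < m"
  define w where "w = 2 powr - real n * 2 powr - (3 / 4 * real s)"
  have w0: "0 \<le> w" by (simp add: w_def)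
  have 3: "var (LN {0..} l (n + s) i e) \<le> (c1 * w)\<^sup>2"
  proof (rule sq_le[OF E3])
    show "2 powr - real (n + s) \<le> w"
      unfolding w_def powr_add[symmetric] by (intro powr_mono) auto
  qed (use l assms pos in auto)
  have 1: "var (LN {0..<2^t} l (n + s) i e) \<le> (c1 * w)\<^sup>2"
  proof (rule sq_le[OF E1])
    have "0 \<le> g * (real (n + s) - real t)" using assms pos by (intro mult_nonneg_nonneg) auto
    then show "2 powr (- real (n + s) - g * (real (n + s) - real t)) \<le> w"
      unfolding w_def powr_add[symmetric] by (intro powr_mono) auto
  qed (use l assms pos in auto)
  note [measurable] = LN_G[OF _ l, THEN meas]
  have "var (LN {2^t..} l (n + s) i e) = var (\<lambda>\<omega>. LN {0..} l (n + s) i e \<omega> - LN {0..<2^t} l (n + s) i e \<omega>)"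
    by (rule var_cong_AE) (use LN_all[OF l, of "n + s" i e t] in \<open>auto elim!: eventually_mono\<close>)
  also have "\<dots> \<le> 2 * (c1 * w)\<^sup>2 + 2 * (c1 * w)\<^sup>2"
    using var_diff_le[OF LN_G LN_G, of "{0..}" l "{0..<2^t}" l "n + s" i e "n + s" i e] l 1 3 by auto
  also have "\<dots> = (2 * c1 * w)\<^sup>2" by (simp add: power_mult_distrib)
  finally show "var (LN {2^t..} l (n + s) i e) \<le> (2 * c1 * 2 powr - real n * 2 powr - (3 / 4 * real s))\<^sup>2"
    by (simp only: w_def mult.assoc)
qed

text \<open>Down to depth \<open>h\<close> the link frequency \<open>n + s\<close> lies inside the
  band, and \<open>E2\<close> compares the band with the full noise up to an error
  \<open>2^(-n - h)\<close> that is no larger than the link itself. Deeper down the whole band lies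
  below the link frequency; it is then a difference of two low-frequency parts, and
  \<open>E1\<close> applies to both.\<close>

lemma linkvar_band:
  assumes "t0 + h \<le> n"
  shows "linkvar (N {2^(n - h)..<2^(n + h)}) n C (4 * c1 * 2 powr - real n)"
proof (rule linkvarI)
  fix l s i e assume l: "l < m"
  define w where "w = 2 powr - real n * 2 powr - (3 / 4 * real s)"
  have w0: "0 \<le> w" by (simp add: w_def)
  note [measurable] = LN_G[OF _ l, THEN meas]
  have nh: "n - h \<le> n + h" by simp
  let ?Y = "LN {2^(n - h)..<2^(n + h)} l (n + s) i e"
  let ?A = "LN {0..} l (n + s) i e"
  have w1: "2 powr - real (n + s) \<le> w"
    unfolding w_def powr_add[symmetric] by (intro powr_mono) auto
  have w2: "2 powr (- real (n + s) - g * (real (n + s) - real t)) \<le> w" if "t \<le> n + s" for t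
  proof -
    have "0 \<le> g * (real (n + s) - real t)" using that pos by (intro mult_nonneg_nonneg) auto
    then show ?thesis
      unfolding w_def powr_add[symmetric] by (intro powr_mono) auto
  qed
  have "var ?Y \<le> 16 * (c1 * w)\<^sup>2"
  proof (cases "s \<le> h")
    case True
    have "var (\<lambda>\<omega>. ?Y \<omega> - ?A \<omega>) \<le> (c1 * (2 * w))\<^sup>2"
    proof (rule sq_le[OF E2])
      have "2 powr - real (n + h) \<le> w"
        using True unfolding w_def powr_add[symmetric] by (intro powr_mono) auto
      then show "2 powr (- real (n + s) - g * (real (n + s) - real (n - h))) + 2 powr - real (n + h) \<le> 2 * w"
        using w2[of "n - h", OF trans_le_add1[OF diff_le_self]] by (simp only: mult_2 add_mono)
    qed (use l assms pos in auto)
    moreover have "var ?A \<le> (c1 * w)\<^sup>2"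
      by (rule sq_le[OF E3]) (use l assms pos w1 in auto)
    moreover have "var ?Y \<le> 2 * var (\<lambda>\<omega>. ?Y \<omega> - ?A \<omega>) + 2 * var ?A"
      using var_add_le[OF diff[OF LN_G LN_G] LN_G, of "{2^(n - h)..<2^(n + h)}" l "{0..}" l "{0..}" l "n + s" i e "n + s" i e "n + s" i e] l by simp
    ultimately have "var ?Y \<le> 10 * (c1 * w)\<^sup>2" by (simp add: power_mult_distrib)
    then show ?thesis by (smt (verit) zero_le_power2)
  next
    case False
    have b: "var (LN {0..<2^t} l (n + s) i e) \<le> (c1 * w)\<^sup>2" if "t0 \<le> t" "t \<le> n + s" for t
      by (rule sq_le[OF E1]) (use l that pos w2 in auto)
    have "var ?Y = var (\<lambda>\<omega>. LN {0..<2^(n + h)} l (n + s) i e \<omega> - LN {0..<2^(n - h)} l (n + s) i e \<omega>)"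
      by (rule var_cong_AE) (use LN_low[OF l nh, of "n + s" i e] in \<open>auto elim!: eventually_mono\<close>)
    also have "\<dots> \<le> 2 * var (LN {0..<2^(n + h)} l (n + s) i e) + 2 * var (LN {0..<2^(n - h)} l (n + s) i e)"
      by (rule var_diff_le[OF LN_G LN_G]) (use l in auto)
    also have "\<dots> \<le> 2 * (c1 * w)\<^sup>2 + 2 * (c1 * w)\<^sup>2"
      by (intro add_mono mult_left_mono b) (use assms False in auto)
    finally show ?thesis by (smt (verit) zero_le_power2)
  qed
  also have "16 * (c1 * w)\<^sup>2 = (4 * c1 * w)\<^sup>2" by (simp add: power_mult_distrib)
  finally show "var ?Y \<le> (4 * c1 * 2 powr - real n * 2 powr - (3 / 4 * real s))\<^sup>2"
    by (simp only: w_def mult.assoc)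
qed

text \<open>The two regimes of \<open>linkvar_band\<close> again, but every term must now be smaller
  by \<open>2^(-g h)\<close>. Down to depth \<open>h\<close> the remainder consists of the error of
  \<open>E2\<close> and the noise below \<open>2^t\<close>, which is at distance at least
  \<open>h\<close> from the level. Deeper down even the full increments are small enough, since a
  link of depth \<open>s > h\<close> has decay \<open>2^(-s / 4)\<close> to spare.\<close>

lemma linkvar_rest:
  assumes "t0 \<le> t" "2 * t \<le> n" "h \<le> t" "t0 + h \<le> n"
  shows "linkvar (\<lambda>x \<omega>. N {2^t..} x \<omega> - N {2^(n - h)..<2^(n + h)} x \<omega>) n C (4 * c1 * 2 powr - (g * real h) * 2 powr - real n)"
proof (rule linkvarI)
  fix l s i e assume l: "l < m"
  define w where "w = 2 powr - (g * real h) * 2 powr - real n * 2 powr - (3 / 4 * real s)"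
  have w0: "0 \<le> w" by (simp add: w_def)
  note [measurable] = LN_G[OF _ l, THEN meas]
  have nh: "n - h \<le> n + h" by simp
  let ?Y = "LN {2^(n - h)..<2^(n + h)} l (n + s) i e"
  let ?U = "LN {2^t..} l (n + s) i e"
  let ?V = "LN {0..<2^t} l (n + s) i e"
  let ?A = "LN {0..} l (n + s) i e"
  have w2: "2 powr (- real (n + s) - g * (real (n + s) - real t)) \<le> w" if "t + h \<le> n + s" for t
  proof -
    have "g * real h \<le> g * (real (n + s) - real t)" using that pos by (intro mult_left_mono) auto
    then show ?thesis
      unfolding w_def powr_add[symmetric] by (intro powr_mono) auto
  qed
  have gh: "g * real h \<le> real h / 4" using pos mult_right_mono[of g "1/4" "real h"] by simp
  have V: "var ?V \<le> (c1 * w)\<^sup>2"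
    by (rule sq_le[OF E1]) (use l assms pos w2[of t] in auto)
  have link_eq: "link \<gamma> (a l) (b l) (n + s) i (\<lambda>x. (N {2^t..} x \<omega> - N {2^(n - h)..<2^(n + h)} x \<omega>) $ e) = ?U \<omega> - ?Y \<omega>" for \<omega>
    by (simp add: link_def)
  have "var (\<lambda>\<omega>. ?U \<omega> - ?Y \<omega>) \<le> 16 * (c1 * w)\<^sup>2"
  proof (cases "s \<le> h")
    case True
    have "var (\<lambda>\<omega>. ?Y \<omega> - ?A \<omega>) \<le> (c1 * (2 * w))\<^sup>2"
    proof (rule sq_le[OF E2])
      have h1: "2 powr - real (n + h) \<le> w"
        using True gh unfolding w_def powr_add[symmetric] by (intro powr_mono) auto
      show "2 powr (- real (n + s) - g * (real (n + s) - real (n - h))) + 2 powr - real (n + h) \<le> 2 * w"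
      proof -
        have "n - h + h \<le> n + s" using assms by simp
        then show ?thesis using w2[of "n - h"] h1 by (simp only: mult_2 add_mono)
      qed
    qed (use l assms pos in auto)
    moreover have "var (\<lambda>\<omega>. ?U \<omega> - ?Y \<omega>) = var (\<lambda>\<omega>. (?Y \<omega> - ?A \<omega>) + ?V \<omega>)"
    proof -
      have "var (\<lambda>\<omega>. ?U \<omega> - ?Y \<omega>) = var (\<lambda>\<omega>. - ((?Y \<omega> - ?A \<omega>) + ?V \<omega>))"
        by (rule var_cong_AE) (use LN_all[OF l, of "n + s" i e t] in \<open>auto elim!: eventually_mono\<close>)
      then show ?thesis by (simp only: power2_minus)
    qed
    moreover have "\<dots> \<le> 2 * var (\<lambda>\<omega>. ?Y \<omega> - ?A \<omega>) + 2 * var ?V"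
      by (rule var_add_le[OF diff[OF LN_G LN_G] LN_G]) (use l in auto)
    ultimately have "var (\<lambda>\<omega>. ?U \<omega> - ?Y \<omega>) \<le> 10 * (c1 * w)\<^sup>2" using V by (simp add: power_mult_distrib)
    then show ?thesis by (smt (verit) zero_le_power2)
  next
    case False
    let ?L = "\<lambda>t. LN {0..<2^t} l (n + s) i e"
    have A: "var ?A \<le> (c1 * w)\<^sup>2"
    proof (rule sq_le[OF E3])
      show "2 powr - real (n + s) \<le> w"
        using False gh unfolding w_def powr_add[symmetric] by (intro powr_mono) auto
    qed (use l assms pos in auto)
    have Lp: "var (?L (n + h)) \<le> (c1 * w)\<^sup>2"
    proof (rule sq_le[OF E1])
      have "0 \<le> g * (real (n + s) - real (n + h))" using False pos by (intro mult_nonneg_nonneg) auto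
      then show "2 powr (- real (n + s) - g * (real (n + s) - real (n + h))) \<le> w"
        using False gh unfolding w_def powr_add[symmetric] by (intro powr_mono) auto
    qed (use l assms pos False in auto)
    have Lm: "var (?L (n - h)) \<le> (c1 * w)\<^sup>2"
      by (rule sq_le[OF E1]) (use l assms pos w2[of "n - h"] in auto)
    have "var (\<lambda>\<omega>. ?U \<omega> - ?Y \<omega>) = var (\<lambda>\<omega>. (?A \<omega> - ?V \<omega>) + (?L (n - h) \<omega> - ?L (n + h) \<omega>))"
      by (rule var_cong_AE) (use LN_all[OF l, of "n + s" i e t] LN_low[OF l nh, of "n + s" i e] in \<open>auto elim!: eventually_elim2\<close>)
    also have "\<dots> \<le> 2 * var (\<lambda>\<omega>. ?A \<omega> - ?V \<omega>) + 2 * var (\<lambda>\<omega>. ?L (n - h) \<omega> - ?L (n + h) \<omega>)"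
      by (rule var_add_le[OF diff[OF LN_G LN_G] diff[OF LN_G LN_G]]) (use l in auto)
    also have "\<dots> \<le> 2 * (2 * var ?A + 2 * var ?V) + 2 * (2 * var (?L (n - h)) + 2 * var (?L (n + h)))"
      by (intro add_mono mult_left_mono var_diff_le LN_G) (use l in auto)
    also have "\<dots> \<le> 16 * (c1 * w)\<^sup>2"
    proof -
      have "2 * (2 * p + 2 * q) + 2 * (2 * r + 2 * u) \<le> 16 * z"
        if "p \<le> z" "q \<le> z" "r \<le> z" "u \<le> z" for p q r u z :: real
        using that by argo
      then show ?thesis using A V Lm Lp by blast
    qed
    finally show ?thesis .
  qed
  also have "16 * (c1 * w)\<^sup>2 = (4 * c1 * w)\<^sup>2" by (simp add: power_mult_distrib)
  finally show "var (\<lambda>\<omega>. link \<gamma> (a l) (b l) (n + s) i (\<lambda>x. (N {2^t..} x \<omega> - N {2^(n - h)..<2^(n + h)} x \<omega>) $ e))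
      \<le> (4 * c1 * 2 powr - (g * real h) * 2 powr - real n * 2 powr - (3 / 4 * real s))\<^sup>2"
    unfolding link_eq by (simp only: w_def mult.assoc)
qed

subsection \<open>A good scale exists with high probability\<close>

text \<open>Independence is stated for paths restricted to \<open>T\<close>, as elements of a
  product space. \<open>oscf\<close> and \<open>chain_norm\<close> look only at grid points, which
  lie in \<open>T\<close>, and therefore factor through the restriction.\<close>

lemma oscf_restrict: "oscf (restrict f T) n C \<delta> \<longleftrightarrow> oscf f n C \<delta>"
  unfolding oscf_def using pt_T by (auto cong: all_cong ball_cong)

lemma chain_norm_restrict: "chain_norm q (restrict f T) n C = chain_norm q f n C"
  unfolding chain_norm_def link_def using pt_T by (auto intro!: suminf_cong sum.cong simp: restrict_def)

lemma comp_meas: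
  "x \<in> T \<Longrightarrow> (\<lambda>f :: real^'k \<Rightarrow> real^'d. f x $ e) \<in> borel_measurable (Pi\<^sub>M T (\<lambda>_. borel))"
  by (rule measurable_compose[OF measurable_component_singleton])
     (auto intro!: borel_measurable_continuous_onI continuous_intros)

lemma oscf_pred: "Measurable.pred (Pi\<^sub>M T (\<lambda>_. borel)) (\<lambda>f :: real^'k \<Rightarrow> real^'d. oscf f n C \<delta>)"
proof -
  have [measurable]: "(\<lambda>f :: real^'k \<Rightarrow> real^'d. f (pt \<gamma> (a l) (b l) n i) $ e) \<in> borel_measurable (Pi\<^sub>M T (\<lambda>_. borel))"
    if "l \<in> {..<m}" for l n i e
    using comp_meas pt_T that by simp
  have "(\<lambda>f :: real^'k \<Rightarrow> real^'d. oscf f n C \<delta>) = (\<lambda>f. \<forall>l\<in>{..<m}. \<forall>t. \<forall>i\<in>desc \<gamma> n t (C l). \<forall>e\<in>UNIV.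
     \<bar>f (pt \<gamma> (a l) (b l) (n + t) i) $ e - f (pt \<gamma> (a l) (b l) n (C l)) $ e\<bar> \<le> \<delta>)"
    by (auto simp: oscf_def fun_eq_iff)
  also have "Measurable.pred (Pi\<^sub>M T (\<lambda>_. borel)) \<dots>" by measurable
  finally show ?thesis .
qed

lemma chain_norm_meas_fun: "(\<lambda>f :: real^'k \<Rightarrow> real^'d. chain_norm q f n C) \<in> borel_measurable (Pi\<^sub>M T (\<lambda>_. borel))"
proof -
  have [measurable]: "(\<lambda>f :: real^'k \<Rightarrow> real^'d. link \<gamma> (a l) (b l) n i (\<lambda>x. f x $ e)) \<in> borel_measurable (Pi\<^sub>M T (\<lambda>_. borel))"
    if "l \<in> {..<m}" for l n i e
    unfolding link_def using that by (intro borel_measurable_diff comp_meas pt_T) auto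
  show ?thesis unfolding chain_norm_def by measurable
qed

lemma oscf_indep:
  assumes "A \<in> borel_Rplus" "B \<in> borel_Rplus" "A \<inter> B = {}"
  shows "prob ({\<omega>\<in>space M. oscf (\<lambda>x. N A x \<omega>) n C \<delta>} \<inter> {\<omega>\<in>space M. oscf (\<lambda>x. N B x \<omega>) n' C' \<delta>'}) =
    prob {\<omega>\<in>space M. oscf (\<lambda>x. N A x \<omega>) n C \<delta>} * prob {\<omega>\<in>space M. oscf (\<lambda>x. N B x \<omega>) n' C' \<delta>'}"
proof -
  let ?P = "Pi\<^sub>M T (\<lambda>_. borel) :: (real^'k \<Rightarrow> real^'d) measure"
  define S where "S n C \<delta> = {f\<in>space ?P. oscf f n C \<delta>}" for n C \<delta>
  have S: "S n C \<delta> \<in> sets ?P" for n C \<delta> unfolding S_def using oscf_pred by measurable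
  note ind = N_indep[OF assms]
  have "(\<lambda>\<omega>. restrict (\<lambda>x. N A x \<omega>) T) -` S n C \<delta> \<inter> space M = {\<omega>\<in>space M. oscf (\<lambda>x. N A x \<omega>) n C \<delta>}" for A n C \<delta>
    by (auto simp: S_def oscf_restrict space_PiM)
  moreover have "(\<lambda>\<omega>. (restrict (\<lambda>x. N A x \<omega>) T, restrict (\<lambda>x. N B x \<omega>) T)) -` (S n C \<delta> \<times> S n' C' \<delta>') \<inter> space M =
     {\<omega>\<in>space M. oscf (\<lambda>x. N A x \<omega>) n C \<delta>} \<inter> {\<omega>\<in>space M. oscf (\<lambda>x. N B x \<omega>) n' C' \<delta>'}"
    by (auto simp: S_def oscf_restrict space_PiM)
  ultimately show ?thesis
    using indep_varD[OF ind S[of n C \<delta>] S[of n' C' \<delta>']] by simp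
qed

text \<open>Scale \<open>i\<close> is tested on the band that reaches \<open>h\<close> octaves to
  either side of its frequency; the spacing \<open>2 * h\<close> makes the bands disjoint and the
  tests pairwise independent. The order of the choices matters: the success probability
  \<open>p\<close> depends neither on \<open>h\<close> nor on the scale, so \<open>L\<close> is
  fixed first, by Chebyshev, and \<open>h\<close> is then taken so large that the noise outside the
  bands is unlikely to spoil any of the \<open>L\<close> tests.\<close>

lemma bad_prob:
  assumes "0 < \<epsilon>" "0 < \<delta>"
  obtains L h :: nat where "0 < L" "0 < h"
    "\<And>\<nu> C. t0 + h \<le> \<nu> \<Longrightarrow>
      prob {\<omega>\<in>space M. \<forall>i<L. \<not> oscf (\<lambda>x. N {2^\<nu>..} x \<omega>) (2 * \<nu> + 2 * h * i) (C i) (\<epsilon> * 2 powr - real (2 * \<nu> + 2 * h * i))} \<le> \<delta>"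
proof -
  obtain q :: nat where q: "Qdim \<gamma> + 1 \<le> real q" using real_arch_simple by blast
  have q0: "0 < q" using q Qdim_pos by linarith
  obtain p where p: "0 < p"
    "\<And>(Y :: real^'k \<Rightarrow> 'w \<Rightarrow> real^'d) n C. gproc Y \<Longrightarrow> linkvar Y n C (4 * c1 * 2 powr - real n) \<Longrightarrow>
       p \<le> prob {\<omega>\<in>space M. oscf (\<lambda>x. Y x \<omega>) n C (\<epsilon> / 2 * 2 powr - real n)}"
    using small_osc[of "\<epsilon> / 2" "4 * c1"] assms pos by auto
  obtain L :: nat where L0: "2 / (\<delta> * p) < real L" using reals_Archimedean2 by blast
  have L: "0 < L" "1 / (real L * p) \<le> \<delta> / 2"
  proof -
    have "0 < 2 / (\<delta> * p)" using assms p by simp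
    from less_trans[OF this L0] show L1: "0 < L" by simp
    have "2 < real L * (\<delta> * p)" using L0 assms(2) p(1) by (simp add: pos_divide_less_eq)
    then have "1 \<le> \<delta> / 2 * (real L * p)" by (simp add: mult_ac)
    then show "1 / (real L * p) \<le> \<delta> / 2" using L1 p(1) by (subst pos_divide_le_eq) auto
  qed
  define K where "K = chain_const CARD('d) q"
  have "(\<lambda>h. real L * (K * (8 * (4 * c1 * 2 powr - (g * real h)) / (\<epsilon> / 2)) ^ (2 * q))) \<longlonglongrightarrow> real L * (K * (8 * (4 * c1 * 0) / (\<epsilon> / 2)) ^ (2 * q))"
  proof (intro tendsto_intros)
    show "(\<lambda>h. 2 powr - (g * real h)) \<longlonglongrightarrow> 0" using pos by real_asymp
  qed (use assms in auto)
  moreover have "real L * (K * (8 * (4 * c1 * 0) / (\<epsilon> / 2)) ^ (2 * q)) < \<delta> / 2"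
    using q0 assms(2) by (simp add: zero_power)
  ultimately have "\<forall>\<^sub>F h in sequentially. real L * (K * (8 * (4 * c1 * 2 powr - (g * real h)) / (\<epsilon> / 2)) ^ (2 * q)) < \<delta> / 2"
    by (rule order_tendstoD(2))
  then obtain h where h: "0 < h" "real L * (K * (8 * (4 * c1 * 2 powr - (g * real h)) / (\<epsilon> / 2)) ^ (2 * q)) < \<delta> / 2"
    using eventually_conj[OF _ eventually_gt_at_top[of "0::nat"]] eventually_happens'[OF sequentially_bot] by blast
  show ?thesis
  proof (rule that[OF L(1) h(1)])
    fix \<nu> C assume \<nu>: "t0 + h \<le> \<nu>"
    define n where "n i = 2 * \<nu> + 2 * h * i" for i
    define Y where "Y i = N {2^(n i - h)..<2^(n i + h)}" for i
    define W where "W i = (\<lambda>x \<omega>. N {2^\<nu>..} x \<omega> - Y i x \<omega>)" for i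
    define E where "E i = {\<omega>\<in>space M. oscf (\<lambda>x. Y i x \<omega>) (n i) (C i) (\<epsilon> / 2 * 2 powr - real (n i))}" for i
    define F where "F i = {\<omega>\<in>space M. \<not> oscf (\<lambda>x. W i x \<omega>) (n i) (C i) (\<epsilon> / 2 * 2 powr - real (n i))}" for i
    have n: "2 * \<nu> \<le> n i" "t0 + h \<le> n i" "h \<le> n i" for i using \<nu> by (auto simp: n_def)
    have gY: "gproc (Y i)" for i unfolding Y_def by (intro gproc_N) auto
    have gW: "gproc (W i)" for i
      unfolding gproc_def W_def using gproc_N[of "{2^\<nu>..}"] gY[of i] by (auto simp: gproc_def intro!: diff)
    have E_meas: "E i \<in> events" for i unfolding E_def by (rule oscf_meas[OF gY])
    have F_meas: "F i \<in> events" for i unfolding F_def using oscf_meas[OF gW] by (intro sets.sets_Collect_neg) 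
    have F_prob: "prob (F i) \<le> K * (8 * (4 * c1 * 2 powr - (g * real h)) / (\<epsilon> / 2)) ^ (2 * q)" for i
    proof -
      have "prob (F i) \<le> K * (8 * (4 * c1 * 2 powr - (g * real h) * 2 powr - real (n i)) / (\<epsilon> / 2 * 2 powr - real (n i))) ^ (2 * q)"
        unfolding F_def K_def
        by (rule oscf_tail[OF gW]) (use linkvar_rest[of \<nu> "n i" h "C i"] n[of i] \<nu> pos assms q in \<open>auto simp: W_def Y_def\<close>)
      then show ?thesis by simp
    qed
    have ind: "prob (E i \<inter> E j) = prob (E i) * prob (E j)" if "i \<noteq> j" for i j
    proof -
      have "{2^(n i - h)..<2^(n i + h)} \<inter> {2^(n j - h)..<(2::real)^(n j + h)} = {}" if "i < j" for i j
      proof -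
        have "n i + h \<le> n j - h"
        proof -
          have "2 * h * Suc i \<le> 2 * h * j" using that by (intro mult_le_mono) auto
          then show ?thesis using n(3)[of j] by (simp add: n_def)
        qed
        then have "(2::real)^(n i + h) \<le> 2^(n j - h)" by (intro power_increasing) auto
        then show ?thesis by auto
      qed
      then have "{2^(n i - h)..<2^(n i + h)} \<inter> {2^(n j - h)..<(2::real)^(n j + h)} = {}"
        using that by (cases "i < j") (auto simp: Int_commute linorder_neq_iff)
      then show ?thesis unfolding E_def Y_def by (intro oscf_indep) auto
    qed
    have none: "prob {\<omega>\<in>space M. \<forall>i<L. \<omega> \<notin> E i} \<le> 1 / (real L * p)"
    proof (rule pairwise_indep_none_le)
      show "p \<le> prob (E i)" for i
        unfolding E_def using linkvar_band[of h "n i" "C i"] n[of i] by (intro p(2) gY) (simp add: Y_def)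
    qed (use E_meas p ind L in auto)
    have "prob {\<omega>\<in>space M. \<forall>i<L. \<not> oscf (\<lambda>x. N {2^\<nu>..} x \<omega>) (n i) (C i) (\<epsilon> * 2 powr - real (n i))} \<le>
        prob ({\<omega>\<in>space M. \<forall>i<L. \<omega> \<notin> E i} \<union> (\<Union>i<L. F i))"
    proof (rule finite_measure_mono)
      show "{\<omega>\<in>space M. \<forall>i<L. \<not> oscf (\<lambda>x. N {2^\<nu>..} x \<omega>) (n i) (C i) (\<epsilon> * 2 powr - real (n i))}
        \<subseteq> {\<omega>\<in>space M. \<forall>i<L. \<omega> \<notin> E i} \<union> (\<Union>i<L. F i)"
      proof (intro subsetI)
        fix \<omega> assume *: "\<omega> \<in> {\<omega>\<in>space M. \<forall>i<L. \<not> oscf (\<lambda>x. N {2^\<nu>..} x \<omega>) (n i) (C i) (\<epsilon> * 2 powr - real (n i))}"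
        have "\<omega> \<in> F i" if i: "i < L" "\<omega> \<in> E i" for i
        proof (rule ccontr)
          assume "\<omega> \<notin> F i"
          then have "oscf (\<lambda>x. Y i x \<omega> + W i x \<omega>) (n i) (C i) (\<epsilon> / 2 * 2 powr - real (n i) + \<epsilon> / 2 * 2 powr - real (n i))"
            using * i by (intro oscf_add) (auto simp: E_def F_def)
          then show False using * i by (simp add: W_def)
        qed
        then show "\<omega> \<in> {\<omega>\<in>space M. \<forall>i<L. \<omega> \<notin> E i} \<union> (\<Union>i<L. F i)" using * by auto
      qed
      have "{\<omega>\<in>space M. \<forall>i<L. \<omega> \<notin> E i} = space M - (\<Union>i<L. E i)" by auto
      then show "{\<omega>\<in>space M. \<forall>i<L. \<omega> \<notin> E i} \<union> (\<Union>i<L. F i) \<in> events"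
        using E_meas F_meas by auto
    qed
    also have "\<dots> \<le> prob {\<omega>\<in>space M. \<forall>i<L. \<omega> \<notin> E i} + prob (\<Union>i<L. F i)"
    proof (rule measure_Un_le)
      have "{\<omega>\<in>space M. \<forall>i<L. \<omega> \<notin> E i} = space M - (\<Union>i<L. E i)" by auto
      then show "{\<omega>\<in>space M. \<forall>i<L. \<omega> \<notin> E i} \<in> events" using E_meas by auto
    qed (use F_meas in auto)
    also have "prob (\<Union>i<L. F i) \<le> (\<Sum>i<L. prob (F i))"
      using F_meas by (intro finite_measure_subadditive_finite) auto
    also have "\<dots> \<le> real L * (K * (8 * (4 * c1 * 2 powr - (g * real h)) / (\<epsilon> / 2)) ^ (2 * q))"
      using sum_bounded_above[of "{..<L}" "\<lambda>i. prob (F i)"] F_prob by simp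
    also have "\<dots> \<le> \<delta> / 2" using h by simp
    also have "prob {\<omega>\<in>space M. \<forall>i<L. \<omega> \<notin> E i} \<le> \<delta> / 2" using none L by simp
    finally show "prob {\<omega>\<in>space M. \<forall>i<L. \<not> oscf (\<lambda>x. N {2^\<nu>..} x \<omega>) (2 * \<nu> + 2 * h * i) (C i) (\<epsilon> * 2 powr - real (2 * \<nu> + 2 * h * i))} \<le> \<delta>"
      by (simp add: n_def)
  qed
qed

subsection \<open>Hitting probabilities of cells\<close>

text \<open>The codimension of the diagonal in the \<open>m\<close>-fold product of the target
  space. \<open>hitset\<close> numbers the corresponding coordinates: component \<open>e\<close> of
  the difference between box \<open>l\<close> and box 0.\<close>

definition codim :: nat where "codim = (m - 1) * CARD('d)"

definition hitset :: "(nat \<times> 'd) set" where "hitset = {1..<m} \<times> UNIV"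

lemma card_hitset: "finite hitset" "card hitset = codim"
  by (simp_all add: hitset_def codim_def card_cartesian_product)

text \<open>\<open>\<rho>\<close> is the \<open>2 * q\<close>-th power of a radius \<open>x\<close>.
  The plain bound is of order \<open>x ^ codim\<close>; for \<open>x\<close> below \<open>s\<close>
  it is replaced by \<open>s ^ codim\<close>, above \<open>s\<close> by
  \<open>x ^ (2 * q) / s ^ (2 * q - codim)\<close>. The result is linear in \<open>\<rho>\<close>,
  so that for a random radius an expectation suffices, and an infinite \<open>\<rho>\<close> does no
  harm.\<close>

lemma anticoncentration_cell:
  fixes \<rho> :: ennreal
  assumes t: "t0 \<le> t" and z: "\<And>l. l < m \<Longrightarrow> z l \<in> cbox (a l) (b l)" and q: "codim < 2 * q" and s: "0 < s"
  shows "emeasure M {\<omega>\<in>space M. \<forall>(l, e)\<in>hitset.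
      ennreal (\<bar>N {0..<2^t} (z l) \<omega> $ e - N {0..<2^t} (z 0) \<omega> $ e + w (l, e)\<bar> ^ (2 * q)) \<le> \<rho>}
    \<le> ennreal ((2 / sqrt \<kappa>) ^ codim) * (ennreal (s ^ codim) + ennreal (1 / s ^ (2 * q - codim)) * \<rho>)"
    (is "emeasure M ?E \<le> _")
proof (cases \<rho>)
  case top
  have "ennreal ((2 / sqrt \<kappa>) ^ codim) * (ennreal (s ^ codim) + ennreal (1 / s ^ (2 * q - codim)) * \<rho>) = top"
    using pos s by (simp add: top ennreal_mult_eq_top_iff ennreal_top_mult ennreal_mult_top)
  then show ?thesis by simp
next
  case (real r)
  define Z where "Z = (\<lambda>(l, e) \<omega>. N {0..<2^t} (z l) \<omega> $ e - N {0..<2^t} (z 0) \<omega> $ e)"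
  have zT: "z l \<in> T" if "l < m" for l using z[OF that] box_T[OF that] by auto
  have ZG: "Z s \<in> G" if "s \<in> hitset" for s
    using that zT m2 unfolding Z_def hitset_def by (auto intro!: diff N_G split: prod.splits)
  have [measurable]: "Z s \<in> borel_measurable M" if "s \<in> hitset" for s using ZG[OF that] by simp
  have vr: "\<kappa> * (\<Sum>s\<in>hitset. (\<xi> s)\<^sup>2) \<le> (\<integral>\<omega>. (\<Sum>s\<in>hitset. \<xi> s * Z s \<omega>)\<^sup>2 \<partial>M)" for \<xi>
  proof -
    \<comment> \<open>A combination of differences to box 0 is a combination of the \<open>m\<close>
      values whose coefficient at box 0 is minus the sum of the others, so the lower bound for the
      values restricts to the differences.\<close>
    define c where "c l e = (if l = 0 then - (\<Sum>l'\<in>{1..<m}. \<xi> (l', e)) else \<xi> (l, e))" for l e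
    have split: "(\<Sum>l<m. f l) = f 0 + (\<Sum>l\<in>{1..<m}. f l)" for f :: "nat \<Rightarrow> real"
      using m2 by (simp add: lessThan_atLeast0 sum.atLeast_Suc_lessThan)
    have sh: "(\<Sum>s\<in>hitset. f s) = (\<Sum>l\<in>{1..<m}. \<Sum>e\<in>UNIV. f (l, e))" for f :: "nat \<times> 'd \<Rightarrow> real"
      unfolding hitset_def by (simp add: sum.cartesian_product)
    have 1: "(\<Sum>s\<in>hitset. \<xi> s * Z s \<omega>) = (\<Sum>l<m. \<Sum>e\<in>UNIV. c l e * N {0..<2^t} (z l) \<omega> $ e)" for \<omega>
    proof -
      have "(\<Sum>l\<in>{1..<m}. \<Sum>e\<in>UNIV. c l e * N {0..<2^t} (z l) \<omega> $ e) =
          (\<Sum>l\<in>{1..<m}. \<Sum>e\<in>UNIV. \<xi> (l, e) * N {0..<2^t} (z l) \<omega> $ e)"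
        by (intro sum.cong) (auto simp: c_def)
      moreover have "(\<Sum>e\<in>UNIV. c 0 e * N {0..<2^t} (z 0) \<omega> $ e) =
          - (\<Sum>l\<in>{1..<m}. \<Sum>e\<in>UNIV. \<xi> (l, e) * N {0..<2^t} (z 0) \<omega> $ e)"
        by (subst sum.swap) (simp add: c_def sum_negf sum_distrib_right)
      ultimately show ?thesis
        unfolding split sh Z_def by (simp add: right_diff_distrib sum_subtractf)
    qed
    have "(\<Sum>s\<in>hitset. (\<xi> s)\<^sup>2) = (\<Sum>l\<in>{1..<m}. \<Sum>e\<in>UNIV. (c l e)\<^sup>2)"
      unfolding sh by (intro sum.cong) (auto simp: c_def)
    also have "\<dots> \<le> (\<Sum>l<m. \<Sum>e\<in>UNIV. (c l e)\<^sup>2)"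
      unfolding split by (simp add: sum_nonneg)
    finally have "\<kappa> * (\<Sum>s\<in>hitset. (\<xi> s)\<^sup>2) \<le> \<kappa> * (\<Sum>l<m. \<Sum>e\<in>UNIV. (c l e)\<^sup>2)"
      using pos by (intro mult_left_mono) auto
    also have "\<dots> \<le> (\<integral>\<omega>. (\<Sum>l<m. \<Sum>e\<in>UNIV. c l e * N {0..<2^t} (z l) \<omega> $ e)\<^sup>2 \<partial>M)"
      by (rule nondeg[OF t z])
    finally show ?thesis unfolding 1 .
  qed
  define x where "x = root (2 * q) r"
  have q0: "0 < 2 * q" using q by simp
  have r0: "0 \<le> r" using real by simp
  have x: "0 \<le> x" "x ^ (2 * q) = r" using r0 q0 by (auto simp: x_def)
  have sub: "?E \<subseteq> {\<omega>\<in>space M. \<forall>s\<in>hitset. \<bar>Z s \<omega> + w s\<bar> \<le> y}" if "x \<le> y" for y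
  proof -
    have "\<bar>v\<bar> \<le> y" if "ennreal (\<bar>v\<bar> ^ (2 * q)) \<le> \<rho>" for v
    proof -
      have "\<bar>v\<bar> ^ (2 * q) \<le> x ^ (2 * q)" using that real r0 x by simp
      then have "\<bar>v\<bar> \<le> x" using x q0 by (rule_tac power_le_imp_le_base_pos)
      then show ?thesis using \<open>x \<le> y\<close> by simp
    qed
    then show ?thesis by (fastforce simp: Z_def)
  qed
  have bound: "emeasure M ?E \<le> ennreal ((2 / sqrt \<kappa>) ^ codim * y ^ codim)" if y: "x \<le> y" "0 < y" for y
  proof -
    have "emeasure M ?E \<le> emeasure M {\<omega>\<in>space M. \<forall>s\<in>hitset. \<bar>Z s \<omega> + w s\<bar> \<le> y}"
      using card_hitset(1) by (intro emeasure_mono sub y) measurable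
    also have "\<dots> \<le> ennreal ((2 * y / sqrt \<kappa>) ^ card hitset)"
      using anticoncentration[OF card_hitset(1) ZG _ y(2) vr] pos by (simp add: emeasure_eq_measure ennreal_leI)
    also have "(2 * y / sqrt \<kappa>) ^ card hitset = (2 / sqrt \<kappa>) ^ codim * y ^ codim"
      by (simp add: card_hitset power_mult_distrib power_divide)
    finally show ?thesis .
  qed
  have K0: "0 \<le> (2 / sqrt \<kappa>) ^ codim" using pos by simp
  have "emeasure M ?E \<le> ennreal ((2 / sqrt \<kappa>) ^ codim * (s ^ codim + 1 / s ^ (2 * q - codim) * r))"
  proof (cases "x \<le> s")
    case True
    have "(2 / sqrt \<kappa>) ^ codim * s ^ codim \<le> (2 / sqrt \<kappa>) ^ codim * (s ^ codim + 1 / s ^ (2 * q - codim) * r)"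
      using r0 s K0 by (intro mult_left_mono) auto
    then show ?thesis using bound[OF True s] by (meson ennreal_leI order_trans)
  next
    case False
    then have sx: "s < x" by simp
    have "x ^ (2 * q) = x ^ codim * x ^ (2 * q - codim)" using q by (simp flip: power_add)
    then have "x ^ codim = r / x ^ (2 * q - codim)" using x sx s by (simp add: field_simps)
    also have "\<dots> \<le> r / s ^ (2 * q - codim)" using r0 s sx by (intro divide_left_mono power_mono mult_pos_pos) auto
    also have "\<dots> \<le> s ^ codim + 1 / s ^ (2 * q - codim) * r" using s by simp
    finally have "(2 / sqrt \<kappa>) ^ codim * x ^ codim \<le> (2 / sqrt \<kappa>) ^ codim * (s ^ codim + 1 / s ^ (2 * q - codim) * r)"
      using K0 by (intro mult_left_mono) auto
    moreover have "0 < x" using sx s by simp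
    ultimately show ?thesis using bound[of x] by (meson ennreal_leI order_trans order_refl)
  qed
  also have "\<dots> = ennreal ((2 / sqrt \<kappa>) ^ codim) * (ennreal (s ^ codim) + ennreal (1 / s ^ (2 * q - codim)) * \<rho>)"
    using K0 s r0 real by (simp add: ennreal_mult' ennreal_plus flip: ennreal_mult'')
  finally show ?thesis .
qed

text \<open>The noise on \<open>[0, 2^t)\<close> supplies a bounded density given the noise on \<open>[2^t, \<infinity>)\<close>.\<close>

lemma hit_le:
  fixes A :: "(real^'k \<Rightarrow> real^'d) \<Rightarrow> bool" and \<rho> :: "(real^'k \<Rightarrow> real^'d) \<Rightarrow> ennreal"
  assumes t: "t0 \<le> t" and z: "\<And>l. l < m \<Longrightarrow> z l \<in> cbox (a l) (b l)" and q: "codim < 2 * q" and s: "0 < s"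
    and A[measurable]: "Measurable.pred (Pi\<^sub>M T (\<lambda>_. borel)) A"
    and \<rho>[measurable]: "\<rho> \<in> borel_measurable (Pi\<^sub>M T (\<lambda>_. borel))"
  shows "emeasure M {\<omega>\<in>space M. A (restrict (\<lambda>x. N {2^t..} x \<omega>) T) \<and> (\<forall>(l, e)\<in>hitset.
      ennreal (\<bar>N {0..<2^t} (z l) \<omega> $ e - N {0..<2^t} (z 0) \<omega> $ e + (N {2^t..} (z l) \<omega> $ e - N {2^t..} (z 0) \<omega> $ e)\<bar> ^ (2 * q))
        \<le> \<rho> (restrict (\<lambda>x. N {2^t..} x \<omega>) T))}
    \<le> (\<integral>\<^sup>+\<omega>. indicator {\<omega>. A (restrict (\<lambda>x. N {2^t..} x \<omega>) T)} \<omega> * (ennreal ((2 / sqrt \<kappa>) ^ codim) *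
        (ennreal (s ^ codim) + ennreal (1 / s ^ (2 * q - codim)) * \<rho> (restrict (\<lambda>x. N {2^t..} x \<omega>) T))) \<partial>M)"
proof -
  let ?F = "Pi\<^sub>M T (\<lambda>_. borel) :: (real^'k \<Rightarrow> real^'d) measure"
  define V where "V \<omega> = restrict (\<lambda>x. N {0..<2^t} x \<omega>) T" for \<omega>
  define U where "U \<omega> = restrict (\<lambda>x. N {2^t..} x \<omega>) T" for \<omega>
  have zT: "z l \<in> T" if "l < m" for l using z[OF that] box_T[OF that] by auto
  have m0: "0 < m" using m2 by simp
  have ind: "indep_var ?F V ?F U"
    unfolding V_def U_def by (rule N_indep) auto
  have [measurable]: "V \<in> measurable M ?F" "U \<in> measurable M ?F"
    using indep_var_rv1[OF ind] indep_var_rv2[OF ind] .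
  have joint: "distr M ?F V \<Otimes>\<^sub>M distr M ?F U = distr M (?F \<Otimes>\<^sub>M ?F) (\<lambda>x. (V x, U x))"
    using ind unfolding indep_var_distribution_eq by simp
  interpret PV: prob_space "distr M ?F V" by (rule prob_space_distr) measurable
  interpret PU: prob_space "distr M ?F U" by (rule prob_space_distr) measurable
  interpret P: pair_prob_space "distr M ?F V" "distr M ?F U" ..
  have [measurable]: "(\<lambda>f :: real^'k \<Rightarrow> real^'d. f (z l) $ e) \<in> borel_measurable ?F" if "l < m" for l e
    using comp_meas zT[OF that] .
  define Q where "Q f g \<longleftrightarrow> (\<forall>(l, e)\<in>hitset. ennreal (\<bar>f (z l) $ e - f (z 0) $ e + (g (z l) $ e - g (z 0) $ e)\<bar> ^ (2 * q)) \<le> \<rho> g)"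
    for f g :: "real^'k \<Rightarrow> real^'d"
  have Q_meas[measurable]: "Measurable.pred (?F \<Otimes>\<^sub>M ?F) (\<lambda>p. Q (fst p) (snd p))"
  proof -
    have [measurable]: "(\<lambda>p :: (real^'k \<Rightarrow> real^'d) \<times> (real^'k \<Rightarrow> real^'d). fst p (z l) $ e) \<in> borel_measurable (?F \<Otimes>\<^sub>M ?F)"
      "(\<lambda>p :: (real^'k \<Rightarrow> real^'d) \<times> (real^'k \<Rightarrow> real^'d). snd p (z l) $ e) \<in> borel_measurable (?F \<Otimes>\<^sub>M ?F)" if "l < m" for l e
      by (rule measurable_compose[OF measurable_fst comp_meas[OF zT[OF that]]],
          rule measurable_compose[OF measurable_snd comp_meas[OF zT[OF that]]])
    have h: "fst s < m" if "s \<in> hitset" for s using that by (auto simp: hitset_def)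
    have "Measurable.pred (?F \<Otimes>\<^sub>M ?F) (\<lambda>p. \<forall>s\<in>hitset. ennreal (\<bar>fst p (z (fst s)) $ snd s - fst p (z 0) $ snd s +
        (snd p (z (fst s)) $ snd s - snd p (z 0) $ snd s)\<bar> ^ (2 * q)) \<le> \<rho> (snd p))"
      using h m0 card_hitset(1) by measurable
    then show ?thesis unfolding Q_def by (simp add: case_prod_beta)
  qed
  define H where "H = {p\<in>space (?F \<Otimes>\<^sub>M ?F). A (snd p) \<and> Q (fst p) (snd p)}"
  have H[measurable]: "H \<in> sets (?F \<Otimes>\<^sub>M ?F)" unfolding H_def by measurable
  have vU: "U \<omega> (z l) = N {2^t..} (z l) \<omega>" "V \<omega> (z l) = N {0..<2^t} (z l) \<omega>" if "l < m" for l \<omega>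
    using zT[OF that] by (simp_all add: U_def V_def)
  have Qeq: "Q (V \<omega>) g \<longleftrightarrow> (\<forall>(l, e)\<in>hitset.
      ennreal (\<bar>N {0..<2^t} (z l) \<omega> $ e - N {0..<2^t} (z 0) \<omega> $ e + (g (z l) $ e - g (z 0) $ e)\<bar> ^ (2 * q)) \<le> \<rho> g)" for \<omega> g
    unfolding Q_def using m0 by (intro ball_cong refl) (auto simp: vU hitset_def)
  have QU: "g (z l) $ e - g (z 0) $ e = N {2^t..} (z l) \<omega> $ e - N {2^t..} (z 0) \<omega> $ e" if "g = U \<omega>" "(l, e) \<in> hitset" for g \<omega> l e
    using that m0 by (auto simp: vU hitset_def)
  have "{\<omega>\<in>space M. A (U \<omega>) \<and> (\<forall>(l, e)\<in>hitset.
      ennreal (\<bar>N {0..<2^t} (z l) \<omega> $ e - N {0..<2^t} (z 0) \<omega> $ e + (N {2^t..} (z l) \<omega> $ e - N {2^t..} (z 0) \<omega> $ e)\<bar> ^ (2 * q)) \<le> \<rho> (U \<omega>))}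
    = (\<lambda>x. (V x, U x)) -` H \<inter> space M"
  proof -
    have "(V \<omega>, U \<omega>) \<in> space (?F \<Otimes>\<^sub>M ?F)" for \<omega>
      by (auto simp: V_def U_def space_pair_measure space_PiM)
    then show ?thesis unfolding H_def
      by (auto simp: Qeq QU split: prod.splits)
  qed
  then have "emeasure M {\<omega>\<in>space M. A (U \<omega>) \<and> (\<forall>(l, e)\<in>hitset.
      ennreal (\<bar>N {0..<2^t} (z l) \<omega> $ e - N {0..<2^t} (z 0) \<omega> $ e + (N {2^t..} (z l) \<omega> $ e - N {2^t..} (z 0) \<omega> $ e)\<bar> ^ (2 * q)) \<le> \<rho> (U \<omega>))}
    = emeasure (distr M ?F V \<Otimes>\<^sub>M distr M ?F U) H"
    unfolding joint by (simp add: emeasure_distr)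
  also have "\<dots> = (\<integral>\<^sup>+g. emeasure (distr M ?F V) ((\<lambda>f. (f, g)) -` H) \<partial>distr M ?F U)"
    by (rule P.emeasure_pair_measure_alt2) (use H in \<open>simp cong: sets_pair_measure_cong\<close>)
  \<comment> \<open>With the high-frequency path \<open>g\<close> frozen, \<open>A\<close> and the
    radius are constants and the high-frequency increments are a deterministic shift.\<close>
  also have "\<dots> \<le> (\<integral>\<^sup>+g. indicator {g. A g} g * (ennreal ((2 / sqrt \<kappa>) ^ codim) *
        (ennreal (s ^ codim) + ennreal (1 / s ^ (2 * q - codim)) * \<rho> g)) \<partial>distr M ?F U)"
  proof (rule nn_integral_mono)
    fix g assume g: "g \<in> space (distr M ?F U)"
    have "emeasure (distr M ?F V) ((\<lambda>f. (f, g)) -` H) \<le> ennreal ((2 / sqrt \<kappa>) ^ codim) *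
        (ennreal (s ^ codim) + ennreal (1 / s ^ (2 * q - codim)) * \<rho> g)"
    proof -
      have "(\<lambda>f. (f, g)) -` H \<in> sets ?F" using sets_Pair1[OF H, of g] sets_Pair2[OF H, of g] by simp
      then have "emeasure (distr M ?F V) ((\<lambda>f. (f, g)) -` H) = emeasure M (V -` ((\<lambda>f. (f, g)) -` H) \<inter> space M)"
        by (simp add: emeasure_distr)
      also have "\<dots> \<le> emeasure M {\<omega>\<in>space M. \<forall>(l, e)\<in>hitset.
          ennreal (\<bar>N {0..<2^t} (z l) \<omega> $ e - N {0..<2^t} (z 0) \<omega> $ e + (\<lambda>(l, e). g (z l) $ e - g (z 0) $ e) (l, e)\<bar> ^ (2 * q)) \<le> \<rho> g}"
      proof (rule emeasure_mono)
        show "V -` ((\<lambda>f. (f, g)) -` H) \<inter> space M \<subseteq> {\<omega>\<in>space M. \<forall>(l, e)\<in>hitset.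
          ennreal (\<bar>N {0..<2^t} (z l) \<omega> $ e - N {0..<2^t} (z 0) \<omega> $ e + (\<lambda>(l, e). g (z l) $ e - g (z 0) $ e) (l, e)\<bar> ^ (2 * q)) \<le> \<rho> g}"
          by (auto simp: H_def Qeq)
        have [measurable]: "(\<lambda>\<omega>. N {0..<2^t} (z l) \<omega> $ e) \<in> borel_measurable M" if "l < m" for l e
          by (intro meas N_G zT that) simp
        have h: "fst s < m" if "s \<in> hitset" for s using that by (auto simp: hitset_def)
        have "{\<omega>\<in>space M. \<forall>s\<in>hitset.
          ennreal (\<bar>N {0..<2^t} (z (fst s)) \<omega> $ snd s - N {0..<2^t} (z 0) \<omega> $ snd s + (g (z (fst s)) $ snd s - g (z 0) $ snd s)\<bar> ^ (2 * q)) \<le> \<rho> g} \<in> sets M"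
          using h m0 card_hitset(1) by measurable
        then show "{\<omega>\<in>space M. \<forall>(l, e)\<in>hitset.
          ennreal (\<bar>N {0..<2^t} (z l) \<omega> $ e - N {0..<2^t} (z 0) \<omega> $ e + (\<lambda>(l, e). g (z l) $ e - g (z 0) $ e) (l, e)\<bar> ^ (2 * q)) \<le> \<rho> g} \<in> sets M"
          by (simp add: case_prod_beta)
      qed
      also have "\<dots> \<le> ennreal ((2 / sqrt \<kappa>) ^ codim) * (ennreal (s ^ codim) + ennreal (1 / s ^ (2 * q - codim)) * \<rho> g)"
        by (rule anticoncentration_cell[OF t z q s])
      finally show ?thesis .
    qed
    moreover have "(\<lambda>f. (f, g)) -` H = {}" if "\<not> A g" using that by (auto simp: H_def)
    ultimately show "emeasure (distr M ?F V) ((\<lambda>f. (f, g)) -` H) \<le> indicator {g. A g} g * (ennreal ((2 / sqrt \<kappa>) ^ codim) *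
        (ennreal (s ^ codim) + ennreal (1 / s ^ (2 * q - codim)) * \<rho> g))"
      by (cases "A g") auto
  qed
  also have "\<dots> = (\<integral>\<^sup>+\<omega>. indicator {g. A g} (U \<omega>) * (ennreal ((2 / sqrt \<kappa>) ^ codim) *
        (ennreal (s ^ codim) + ennreal (1 / s ^ (2 * q - codim)) * \<rho> (U \<omega>))) \<partial>M)"
    by (rule nn_integral_distr) measurable
  finally show ?thesis unfolding U_def by (simp add: indicator_def)
qed

subsection \<open>Selection of cells\<close>

text \<open>The exponent has one bit more than the level, so that the index of a right end point is
  included (see \<open>idx_bounds\<close>).\<close>

definition cells :: "nat \<Rightarrow> (nat \<Rightarrow> 'k \<Rightarrow> nat) set" where
  "cells n = (\<Pi>\<^sub>E l\<in>{..<m}. \<Pi>\<^sub>E j\<in>UNIV. {..<2 ^ (lev \<gamma> n j + 1)})"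

definition coT :: "nat \<Rightarrow> nat \<Rightarrow> (nat \<Rightarrow> 'k \<Rightarrow> nat) \<Rightarrow> (nat \<Rightarrow> 'k \<Rightarrow> nat)" where
  "coT n n' c = (\<lambda>l\<in>{..<m}. coarsen \<gamma> n n' (c l))"

lemma finite_cells [simp]: "finite (cells n)"
  unfolding cells_def by (intro finite_PiE) auto

lemma card_cells: "card (cells n) = (\<Prod>j\<in>UNIV. 2 ^ (lev \<gamma> n j + 1)) ^ m"
  unfolding cells_def by (simp add: card_PiE)

lemma card_cells_pos: "0 < card (cells n)"
  unfolding card_cells by simp

text \<open>The criticality hypothesis \<open>crit\<close> enters here: the number of tuples of
  level \<open>n\<close> does not outgrow the reciprocal of the order of magnitude of a single
  hitting probability, uniformly in \<open>n\<close>.\<close>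

lemma card_cells_le: "real (card (cells n)) * 2 powr - (real n * real codim) \<le> 2 ^ (CARD('k) * m)"
proof -
  have "real (card (cells n)) = (\<Prod>j\<in>UNIV. 2 ^ (lev \<gamma> n j + 1)) ^ m" by (simp add: card_cells)
  also have "\<dots> \<le> (\<Prod>j\<in>UNIV. 2 * 2 powr (real n * (1 + \<gamma> j))) ^ m"
  proof (intro power_mono prod_mono conjI prod_nonneg ballI)
    fix j
    have "(2::real) ^ lev \<gamma> n j \<le> 2 powr (real n * (1 + \<gamma> j))"
      using lev_bounds(1)[of n j] by (simp add: powr_realpow[symmetric])
    then show "(2::real) ^ (lev \<gamma> n j + 1) \<le> 2 * 2 powr (real n * (1 + \<gamma> j))" by simp
  qed auto
  also have "\<dots> = 2 ^ (CARD('k) * m) * 2 powr (real n * (real m * Qdim \<gamma>))"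
  proof -
    have "(\<Prod>j\<in>UNIV. 2 * 2 powr (real n * (1 + \<gamma> j))) = 2 ^ CARD('k) * 2 powr (real n * Qdim \<gamma>)"
      by (simp add: prod.distrib Qdim_eq powr_sum sum_distrib_left)
    moreover have "(2 powr (real n * Qdim \<gamma>)) ^ m = 2 powr (real n * (real m * Qdim \<gamma>))"
      by (simp add: powr_power mult_ac)
    ultimately show ?thesis by (simp only: power_mult_distrib power_mult)
  qed
  also have "\<dots> \<le> 2 ^ (CARD('k) * m) * 2 powr (real n * real codim)"
    using crit by (intro mult_left_mono powr_mono) (auto simp: codim_def)
  finally have "real (card (cells n)) * 2 powr - (real n * real codim) \<le>
      2 ^ (CARD('k) * m) * 2 powr (real n * real codim) * 2 powr - (real n * real codim)"
    by (rule mult_right_mono) simp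
  also have "\<dots> = 2 ^ (CARD('k) * m)" by (simp add: powr_minus)
  finally show ?thesis .
qed

lemma coT_cells:
  assumes "n \<le> n'" "c \<in> cells n'"
  shows "coT n n' c \<in> cells n"
proof -
  have "coarsen \<gamma> n n' (c l) j < 2 ^ (lev \<gamma> n j + 1)" if "l < m" for l j
  proof -
    have e: "lev \<gamma> n' j + 1 = (lev \<gamma> n j + 1) + (lev \<gamma> n' j - lev \<gamma> n j)" using lev_mono[OF assms(1), of j] by simp
    have "c l j < 2 ^ (lev \<gamma> n' j + 1)"
      using assms(2) that unfolding cells_def by (auto simp: PiE_iff)
    then show ?thesis
      unfolding coarsen_def e power_add[of _ "lev \<gamma> n j + 1"] by (intro less_mult_imp_div_less)
  qed
  then show ?thesis by (auto simp: cells_def coT_def PiE_iff)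
qed

text \<open>Every coarse tuple has equally many fine tuples below it, so the uniform distribution on
  a fine grid projects to the uniform distribution on every coarser one.\<close>

lemma card_fiber:
  assumes "n \<le> n'" "C \<in> cells n"
  shows "card {c\<in>cells n'. coT n n' c = C} * card (cells n) = card (cells n')"
proof -
  have "{c\<in>cells n'. coT n n' c = C} = (\<Pi>\<^sub>E l\<in>{..<m}. desc \<gamma> n (n' - n) (C l))" (is "?L = ?R")
  proof
    show "?L \<subseteq> ?R"
      using assms(1) by (auto simp: cells_def coT_def desc_def PiE_iff extensional_def)
    show "?R \<subseteq> ?L"
    proof
      fix c assume c: "c \<in> ?R"
      have co: "coarsen \<gamma> n n' (c l) = C l" if "l < m" for l
        using c that assms(1) by (auto simp: desc_def PiE_iff)
      have ext: "c \<in> extensional {..<m}" "C \<in> extensional {..<m}" using c assms(2) by (auto simp: cells_def PiE_iff)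
      then have "coT n n' c = C" by (auto simp: coT_def co extensional_def fun_eq_iff)
      moreover have "c l j < 2 ^ (lev \<gamma> n' j + 1)" if "l < m" for l j
      proof -
        have e: "lev \<gamma> n' j + 1 = (lev \<gamma> n j + 1) + (lev \<gamma> n' j - lev \<gamma> n j)" using lev_mono[OF assms(1), of j] by simp
        have "c l j div 2 ^ (lev \<gamma> n' j - lev \<gamma> n j) < 2 ^ (lev \<gamma> n j + 1)"
        proof -
          have "C l j < 2 ^ (lev \<gamma> n j + 1)" using assms(2) that by (auto simp: cells_def PiE_iff)
          then show ?thesis unfolding co[OF that, symmetric] coarsen_def .
        qed
        then show ?thesis
          unfolding e power_add[of _ "lev \<gamma> n j + 1"] by (subst (asm) div_less_iff_less_mult) auto
      qed
      ultimately show "c \<in> ?L" using ext by (auto simp: cells_def PiE_iff)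
    qed
  qed
  then have "card {c\<in>cells n'. coT n n' c = C} = (\<Prod>j\<in>UNIV. 2 ^ (lev \<gamma> n' j - lev \<gamma> n j)) ^ m"
    using assms(1) by (simp add: card_PiE card_desc)
  moreover have "(\<Prod>j\<in>UNIV. 2 ^ (lev \<gamma> n' j - lev \<gamma> n j)) * (\<Prod>j\<in>UNIV. 2 ^ (lev \<gamma> n j + 1)) = (\<Prod>j\<in>UNIV. (2::nat) ^ (lev \<gamma> n' j + 1))"
    unfolding prod.distrib[symmetric] power_add[symmetric] using lev_mono[OF assms(1)] by simp
  ultimately show ?thesis by (simp only: card_cells power_mult_distrib[symmetric])
qed

text \<open>The weight of a selected tuple is spread evenly over the tuples of the finest grid below
  it. For each of those the ancestors at different levels are selected on disjoint events, so the
  probabilities add up to at most one and the number of levels drops out of the bound.\<close>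

lemma selection_sum_le:
  fixes S :: "nat \<Rightarrow> (nat \<Rightarrow> 'k \<Rightarrow> nat) \<Rightarrow> 'w set"
  assumes S: "\<And>i C. S i C \<in> events" and n: "\<And>i. i < L \<Longrightarrow> n i \<le> n'"
    and disj: "\<And>c. c \<in> cells n' \<Longrightarrow> disjoint_family_on (\<lambda>i. S i (coT (n i) n' c)) {..<L}"
  shows "(\<Sum>i<L. \<Sum>C\<in>cells (n i). prob (S i C) * 2 powr - (real (n i) * real codim)) \<le> 2 ^ (CARD('k) * m)"
proof -
  define KC :: real where "KC = 2 ^ (CARD('k) * m)"
  define W where "W = real (card (cells n'))"
  have W: "W > 0" using card_cells_pos by (simp add: W_def)
  have KC: "KC > 0" by (simp add: KC_def)
  have "(\<Sum>C\<in>cells (n i). prob (S i C) * 2 powr - (real (n i) * real codim)) \<le> (\<Sum>c\<in>cells n'. prob (S i (coT (n i) n' c)) * (KC / W))"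
    if i: "i < L" for i
  proof -
    \<comment> \<open>Up to the constant \<open>KC\<close>, the weight of \<open>C\<close> is at
      most the proportion of finest tuples that lie below it.\<close>
    have w: "2 powr - (real (n i) * real codim) \<le> real (card {c\<in>cells n'. coT (n i) n' c = C}) * (KC / W)"
      if C: "C \<in> cells (n i)" for C
    proof -
      define N where "N = real (card (cells (n i)))"
      have N: "N > 0" using card_cells_pos by (simp add: N_def)
      define f where "f = real (card {c\<in>cells n'. coT (n i) n' c = C})"
      have fN: "W = f * N"
        unfolding f_def N_def W_def card_fiber[OF n[OF i] C, symmetric] by (rule of_nat_mult)
      then have "f \<noteq> 0" using W by auto
      then have e: "f * (KC / W) = KC / N" unfolding fN by simp
      show ?thesis
        unfolding f_def[symmetric] e using card_cells_le[of "n i"] N by (simp add: N_def KC_def pos_le_divide_eq mult.commute)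
    qed
    have "(\<Sum>C\<in>cells (n i). prob (S i C) * 2 powr - (real (n i) * real codim)) \<le>
        (\<Sum>C\<in>cells (n i). prob (S i C) * (real (card {c\<in>cells n'. coT (n i) n' c = C}) * (KC / W)))"
      by (intro sum_mono mult_left_mono w) auto
    also have "\<dots> = (\<Sum>C\<in>cells (n i). \<Sum>c\<in>{c\<in>cells n'. coT (n i) n' c = C}. prob (S i (coT (n i) n' c)) * (KC / W))"
      by (intro sum.cong refl) simp
    also have "\<dots> = (\<Sum>c\<in>cells n'. prob (S i (coT (n i) n' c)) * (KC / W))"
      using coT_cells[OF n[OF i]] by (intro sum.group) auto
    finally show ?thesis .
  qed
  then have "(\<Sum>i<L. \<Sum>C\<in>cells (n i). prob (S i C) * 2 powr - (real (n i) * real codim)) \<le>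
      (\<Sum>i<L. \<Sum>c\<in>cells n'. prob (S i (coT (n i) n' c)) * (KC / W))"
    by (intro sum_mono) auto
  also have "\<dots> = (\<Sum>c\<in>cells n'. (\<Sum>i<L. prob (S i (coT (n i) n' c))) * (KC / W))"
    by (subst sum.swap) (simp only: sum_distrib_right)
  also have "\<dots> \<le> (\<Sum>c\<in>cells n'. 1 * (KC / W))"
  proof (intro sum_mono mult_right_mono)
    fix c assume "c \<in> cells n'"
    then have "(\<Sum>i<L. prob (S i (coT (n i) n' c))) = prob (\<Union>i<L. S i (coT (n i) n' c))"
      using S disj by (intro finite_measure_finite_Union[symmetric]) auto
    also have "\<dots> \<le> 1" by simp
    finally show "(\<Sum>i<L. prob (S i (coT (n i) n' c))) \<le> 1" .
  qed (use W KC in auto)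
  also have "\<dots> = W * (KC / W)" by (simp add: W_def)
  also have "\<dots> = KC" using W by simp
  finally show ?thesis by (simp add: KC_def)
qed

section \<open>Hits of selected cells and of cells without a good scale\<close>

lemma codim_pos: "0 < codim"
  using m2 by (simp add: codim_def)

definition hit :: "nat \<Rightarrow> nat \<Rightarrow> (nat \<Rightarrow> 'k \<Rightarrow> nat) \<Rightarrow> nat \<Rightarrow> ((real^'k \<Rightarrow> real^'d) \<Rightarrow> bool) \<Rightarrow> ((real^'k \<Rightarrow> real^'d) \<Rightarrow> ennreal) \<Rightarrow> 'w set" where
  "hit q n C t A \<rho> = {\<omega>\<in>space M. A (restrict (\<lambda>x. N {2^t..} x \<omega>) T) \<and> (\<forall>(l, e)\<in>hitset.
     ennreal (\<bar>N {0..<2^t} (pt \<gamma> (a l) (b l) n (C l)) \<omega> $ e - N {0..<2^t} (pt \<gamma> (a 0) (b 0) n (C 0)) \<omega> $ e +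
       (N {2^t..} (pt \<gamma> (a l) (b l) n (C l)) \<omega> $ e - N {2^t..} (pt \<gamma> (a 0) (b 0) n (C 0)) \<omega> $ e)\<bar> ^ (2 * q))
        \<le> \<rho> (restrict (\<lambda>x. N {2^t..} x \<omega>) T))}"

lemma U_meas: "(\<lambda>\<omega>. restrict (\<lambda>x. N {2^t..} x \<omega>) T) \<in> measurable M (Pi\<^sub>M T (\<lambda>_. borel))"
proof -
  have "{2^t..} \<inter> {0..<2^t} = ({} :: real set)" by auto
  then show ?thesis using indep_var_rv1[OF N_indep[of "{2^t..}" "{0..<2^t}"]] by simp
qed

lemma hit_meas:
  assumes [measurable]: "Measurable.pred (Pi\<^sub>M T (\<lambda>_. borel)) A" "\<rho> \<in> borel_measurable (Pi\<^sub>M T (\<lambda>_. borel))"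
  shows "hit q n C t A \<rho> \<in> events"
proof -
  note [measurable] = U_meas
  have m0: "0 < m" using m2 by simp
  have [measurable]: "(\<lambda>\<omega>. N {0..<2^t} (pt \<gamma> (a l) (b l) n (C l)) \<omega> $ e) \<in> borel_measurable M"
    "(\<lambda>\<omega>. N {2^t..} (pt \<gamma> (a l) (b l) n (C l)) \<omega> $ e) \<in> borel_measurable M" if "l < m" for l e
    by (intro meas N_G pt_T that; simp)+
  have h: "fst s < m" if "s \<in> hitset" for s using that by (auto simp: hitset_def)
  have "hit q n C t A \<rho> = {\<omega>\<in>space M. A (restrict (\<lambda>x. N {2^t..} x \<omega>) T) \<and> (\<forall>s\<in>hitset.
     ennreal (\<bar>N {0..<2^t} (pt \<gamma> (a (fst s)) (b (fst s)) n (C (fst s))) \<omega> $ snd s - N {0..<2^t} (pt \<gamma> (a 0) (b 0) n (C 0)) \<omega> $ snd s +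
       (N {2^t..} (pt \<gamma> (a (fst s)) (b (fst s)) n (C (fst s))) \<omega> $ snd s - N {2^t..} (pt \<gamma> (a 0) (b 0) n (C 0)) \<omega> $ snd s)\<bar> ^ (2 * q))
        \<le> \<rho> (restrict (\<lambda>x. N {2^t..} x \<omega>) T))}"
    by (simp add: hit_def case_prod_beta)
  also have "\<dots> \<in> events" using h m0 card_hitset(1) by measurable
  finally show ?thesis .
qed

lemma hit_emeasure_le:
  assumes "t0 \<le> t" "codim < 2 * q" "0 < s"
    and "Measurable.pred (Pi\<^sub>M T (\<lambda>_. borel)) A" "\<rho> \<in> borel_measurable (Pi\<^sub>M T (\<lambda>_. borel))"
  shows "emeasure M (hit q n C t A \<rho>) \<le>
    (\<integral>\<^sup>+\<omega>. indicator {\<omega>. A (restrict (\<lambda>x. N {2^t..} x \<omega>) T)} \<omega> * (ennreal ((2 / sqrt \<kappa>) ^ codim) *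
        (ennreal (s ^ codim) + ennreal (1 / s ^ (2 * q - codim)) * \<rho> (restrict (\<lambda>x. N {2^t..} x \<omega>) T))) \<partial>M)"
  unfolding hit_def
  by (rule hit_le[where z = "\<lambda>l. pt \<gamma> (a l) (b l) n (C l)"]) (use assms pt_in_box[OF ab] in auto)

text \<open>For the deterministic radius \<open>s\<close> both terms of
  \<open>hit_emeasure_le\<close> equal \<open>s ^ codim\<close>, whence the factor 2; the selection
  contributes its probability as a separate factor.\<close>

lemma hit_const_le:
  assumes "t0 \<le> t" "codim < 2 * q" "0 < s" and A[measurable]: "Measurable.pred (Pi\<^sub>M T (\<lambda>_. borel)) A"
  shows "prob (hit q n C t A (\<lambda>_. ennreal (s ^ (2 * q)))) \<le>
    prob {\<omega>\<in>space M. A (restrict (\<lambda>x. N {2^t..} x \<omega>) T)} * (2 * (2 / sqrt \<kappa>) ^ codim * s ^ codim)"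
proof -
  note [measurable] = U_meas
  let ?A = "{\<omega>\<in>space M. A (restrict (\<lambda>x. N {2^t..} x \<omega>) T)}"
  have K: "0 \<le> (2 / sqrt \<kappa>) ^ codim" using pos by simp
  have "1 / s ^ (2 * q - codim) * s ^ (2 * q) = s ^ codim"
    using assms(2,3) by (simp add: power_diff)
  then have e: "ennreal ((2 / sqrt \<kappa>) ^ codim) * (ennreal (s ^ codim) + ennreal (1 / s ^ (2 * q - codim)) * ennreal (s ^ (2 * q))) =
      ennreal (2 * (2 / sqrt \<kappa>) ^ codim * s ^ codim)"
    using K assms(3) by (simp add: ennreal_mult'[symmetric] ennreal_plus[symmetric] mult_ac del: ennreal_plus)
  have "emeasure M (hit q n C t A (\<lambda>_. ennreal (s ^ (2 * q)))) \<le>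
     (\<integral>\<^sup>+\<omega>. indicator {\<omega>. A (restrict (\<lambda>x. N {2^t..} x \<omega>) T)} \<omega> * ennreal (2 * (2 / sqrt \<kappa>) ^ codim * s ^ codim) \<partial>M)"
    using hit_emeasure_le[OF assms(1-3) A, of "\<lambda>_. ennreal (s ^ (2 * q))" n C] by (simp add: e)
  also have "\<dots> = (\<integral>\<^sup>+\<omega>. indicator ?A \<omega> * ennreal (2 * (2 / sqrt \<kappa>) ^ codim * s ^ codim) \<partial>M)"
    by (intro nn_integral_cong) (auto simp: indicator_def)
  also have "\<dots> = emeasure M ?A * ennreal (2 * (2 / sqrt \<kappa>) ^ codim * s ^ codim)"
    by (simp add: nn_integral_multc)
  also have "\<dots> = ennreal (prob ?A * (2 * (2 / sqrt \<kappa>) ^ codim * s ^ codim))"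
    using K assms(3) by (simp add: emeasure_eq_measure ennreal_mult')
  finally show ?thesis using K assms(3) by (simp add: emeasure_eq_measure)
qed

text \<open>The path at a coincidence point is within \<open>\<delta> + \<delta>'\<close> of its
  value at the grid point of the cell, so the values at two grid points differ by at most twice
  that. The splitting of the path is asked for at grid points only, where it can be had almost
  surely for all of them at once.\<close>

lemma level_set_hit:
  fixes v :: "real^'k \<Rightarrow> real^'d" and V U
  assumes x: "\<And>l. l < m \<Longrightarrow> xs l \<in> cbox (a l) (b l)" "\<And>l. l < m \<Longrightarrow> v (xs l) = v (xs 0)" "continuous_on UNIV v"
    and v: "\<And>l n i. l < m \<Longrightarrow> v (pt \<gamma> (a l) (b l) n i) = V (pt \<gamma> (a l) (b l) n i) + U (pt \<gamma> (a l) (b l) n i)"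
    and C: "\<And>l. l < m \<Longrightarrow> C l = idx \<gamma> (a l) (b l) n (xs l)"
    and osc: "oscf V n C \<delta>" "oscf U n C \<delta>'" and l: "l < m"
  shows "\<bar>V (pt \<gamma> (a l) (b l) n (C l)) $ e - V (pt \<gamma> (a 0) (b 0) n (C 0)) $ e +
    (U (pt \<gamma> (a l) (b l) n (C l)) $ e - U (pt \<gamma> (a 0) (b 0) n (C 0)) $ e)\<bar> \<le> 2 * (\<delta> + \<delta>')"
proof -
  have m0: "0 < m" using m2 by simp
  have d: "\<bar>v (xs l) $ e - v (pt \<gamma> (a l) (b l) n (C l)) $ e\<bar> \<le> \<delta> + \<delta>'" if l: "l < m" for l
    unfolding C[OF l]
  proof (rule chain_limit[where f = "\<lambda>x. v x $ e", OF ab[OF l] x(1)[OF l]])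
    show "isCont (\<lambda>x. v x $ e) (xs l)"
      using x(3) by (auto intro!: continuous_intros simp: continuous_on_eq_continuous_at)
    fix t i assume i: "i \<in> desc \<gamma> n t (idx \<gamma> (a l) (b l) n (xs l))"
    have "\<bar>V (pt \<gamma> (a l) (b l) (n + t) i) $ e - V (pt \<gamma> (a l) (b l) n (C l)) $ e\<bar> \<le> \<delta>"
      "\<bar>U (pt \<gamma> (a l) (b l) (n + t) i) $ e - U (pt \<gamma> (a l) (b l) n (C l)) $ e\<bar> \<le> \<delta>'"
      using osc l i by (auto simp: oscf_def C[OF l])
    then show "\<bar>v (pt \<gamma> (a l) (b l) (n + t) i) $ e - v (pt \<gamma> (a l) (b l) n (idx \<gamma> (a l) (b l) n (xs l))) $ e\<bar> \<le> \<delta> + \<delta>'"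
      unfolding v[OF l] C[OF l] by simp
  qed
  have "v (xs l) $ e = v (xs 0) $ e" using x(2)[OF l] by simp
  then have "\<bar>v (pt \<gamma> (a l) (b l) n (C l)) $ e - v (pt \<gamma> (a 0) (b 0) n (C 0)) $ e\<bar> \<le> 2 * (\<delta> + \<delta>')"
  proof -
    have "\<bar>x - p\<bar> \<le> s \<Longrightarrow> \<bar>y - r\<bar> \<le> s \<Longrightarrow> x = y \<Longrightarrow> \<bar>p - r\<bar> \<le> 2 * s" for x y p r s :: real
      by linarith
    then show ?thesis using d[OF l] d[OF m0] \<open>v (xs l) $ e = v (xs 0) $ e\<close> by blast
  qed
  then show ?thesis unfolding v[OF l] v[OF m0] by (simp add: algebra_simps)
qed

text \<open>The radius is random here and may be correlated with the event \<open>A\<close> that no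
  scale is good. The linear bound separates the two: one term keeps the indicator of
  \<open>A\<close> and is small with \<open>\<delta>\<close>; in the other the indicator is dropped
  and only the mean of \<open>\<rho>\<close>, of order \<open>2^(-2 q n)\<close>, is used. With
  \<open>s = \<Lambda> * w\<close> both terms scale like \<open>w ^ codim\<close>; a large
  \<open>\<Lambda>\<close> makes the second small, and \<open>\<delta>\<close> is adapted to it
  afterwards.\<close>

lemma hit_bad_le:
  fixes A :: "(real^'k \<Rightarrow> real^'d) \<Rightarrow> bool"
  assumes t: "t0 \<le> t" "2 * t \<le> n" and q: "codim < 2 * q" "Qdim \<gamma> + 1 \<le> real q" and "0 < \<Lambda>" "0 < \<epsilon>"
    and A[measurable]: "Measurable.pred (Pi\<^sub>M T (\<lambda>_. borel)) A"
    and \<delta>: "prob {\<omega>\<in>space M. A (restrict (\<lambda>x. N {2^t..} x \<omega>) T)} \<le> \<delta>"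
    and C5: "C5 = 4 ^ (2 * q) * (8 ^ (2 * q) * (chain_const CARD('d) q * (2 * c1) ^ (2 * q)) + \<epsilon> ^ (2 * q))"
    and \<rho>: "\<rho> = (\<lambda>f. ennreal (4 ^ (2 * q)) * (ennreal (8 ^ (2 * q)) * chain_norm q f n C + ennreal ((\<epsilon> * 2 powr - real n) ^ (2 * q))))"
  shows "prob (hit q n C t A \<rho>) \<le> (2 / sqrt \<kappa>) ^ codim * (\<Lambda> ^ codim * \<delta> + C5 / \<Lambda> ^ (2 * q - codim)) * 2 powr - (real n * real codim)"
proof -
  note [measurable] = U_meas chain_norm_meas_fun
  define w where "w = 2 powr - real n"
  have w: "0 < w" by (simp add: w_def)
  have wD: "w ^ codim = 2 powr - (real n * real codim)" by (simp add: w_def powr_power mult.commute)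
  define K where "K = (2 / sqrt \<kappa>) ^ codim"
  have K: "0 \<le> K" using pos by (simp add: K_def)
  define s where "s = \<Lambda> * w"
  have s: "0 < s" using w assms by (simp add: s_def)
  define r where "r = 1 / s ^ (2 * q - codim)"
  have r: "0 \<le> r" using s by (simp add: r_def)
  have KK0: "0 \<le> chain_const CARD('d) q * (2 * c1) ^ (2 * q)" using chain_const_nonneg pos by simp
  have C50: "0 \<le> C5" unfolding C5
    by (intro mult_nonneg_nonneg add_nonneg_nonneg chain_const_nonneg zero_le_power) (use pos assms in auto)
  let ?U = "\<lambda>\<omega>. restrict (\<lambda>x. N {2^t..} x \<omega>) T"
  let ?A = "{\<omega>\<in>space M. A (?U \<omega>)}"
  have \<rho>_meas[measurable]: "\<rho> \<in> borel_measurable (Pi\<^sub>M T (\<lambda>_. borel))" unfolding \<rho> by measurable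
  have I: "(\<integral>\<^sup>+\<omega>. \<rho> (?U \<omega>) \<partial>M) \<le> ennreal (C5 * w ^ (2 * q))"
  proof -
    note [measurable] = chain_norm_meas[OF gproc_N, of "{2^t..}" q n C, simplified]
    have "(\<integral>\<^sup>+\<omega>. \<rho> (?U \<omega>) \<partial>M) = ennreal (4 ^ (2 * q)) * (ennreal (8 ^ (2 * q)) * (\<integral>\<^sup>+\<omega>. chain_norm q (\<lambda>x. N {2^t..} x \<omega>) n C \<partial>M)
        + ennreal ((\<epsilon> * w) ^ (2 * q)))"
      unfolding \<rho> chain_norm_restrict
      by (simp add: nn_integral_cmult nn_integral_add emeasure_space_1 w_def)
    also have "\<dots> \<le> ennreal (4 ^ (2 * q)) * (ennreal (8 ^ (2 * q)) * ennreal (chain_const CARD('d) q * (2 * c1 * w) ^ (2 * q))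
        + ennreal ((\<epsilon> * w) ^ (2 * q)))"
      using linkvar_up[OF t, of C] pos q unfolding w_def
      by (intro mult_left_mono add_right_mono chain_norm_moment gproc_N) auto
    also have "\<dots> = ennreal (4 ^ (2 * q) * (8 ^ (2 * q) * (chain_const CARD('d) q * (2 * c1 * w) ^ (2 * q)) + (\<epsilon> * w) ^ (2 * q)))"
      using chain_const_nonneg[of "CARD('d)" q] pos w assms(6)
      by (simp add: ennreal_mult'[symmetric] ennreal_plus[symmetric] del: ennreal_plus)
    also have "4 ^ (2 * q) * (8 ^ (2 * q) * (chain_const CARD('d) q * (2 * c1 * w) ^ (2 * q)) + (\<epsilon> * w) ^ (2 * q)) = C5 * w ^ (2 * q)"
      unfolding C5 power_mult_distrib[of _ w] by (simp only: ring_distribs mult_ac)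
    finally show ?thesis .
  qed
  have "emeasure M (hit q n C t A \<rho>) \<le>
    (\<integral>\<^sup>+\<omega>. indicator {\<omega>. A (?U \<omega>)} \<omega> * (ennreal K * (ennreal (s ^ codim) + ennreal r * \<rho> (?U \<omega>))) \<partial>M)"
    unfolding K_def r_def by (rule hit_emeasure_le[OF t(1) q(1) s A \<rho>_meas])
  also have "\<dots> \<le> (\<integral>\<^sup>+\<omega>. indicator ?A \<omega> * ennreal (K * s ^ codim) + ennreal (K * r) * \<rho> (?U \<omega>) \<partial>M)"
    using K s r by (intro nn_integral_mono) (auto simp: indicator_def ennreal_mult distrib_left mult.assoc)
  also have "\<dots> = emeasure M ?A * ennreal (K * s ^ codim) + ennreal (K * r) * (\<integral>\<^sup>+\<omega>. \<rho> (?U \<omega>) \<partial>M)"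
    by (simp add: nn_integral_add nn_integral_cmult nn_integral_multc)
  also have "\<dots> \<le> ennreal \<delta> * ennreal (K * s ^ codim) + ennreal (K * r) * ennreal (C5 * w ^ (2 * q))"
    using \<delta> I by (intro add_mono mult_right_mono mult_left_mono) (auto simp: emeasure_eq_measure ennreal_leI)
  also have "\<dots> = ennreal (\<delta> * (K * s ^ codim) + K * r * (C5 * w ^ (2 * q)))"
  proof -
    have "0 \<le> \<delta>" using \<delta> measure_nonneg order_trans by blast
    then show ?thesis using K s r C50 w
      by (subst ennreal_plus) (auto simp: ennreal_mult' intro!: mult_nonneg_nonneg)
  qed
  also have "\<delta> * (K * s ^ codim) + K * r * (C5 * w ^ (2 * q)) = K * (\<Lambda> ^ codim * \<delta> + C5 / \<Lambda> ^ (2 * q - codim)) * w ^ codim"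
  proof -
    have "w ^ (2 * q) = w ^ (2 * q - codim) * w ^ codim" using q by (simp flip: power_add)
    then have "r * (C5 * w ^ (2 * q)) = C5 / \<Lambda> ^ (2 * q - codim) * w ^ codim"
      using w assms by (simp add: r_def s_def power_mult_distrib)
    then have "K * r * (C5 * w ^ (2 * q)) = K * (C5 / \<Lambda> ^ (2 * q - codim) * w ^ codim)" by (simp only: mult.assoc)
    then show ?thesis by (simp add: s_def power_mult_distrib algebra_simps)
  qed
  finally have "ennreal (prob (hit q n C t A \<rho>)) \<le> ennreal (K * (\<Lambda> ^ codim * \<delta> + C5 / \<Lambda> ^ (2 * q - codim)) * w ^ codim)"
    by (simp add: emeasure_eq_measure)
  moreover have "0 \<le> K * (\<Lambda> ^ codim * \<delta> + C5 / \<Lambda> ^ (2 * q - codim)) * w ^ codim"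
    using K w C50 assms(5) order_trans[OF measure_nonneg \<delta>] by (intro mult_nonneg_nonneg add_nonneg_nonneg) auto
  ultimately show ?thesis unfolding K_def wD by simp
qed

lemma no_hit_aux:
  assumes v: "AE \<omega> in M. continuous_on UNIV (\<lambda>x. v x \<omega>)"
    and N_v: "\<And>x. x \<in> T \<Longrightarrow> AE \<omega> in M. N {0..} x \<omega> = v x \<omega>" and \<eta>: "0 < \<eta>"
  obtains E where "E \<in> events" "prob E \<le> \<eta>"
    "AE \<omega> in M. (\<exists>xs. (\<forall>l<m. xs l \<in> cbox (a l) (b l)) \<and> (\<forall>l<m. v (xs l) \<omega> = v (xs 0) \<omega>)) \<longrightarrow> \<omega> \<in> E"
proof -
  \<comment> \<open>\<open>Q + 1\<close> makes the chaining moments summable,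
    \<open>codim + 1\<close> keeps \<open>2 * q - codim\<close> positive, and the quotient by
    \<open>g\<close> lets the gain \<open>2^(-g \<nu>)\<close>, raised to the power
    \<open>2 * q\<close>, beat the roughly \<open>2^(2 \<nu> codim)\<close> tuples of cells.\<close>
  obtain q :: nat where q': "max (Qdim \<gamma> + 1) (max (real codim + 1) ((real m * Qdim \<gamma> + real codim + 1) / g)) \<le> real q"
    using real_arch_simple by blast
  then have q: "Qdim \<gamma> + 1 \<le> real q" "codim < 2 * q" "real codim + 1 \<le> g * real q"
  proof -
    have "(real m * Qdim \<gamma> + real codim + 1) / g \<le> real q" using q' by simp
    then have "real m * Qdim \<gamma> + real codim + 1 \<le> g * real q" using pos by (simp add: pos_divide_le_eq mult.commute)
    moreover have "0 \<le> real m * Qdim \<gamma>" using Qdim_pos by simp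
    ultimately show "real codim + 1 \<le> g * real q" by linarith
    show "Qdim \<gamma> + 1 \<le> real q" "codim < 2 * q" using q' by auto
  qed
  define K where "K = (2 / sqrt \<kappa>) ^ codim"
  have K: "0 < K" using pos by (simp add: K_def)
  define KC :: real where "KC = 2 ^ (CARD('k) * m)"
  have KC: "0 < KC" by (simp add: KC_def)
  \<comment> \<open>The 4 stands for two cells with two oscillations \<open>\<epsilon> * w\<close>
    each, one of the low and one of the high frequencies.\<close>
  obtain \<epsilon> where \<epsilon>: "0 < \<epsilon>" "KC * (2 * K * (4 * \<epsilon>) ^ codim) \<le> \<eta> / 3"
  proof -
    have "((\<lambda>\<epsilon>. KC * (2 * K * (4 * \<epsilon>) ^ codim)) \<longlongrightarrow> KC * (2 * K * (4 * 0) ^ codim)) (at_right 0)"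
      by (intro tendsto_intros)
    then have "\<forall>\<^sub>F \<epsilon> in at_right 0. KC * (2 * K * (4 * \<epsilon>) ^ codim) < \<eta> / 3"
      using codim_pos \<eta> by (intro order_tendstoD(2)) (auto simp: zero_power)
    then show ?thesis
      using eventually_conj[OF _ eventually_at_right_less[of "0::real"]] eventually_happens'[OF trivial_limit_at_right_real]
        that less_imp_le by blast
  qed
  define C5 where "C5 = 4 ^ (2 * q) * (8 ^ (2 * q) * (chain_const CARD('d) q * (2 * c1) ^ (2 * q)) + \<epsilon> ^ (2 * q))"
  have C5: "0 \<le> C5" unfolding C5_def
    by (intro mult_nonneg_nonneg add_nonneg_nonneg chain_const_nonneg zero_le_power) (use pos \<epsilon> in auto)
  \<comment> \<open>The third of \<open>\<eta>\<close> reserved for bad cells is split into two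
    sixths, one settled by \<open>\<Lambda>\<close> and the other by \<open>\<delta>\<close>;
    \<open>C5\<close> depends on neither.\<close>
  define \<Lambda> where "\<Lambda> = 1 + 6 * KC * K * C5 / \<eta>"
  have \<Lambda>1: "1 \<le> \<Lambda>" unfolding \<Lambda>_def using KC K C5 \<eta> by auto
  have \<Lambda>: "KC * (K * (C5 / \<Lambda> ^ (2 * q - codim))) \<le> \<eta> / 6"
  proof -
    have "\<Lambda> ^ 1 \<le> \<Lambda> ^ (2 * q - codim)" using \<Lambda>1 q by (intro power_increasing) auto
    then have "C5 / \<Lambda> ^ (2 * q - codim) \<le> C5 / \<Lambda>"
      using \<Lambda>1 C5 by (intro divide_left_mono mult_pos_pos) auto
    then have "KC * (K * (C5 / \<Lambda> ^ (2 * q - codim))) \<le> KC * (K * (C5 / \<Lambda>))"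
      using KC K by (intro mult_left_mono) auto
    also have "\<dots> = (6 * KC * K * C5 / \<eta>) * (\<eta> / 6) / \<Lambda>" using \<eta> by simp
    also have "\<dots> \<le> \<Lambda> * (\<eta> / 6) / \<Lambda>"
      using \<Lambda>1 \<eta> by (intro divide_right_mono mult_right_mono) (auto simp: \<Lambda>_def)
    finally show ?thesis using \<Lambda>1 by simp
  qed
  define \<delta> where "\<delta> = \<eta> / (6 * KC * K * \<Lambda> ^ codim)"
  have \<delta>: "0 < \<delta>" "KC * (K * (\<Lambda> ^ codim * \<delta>)) = \<eta> / 6"
    using \<eta> KC K \<Lambda>1 by (auto simp: \<delta>_def)
  obtain L h :: nat where Lh: "0 < L" "0 < h"
    "\<And>\<nu> C. t0 + h \<le> \<nu> \<Longrightarrow>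
      prob {\<omega>\<in>space M. \<forall>i<L. \<not> oscf (\<lambda>x. N {2^\<nu>..} x \<omega>) (2 * \<nu> + 2 * h * i) (C i) (\<epsilon> * 2 powr - real (2 * \<nu> + 2 * h * i))} \<le> \<delta>"
    using bad_prob[OF \<epsilon>(1) \<delta>(1)] by blast
  define C6 where "C6 = chain_const CARD('d) q * (8 * c1 / \<epsilon>) ^ (2 * q)"
  have C6: "0 \<le> C6" unfolding C6_def using chain_const_nonneg \<epsilon> pos by auto
  \<comment> \<open>Now that \<open>L\<close> and \<open>h\<close> are fixed, the finest level
    exceeds \<open>2 * \<nu>\<close> by a constant, and the number of scales does not grow with
    \<open>\<nu>\<close>.\<close>
  obtain \<nu> where \<nu>: "t0 + h \<le> \<nu>"
    "real (L + 1) * (KC * 2 powr (real (2 * \<nu> + 2 * h * L) * real codim) * (C6 * 2 powr - (g * real \<nu> * real (2 * q)))) \<le> \<eta> / 3"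
  proof -
    define c where "c = real (L + 1) * KC * C6 * 2 powr (real (2 * h * L) * real codim)"
    have c0: "0 \<le> c" using KC C6 by (simp add: c_def)
    have b: "real (L + 1) * (KC * 2 powr (real (2 * \<nu> + 2 * h * L) * real codim) * (C6 * 2 powr - (g * real \<nu> * real (2 * q)))) \<le> c * 2 powr - real \<nu>" for \<nu>
    proof -
      have "real (L + 1) * (KC * 2 powr (real (2 * \<nu> + 2 * h * L) * real codim) * (C6 * 2 powr - (g * real \<nu> * real (2 * q)))) =
        c * (2 powr (2 * real \<nu> * real codim) * 2 powr - (g * real \<nu> * real (2 * q)))"
      proof -
        have "2 powr (real (2 * \<nu> + 2 * h * L) * real codim) = 2 powr (2 * real \<nu> * real codim) * 2 powr (real (2 * h * L) * real codim)"
          unfolding powr_add[symmetric] by (simp add: distrib_right)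
        then show ?thesis unfolding c_def by (simp only: mult_ac)
      qed
      also have "\<dots> \<le> c * 2 powr - real \<nu>"
      proof (rule mult_left_mono[OF _ c0])
        have "real \<nu> * (real codim + 1) \<le> real \<nu> * (g * real q)" using q by (intro mult_left_mono) auto
        then have "2 * real \<nu> * real codim + - (g * real \<nu> * real (2 * q)) \<le> - real \<nu>"
          by (simp add: algebra_simps)
        then show "2 powr (2 * real \<nu> * real codim) * 2 powr - (g * real \<nu> * real (2 * q)) \<le> 2 powr - real \<nu>"
          unfolding powr_add[symmetric] by (intro powr_mono) auto
      qed
      finally show ?thesis .
    qed
    have "(\<lambda>\<nu>. c * 2 powr - real \<nu>) \<longlonglongrightarrow> c * 0"
      by (intro tendsto_intros) real_asymp
    then have "\<forall>\<^sub>F \<nu> in sequentially. c * 2 powr - real \<nu> < \<eta> / 3"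
      using \<eta> by (intro order_tendstoD(2)) auto
    then have "\<forall>\<^sub>F \<nu> in sequentially. c * 2 powr - real \<nu> < \<eta> / 3 \<and> t0 + h \<le> \<nu>"
      by (intro eventually_conj eventually_ge_at_top)
    then obtain \<nu> where "c * 2 powr - real \<nu> < \<eta> / 3" "t0 + h \<le> \<nu>"
      using eventually_happens'[OF sequentially_bot] by blast
    then show ?thesis using that b[of \<nu>] by (meson less_imp_le order_trans)
  qed
  have t: "t0 \<le> \<nu>" using \<nu> by simp
  define n where "n i = 2 * \<nu> + 2 * h * i" for i
  define n' where "n' = n L"
  define w where "w i = 2 powr - real (n i)" for i
  have w: "0 < w i" for i by (simp add: w_def)
  have n_mono: "i \<le> j \<Longrightarrow> n i \<le> n j" for i j by (simp add: n_def)
  have n_ge: "2 * \<nu> \<le> n i" for i by (simp add: n_def)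
  define U where "U \<omega> = restrict (\<lambda>x. N {2^\<nu>..} x \<omega>) T" for \<omega>
  define good where "good i C f \<longleftrightarrow> oscf f (n i) C (\<epsilon> * w i)" for i C and f :: "real^'k \<Rightarrow> real^'d"
  \<comment> \<open>Taking the first good scale among the ancestors makes the selection events along
    one branch disjoint.\<close>
  define sel where "sel i C f \<longleftrightarrow> good i C f \<and> (\<forall>i'<i. \<not> good i' (coT (n i') (n i) C) f)" for i C f
  define bad where "bad c f \<longleftrightarrow> (\<forall>i<L. \<not> good i (coT (n i) n' c) f)" for c f
  have [measurable]: "Measurable.pred (Pi\<^sub>M T (\<lambda>_. borel)) (good i C)" for i C
    unfolding good_def by (rule oscf_pred)
  have [measurable]: "Measurable.pred (Pi\<^sub>M T (\<lambda>_. borel)) (sel i C)" for i C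
    unfolding sel_def by measurable
  have [measurable]: "Measurable.pred (Pi\<^sub>M T (\<lambda>_. borel)) (bad c)" for c
    unfolding bad_def by measurable
  have [measurable]: "U \<in> measurable M (Pi\<^sub>M T (\<lambda>_. borel))" unfolding U_def by (rule U_meas)
  \<comment> \<open>The \<open>2 * q\<close>-th power of a bound for the radius on a bad cell: the 8
    comes from the chaining, the 4 from two cells with two oscillations each.\<close>
  define \<rho> where "\<rho> c = (\<lambda>f :: real^'k \<Rightarrow> real^'d. ennreal (4 ^ (2 * q)) * (ennreal (8 ^ (2 * q)) * chain_norm q f n' c + ennreal ((\<epsilon> * 2 powr - real n') ^ (2 * q))))" for c
  have [measurable]: "\<rho> c \<in> borel_measurable (Pi\<^sub>M T (\<lambda>_. borel))" for c
    unfolding \<rho>_def using chain_norm_meas_fun by measurable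
  \<comment> \<open>The three exceptional events: a large low-frequency oscillation, a hit of a
    selected tuple, and a hit of a tuple without good scale. Each receives a third of
    \<open>\<eta>\<close>.\<close>
  define EV where "EV i C = {\<omega>\<in>space M. \<not> oscf (\<lambda>x. N {0..<2^\<nu>} x \<omega>) (n i) C (\<epsilon> * w i)}" for i C
  define EG where "EG i C = hit q (n i) C \<nu> (sel i C) (\<lambda>_. ennreal ((4 * \<epsilon> * w i) ^ (2 * q)))" for i C
  define EB where "EB c = hit q n' c \<nu> (bad c) (\<rho> c)" for c
  have EV_meas: "EV i C \<in> events" for i C
    unfolding EV_def using oscf_meas[OF gproc_N] by (intro sets.sets_Collect_neg) auto
  have EG_meas: "EG i C \<in> events" for i C unfolding EG_def by (rule hit_meas) measurable
  have EB_meas: "EB c \<in> events" for c unfolding EB_def by (rule hit_meas) measurable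
  define E where "E = (\<Union>i\<in>{..L}. \<Union>C\<in>cells (n i). EV i C) \<union> ((\<Union>i\<in>{..<L}. \<Union>C\<in>cells (n i). EG i C) \<union> (\<Union>c\<in>cells n'. EB c))"
  have mUN: "(\<Union>i\<in>I. \<Union>C\<in>cells (n i). F i C) \<in> events" if "finite I" "\<And>i C. F i C \<in> events" for I F
    using that by (intro sets.finite_UN) auto
  have E_meas: "E \<in> events"
    unfolding E_def by (intro sets.Un mUN sets.finite_UN EV_meas EG_meas EB_meas) auto
  have sub2: "prob (\<Union>i\<in>I. \<Union>C\<in>cells (n i). F i C) \<le> (\<Sum>i\<in>I. \<Sum>C\<in>cells (n i). prob (F i C))"
    if "finite I" "\<And>i C. F i C \<in> events" for I F
  proof -
    have "prob (\<Union>i\<in>I. \<Union>C\<in>cells (n i). F i C) \<le> (\<Sum>i\<in>I. prob (\<Union>C\<in>cells (n i). F i C))"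
      using that by (intro finite_measure_subadditive_finite) (auto intro!: sets.finite_UN)
    also have "\<dots> \<le> (\<Sum>i\<in>I. \<Sum>C\<in>cells (n i). prob (F i C))"
      using that by (intro sum_mono finite_measure_subadditive_finite) auto
    finally show ?thesis .
  qed
  have PV: "prob (\<Union>i\<in>{..L}. \<Union>C\<in>cells (n i). EV i C) \<le> \<eta> / 3"
  proof -
    have ev: "prob (EV i C) \<le> C6 * 2 powr - (g * real \<nu> * real (2 * q))" for i C
    proof -
      have "prob (EV i C) \<le> chain_const CARD('d) q * (8 * (c1 * 2 powr (- real (n i) - g * real \<nu>)) / (\<epsilon> * w i)) ^ (2 * q)"
        unfolding EV_def using \<epsilon> w pos
        by (intro oscf_tail gproc_N linkvar_low[OF t n_ge] q) auto
      also have "8 * (c1 * 2 powr (- real (n i) - g * real \<nu>)) / (\<epsilon> * w i) = 8 * c1 / \<epsilon> * 2 powr - (g * real \<nu>)"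
        by (simp add: w_def powr_diff powr_minus field_simps)
      also have "chain_const CARD('d) q * (8 * c1 / \<epsilon> * 2 powr - (g * real \<nu>)) ^ (2 * q) = C6 * 2 powr - (g * real \<nu> * real (2 * q))"
        unfolding C6_def power_mult_distrib by (simp add: powr_power mult.commute mult.left_commute)
      finally show ?thesis .
    qed
    have cd: "real (card (cells (n i))) \<le> KC * 2 powr (real n' * real codim)" if "i \<le> L" for i
    proof -
      have "real (card (cells (n i))) = real (card (cells (n i))) * 2 powr - (real (n i) * real codim) * 2 powr (real (n i) * real codim)"
        by (simp add: powr_minus)
      also have "\<dots> \<le> KC * 2 powr (real n' * real codim)"
        using card_cells_le[of "n i"] KC n_mono[OF that] unfolding n'_def
        by (intro mult_mono powr_mono mult_right_mono) (auto simp: KC_def)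
      finally show ?thesis .
    qed
    have "prob (\<Union>i\<in>{..L}. \<Union>C\<in>cells (n i). EV i C) \<le> (\<Sum>i\<le>L. \<Sum>C\<in>cells (n i). prob (EV i C))"
      by (intro sub2 EV_meas) auto
    also have "\<dots> \<le> (\<Sum>i\<le>L. \<Sum>C\<in>cells (n i). C6 * 2 powr - (g * real \<nu> * real (2 * q)))"
      by (intro sum_mono ev)
    also have "\<dots> = (\<Sum>i\<le>L. real (card (cells (n i))) * (C6 * 2 powr - (g * real \<nu> * real (2 * q))))"
      by simp
    also have "\<dots> \<le> (\<Sum>i\<le>L. (KC * 2 powr (real n' * real codim)) * (C6 * 2 powr - (g * real \<nu> * real (2 * q))))"
      using C6 by (intro sum_mono mult_right_mono cd) auto
    also have "\<dots> = real (L + 1) * (KC * 2 powr (real n' * real codim) * (C6 * 2 powr - (g * real \<nu> * real (2 * q))))"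
      by simp
    also have "\<dots> \<le> \<eta> / 3" using \<nu>(2) by (simp add: n'_def n_def)
    finally show ?thesis .
  qed
  have PG: "prob (\<Union>i\<in>{..<L}. \<Union>C\<in>cells (n i). EG i C) \<le> \<eta> / 3"
  proof -
    define S where "S i C = {\<omega>\<in>space M. sel i C (U \<omega>)}" for i C
    have S_meas: "S i C \<in> events" for i C unfolding S_def by measurable
    have eg: "prob (EG i C) \<le> (2 * K * (4 * \<epsilon>) ^ codim) * (prob (S i C) * 2 powr - (real (n i) * real codim))" for i C
    proof -
      have "prob (EG i C) \<le> prob (S i C) * (2 * K * (4 * \<epsilon> * w i) ^ codim)"
        unfolding EG_def S_def U_def K_def using \<epsilon> w t q by (intro hit_const_le) auto
      also have "(4 * \<epsilon> * w i) ^ codim = (4 * \<epsilon>) ^ codim * 2 powr - (real (n i) * real codim)"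
        by (simp add: power_mult_distrib w_def powr_power mult.commute)
      finally show ?thesis by (simp only: mult_ac)
    qed
    have "prob (\<Union>i\<in>{..<L}. \<Union>C\<in>cells (n i). EG i C) \<le> (\<Sum>i<L. \<Sum>C\<in>cells (n i). prob (EG i C))"
      by (intro sub2 EG_meas) auto
    also have "\<dots> \<le> (\<Sum>i<L. \<Sum>C\<in>cells (n i). (2 * K * (4 * \<epsilon>) ^ codim) * (prob (S i C) * 2 powr - (real (n i) * real codim)))"
      by (intro sum_mono eg)
    also have "\<dots> = (2 * K * (4 * \<epsilon>) ^ codim) * (\<Sum>i<L. \<Sum>C\<in>cells (n i). prob (S i C) * 2 powr - (real (n i) * real codim))"
      by (simp only: sum_distrib_left)
    also have "\<dots> \<le> (2 * K * (4 * \<epsilon>) ^ codim) * KC"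
    proof (rule mult_left_mono)
      show "(\<Sum>i<L. \<Sum>C\<in>cells (n i). prob (S i C) * 2 powr - (real (n i) * real codim)) \<le> KC"
        unfolding KC_def
      proof (rule selection_sum_le[OF S_meas, where n' = n'])
        show "n i \<le> n'" if "i < L" for i using that n_mono[of i L] by (simp add: n'_def)
        fix c assume "c \<in> cells n'"
        have "coT (n i') (n i) (coT (n i) n' c) = coT (n i') n' c" if "i' < i" "i < L" for i i'
          using that n_mono[of i' i] n_mono[of i L] by (auto simp: coT_def coarsen_trans n'_def)
        then have "S i' (coT (n i') n' c) \<inter> S i (coT (n i) n' c) = {}" if "i' < i" "i < L" for i i'
          using that by (auto simp: S_def sel_def)
        then show "disjoint_family_on (\<lambda>i. S i (coT (n i) n' c)) {..<L}"
          unfolding disjoint_family_on_def by (metis Int_commute lessThan_iff linorder_neqE_nat)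
      qed
    qed (use K \<epsilon> in auto)
    also have "\<dots> \<le> \<eta> / 3" using \<epsilon> by (simp add: mult_ac)
    finally show ?thesis .
  qed
  have PB: "prob (\<Union>c\<in>cells n'. EB c) \<le> \<eta> / 3"
  proof -
    have "prob {\<omega>\<in>space M. bad c (U \<omega>)} \<le> \<delta>" for c
      using Lh(3)[OF \<nu>(1), of "\<lambda>i. coT (n i) n' c"]
      by (simp add: bad_def good_def U_def oscf_restrict n_def w_def)
    then have eb: "prob (EB c) \<le> K * (\<Lambda> ^ codim * \<delta> + C5 / \<Lambda> ^ (2 * q - codim)) * 2 powr - (real n' * real codim)" for c
      unfolding EB_def K_def \<rho>_def U_def using n_ge[of L] \<Lambda>1 \<epsilon> q
      by (intro hit_bad_le[OF t]) (auto simp: n'_def C5_def)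
    have "prob (\<Union>c\<in>cells n'. EB c) \<le> (\<Sum>c\<in>cells n'. prob (EB c))"
      using EB_meas by (intro finite_measure_subadditive_finite) auto
    also have "\<dots> \<le> (\<Sum>c\<in>cells n'. K * (\<Lambda> ^ codim * \<delta> + C5 / \<Lambda> ^ (2 * q - codim)) * 2 powr - (real n' * real codim))"
      by (intro sum_mono eb)
    also have "\<dots> = (K * (\<Lambda> ^ codim * \<delta> + C5 / \<Lambda> ^ (2 * q - codim))) * (real (card (cells n')) * 2 powr - (real n' * real codim))"
      by simp
    also have "\<dots> \<le> (K * (\<Lambda> ^ codim * \<delta> + C5 / \<Lambda> ^ (2 * q - codim))) * KC"
      unfolding KC_def using K \<Lambda>1 \<delta> C5 by (intro mult_left_mono card_cells_le mult_nonneg_nonneg add_nonneg_nonneg) auto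
    also have "\<dots> = KC * (K * (\<Lambda> ^ codim * \<delta>)) + KC * (K * (C5 / \<Lambda> ^ (2 * q - codim)))"
      by (simp only: ring_distribs mult_ac)
    also have "\<dots> \<le> \<eta> / 3"
    proof -
      have "A = \<eta> / 6 \<Longrightarrow> B \<le> \<eta> / 6 \<Longrightarrow> A + B \<le> \<eta> / 3" for A B :: real by simp
      then show ?thesis using \<delta>(2) \<Lambda> by blast
    qed
    finally show ?thesis .
  qed
  have "prob E \<le> prob (\<Union>i\<in>{..L}. \<Union>C\<in>cells (n i). EV i C) +
      (prob (\<Union>i\<in>{..<L}. \<Union>C\<in>cells (n i). EG i C) + prob (\<Union>c\<in>cells n'. EB c))"
    unfolding E_def
    by (intro order_trans[OF measure_Un_le] add_left_mono measure_Un_le sets.Un mUN sets.finite_UN EV_meas EG_meas EB_meas) auto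
  then have PE: "prob E \<le> \<eta>" using PV PG PB by simp
  \<comment> \<open>One null set serves all grid points, because their indices form a countable
    type.\<close>
  have "AE \<omega> in M. \<forall>l n i. l < m \<longrightarrow> v (pt \<gamma> (a l) (b l) n i) \<omega> =
      N {0..<2^\<nu>} (pt \<gamma> (a l) (b l) n i) \<omega> + N {2^\<nu>..} (pt \<gamma> (a l) (b l) n i) \<omega>"
    unfolding AE_all_countable
  proof (intro allI)
    fix l n i
    show "AE \<omega> in M. l < m \<longrightarrow> v (pt \<gamma> (a l) (b l) n i) \<omega> =
      N {0..<2^\<nu>} (pt \<gamma> (a l) (b l) n i) \<omega> + N {2^\<nu>..} (pt \<gamma> (a l) (b l) n i) \<omega>"
    proof (cases "l < m")
      case True
      have u: "{0..<2^\<nu>} \<union> {2^\<nu>..} = {0::real..}" by (auto intro: order_trans[of 0 "2^\<nu>"])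
      have "AE \<omega> in M. N ({0..<2^\<nu>} \<union> {2^\<nu>..}) (pt \<gamma> (a l) (b l) n i) \<omega> =
          N {0..<2^\<nu>} (pt \<gamma> (a l) (b l) n i) \<omega> + N {2^\<nu>..} (pt \<gamma> (a l) (b l) n i) \<omega>"
        by (rule N_add) (use pt_T[OF True] in auto)
      with N_v[OF pt_T[OF True, of n i]] show ?thesis unfolding u by eventually_elim simp
    qed simp
  qed
  moreover have "AE \<omega> in M. \<omega> \<in> space M" by simp
  ultimately have "AE \<omega> in M. (\<exists>xs. (\<forall>l<m. xs l \<in> cbox (a l) (b l)) \<and> (\<forall>l<m. v (xs l) \<omega> = v (xs 0) \<omega>)) \<longrightarrow> \<omega> \<in> E"
    using v
  proof eventually_elim
    case (elim \<omega>)
    show ?case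
    proof (intro impI, elim exE conjE)
      fix xs assume xs: "\<forall>l<m. xs l \<in> cbox (a l) (b l)" "\<forall>l<m. v (xs l) \<omega> = v (xs 0) \<omega>"
      define cc where "cc i = (\<lambda>l\<in>{..<m}. idx \<gamma> (a l) (b l) (n i) (xs l))" for i
      have cc: "cc i \<in> cells (n i)" for i
        using idx_bounds(1)[OF ab] xs(1) by (auto simp: cc_def cells_def)
      have cc_co: "coT (n i) (n j) (cc j) = cc i" if "i \<le> j" for i j
        using n_mono[OF that] xs(1) by (auto simp: coT_def cc_def idx_coarsen fun_eq_iff)
      show "\<omega> \<in> E"
      proof (rule ccontr)
        assume nE: "\<omega> \<notin> E"
        have oV: "oscf (\<lambda>x. N {0..<2^\<nu>} x \<omega>) (n i) (cc i) (\<epsilon> * w i)" if "i \<le> L" for i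
        proof (rule ccontr)
          assume "\<not> ?thesis"
          then have "\<omega> \<in> EV i (cc i)" using elim(2) by (simp add: EV_def)
          then have "\<omega> \<in> (\<Union>i\<in>{..L}. \<Union>C\<in>cells (n i). EV i C)"
            using that cc[of i] by (intro UN_I[of i] UN_I[of "cc i"]) auto
          then show False using nE by (simp add: E_def)
        qed
        have inc: "\<bar>N {0..<2^\<nu>} (pt \<gamma> (a l) (b l) (n i) (cc i l)) \<omega> $ e - N {0..<2^\<nu>} (pt \<gamma> (a 0) (b 0) (n i) (cc i 0)) \<omega> $ e +
            (N {2^\<nu>..} (pt \<gamma> (a l) (b l) (n i) (cc i l)) \<omega> $ e - N {2^\<nu>..} (pt \<gamma> (a 0) (b 0) (n i) (cc i 0)) \<omega> $ e)\<bar>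
            \<le> 2 * (\<epsilon> * w i + \<delta>')"
          if "i \<le> L" "oscf (\<lambda>x. N {2^\<nu>..} x \<omega>) (n i) (cc i) \<delta>'" "l < m" for i \<delta>' l e
        proof (rule level_set_hit[where xs = xs and v = "\<lambda>x. v x \<omega>", OF _ _ elim(3) _ _ oV[OF that(1)] that(2,3)])
          show "xs l \<in> cbox (a l) (b l)" "v (xs l) \<omega> = v (xs 0) \<omega>" if "l < m" for l
            using xs that by blast+
          show "v (pt \<gamma> (a l) (b l) n i) \<omega> = N {0..<2^\<nu>} (pt \<gamma> (a l) (b l) n i) \<omega> + N {2^\<nu>..} (pt \<gamma> (a l) (b l) n i) \<omega>"
            if "l < m" for l n i using elim(1) that by blast
        qed (simp add: cc_def)
        show False
        proof (cases "\<exists>i<L. good i (cc i) (U \<omega>)")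
          case True
          \<comment> \<open>Minimality makes the tuple of \<open>xs\<close> at this scale a selected
            one, hence one that \<open>EG\<close> accounts for.\<close>
          define i where "i = (LEAST i. i < L \<and> good i (cc i) (U \<omega>))"
          have i: "i < L" "good i (cc i) (U \<omega>)"
            using LeastI_ex[of "\<lambda>i. i < L \<and> good i (cc i) (U \<omega>)"] True by (auto simp: i_def)
          have "\<not> good i' (cc i') (U \<omega>)" if "i' < i" for i'
            using not_less_Least[of i' "\<lambda>i. i < L \<and> good i (cc i) (U \<omega>)"] that i(1) by (auto simp: i_def)
          then have s: "sel i (cc i) (U \<omega>)" using i cc_co by (auto simp: sel_def)
          have o: "oscf (\<lambda>x. N {2^\<nu>..} x \<omega>) (n i) (cc i) (\<epsilon> * w i)"
            using i by (simp add: good_def U_def oscf_restrict)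
          have "\<omega> \<in> EG i (cc i)"
            unfolding EG_def hit_def
          proof (intro CollectI conjI elim(2) ballI, goal_cases)
            case 1 then show ?case using s by (simp add: U_def)
          next
            case (2 p)
            obtain l e where p: "p = (l, e)" by force
            have l: "l < m" using 2 p by (auto simp: hitset_def)
            have "\<epsilon> * w i + \<epsilon> * w i = 2 * \<epsilon> * w i" by simp
            then have "2 * (\<epsilon> * w i + \<epsilon> * w i) = 4 * \<epsilon> * w i" by simp
            then show ?case
              unfolding p prod.case using inc[OF less_imp_le[OF i(1)] o l, of e]
              by (intro ennreal_leI power_mono) auto
          qed
          then have "\<omega> \<in> (\<Union>i\<in>{..<L}. \<Union>C\<in>cells (n i). EG i C)"
            using i(1) cc[of i] by (intro UN_I[of i] UN_I[of "cc i"]) auto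
          then show False using nE by (simp add: E_def)
        next
          case False
          have wL: "w L = 2 powr - real n'" by (simp add: w_def n'_def)
          have b: "bad (cc L) (U \<omega>)"
            using False cc_co[OF less_imp_le] unfolding bad_def n'_def by auto
          have "\<omega> \<in> EB (cc L)"
            unfolding EB_def hit_def
          proof (intro CollectI conjI elim(2) ballI, goal_cases)
            case 1 then show ?case using b by (simp add: U_def)
          next
            case (2 p)
            obtain l e where p: "p = (l, e)" by force
            have l: "l < m" using 2 p by (auto simp: hitset_def)
            show ?case
            proof (cases "chain_norm q (\<lambda>x. N {2^\<nu>..} x \<omega>) n' (cc L)")
              \<comment> \<open>An infinite chaining norm makes the radius infinite and the hit
                automatic.\<close>
              case top
              then show ?thesis by (simp add: \<rho>_def chain_norm_restrict ennreal_mult_top)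
            next
              case (real r)
              define y where "y = root (2 * q) r"
              have q0: "0 < q" using q by simp
              have y: "0 \<le> y" "y ^ (2 * q) = r" using real q0 by (auto simp: y_def)
              have o: "oscf (\<lambda>x. N {2^\<nu>..} x \<omega>) (n L) (cc L) (8 * y)"
                using real y q0 by (intro chain_norm_oscf[where q = q]) (auto simp: n'_def)
              have "\<bar>N {0..<2^\<nu>} (pt \<gamma> (a l) (b l) n' (cc L l)) \<omega> $ e - N {0..<2^\<nu>} (pt \<gamma> (a 0) (b 0) n' (cc L 0)) \<omega> $ e +
                (N {2^\<nu>..} (pt \<gamma> (a l) (b l) n' (cc L l)) \<omega> $ e - N {2^\<nu>..} (pt \<gamma> (a 0) (b 0) n' (cc L 0)) \<omega> $ e)\<bar> ^ (2 * q)
                \<le> (4 * max (8 * y) (\<epsilon> * w L)) ^ (2 * q)"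
                using inc[OF order_refl o l, of e] by (intro power_mono) (auto simp: n'_def)
              \<comment> \<open>The power of a maximum is at most the sum of the powers; this keeps
                \<open>\<rho>\<close> linear in the chaining norm.\<close>
              also have "\<dots> \<le> 4 ^ (2 * q) * (8 ^ (2 * q) * r + (\<epsilon> * w L) ^ (2 * q))"
              proof -
                have nn: "0 \<le> (8 * y) ^ (2 * q)" "0 \<le> (\<epsilon> * w L) ^ (2 * q)" using y \<epsilon> w[of L] by auto
                have "(max (8 * y) (\<epsilon> * w L)) ^ (2 * q) \<le> (8 * y) ^ (2 * q) + (\<epsilon> * w L) ^ (2 * q)"
                  using nn by (auto simp: max_def)
                then show ?thesis
                  unfolding power_mult_distrib[of 4] using y(2)
                  by (intro mult_left_mono) (auto simp: power_mult_distrib[of 8])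
              qed
              finally have "ennreal (\<bar>N {0..<2^\<nu>} (pt \<gamma> (a l) (b l) n' (cc L l)) \<omega> $ e - N {0..<2^\<nu>} (pt \<gamma> (a 0) (b 0) n' (cc L 0)) \<omega> $ e +
                (N {2^\<nu>..} (pt \<gamma> (a l) (b l) n' (cc L l)) \<omega> $ e - N {2^\<nu>..} (pt \<gamma> (a 0) (b 0) n' (cc L 0)) \<omega> $ e)\<bar> ^ (2 * q))
                \<le> ennreal (4 ^ (2 * q) * (8 ^ (2 * q) * r + (\<epsilon> * w L) ^ (2 * q)))"
                by (rule ennreal_leI)
              also have "\<dots> = \<rho> (cc L) (restrict (\<lambda>x. N {2^\<nu>..} x \<omega>) T)"
                using real \<epsilon> w[of L] unfolding \<rho>_def chain_norm_restrict wL[symmetric]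
                by (simp add: ennreal_mult' ennreal_plus)
              finally show ?thesis unfolding p prod.case .
            qed
          qed
          then have "\<omega> \<in> (\<Union>c\<in>cells n'. EB c)"
            using cc[of L] by (intro UN_I[of "cc L"]) (auto simp: n'_def)
          then show False using nE by (simp add: E_def)
        qed
      qed
    qed
  qed
  with E_meas PE show ?thesis by (rule that)
qed

text \<open>The outcomes with a coincidence form an uncountable union that is never shown to be
  measurable. They are enclosed in measurable events of arbitrarily small probability, whose
  intersection is null.\<close>

lemma no_hit:
  assumes "AE \<omega> in M. continuous_on UNIV (\<lambda>x. v x \<omega>)"
    and "\<And>x. x \<in> T \<Longrightarrow> AE \<omega> in M. N {0..} x \<omega> = v x \<omega>"
  shows "AE \<omega> in M. \<not> (\<exists>xs. (\<forall>l<m. xs l \<in> cbox (a l) (b l)) \<and> (\<forall>l<m. v (xs l) \<omega> = v (xs 0) \<omega>))"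
proof -
  define H where "H \<omega> \<longleftrightarrow> (\<exists>xs. (\<forall>l<m. xs l \<in> cbox (a l) (b l)) \<and> (\<forall>l<m. v (xs l) \<omega> = v (xs 0) \<omega>))" for \<omega>
  have "\<exists>E. E \<in> events \<and> prob E \<le> 1 / real (Suc i) \<and> (AE \<omega> in M. H \<omega> \<longrightarrow> \<omega> \<in> E)" for i
  proof -
    have "0 < 1 / real (Suc i)" by simp
    from no_hit_aux[OF assms this] obtain E where "E \<in> events" "prob E \<le> 1 / real (Suc i)" "AE \<omega> in M. H \<omega> \<longrightarrow> \<omega> \<in> E"
      unfolding H_def .
    then show ?thesis by blast
  qed
  then obtain E where E: "\<And>i. E i \<in> events" "\<And>i. prob (E i) \<le> 1 / real (Suc i)" "\<And>i. AE \<omega> in M. H \<omega> \<longrightarrow> \<omega> \<in> E i"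
    by metis
  have I: "(\<Inter>i. E i) \<in> events" using E(1) by (intro sets.countable_INT) auto
  have le: "prob (\<Inter>i. E i) \<le> inverse (real (Suc i))" for i
  proof -
    have "prob (\<Inter>i. E i) \<le> prob (E i)" using E(1) by (intro finite_measure_mono) auto
    then show ?thesis using E(2)[of i] by (simp add: inverse_eq_divide)
  qed
  have "prob (\<Inter>i. E i) \<le> 0"
    by (rule LIMSEQ_le_const[OF LIMSEQ_inverse_real_of_nat]) (use le in blast)
  then have "prob (\<Inter>i. E i) = 0" by (simp only: measure_le_0_iff)
  then have "(\<Inter>i. E i) \<in> null_sets M" using I by (simp add: emeasure_eq_measure null_sets_def)
  then have "AE \<omega> in M. \<omega> \<notin> (\<Inter>i. E i)" by (rule AE_not_in)
  moreover have "AE \<omega> in M. \<forall>i. H \<omega> \<longrightarrow> \<omega> \<in> E i"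
    unfolding AE_all_countable using E(3) by blast
  ultimately have "AE \<omega> in M. \<not> H \<omega>" by eventually_elim blast
  then show ?thesis by (simp add: H_def)
qed

end

subsection \<open>Frame bounds and countably many boxes\<close>

context gaussian_space
begin

lemma integrable_mult:
  assumes "f \<in> G" "h \<in> G"
  shows "integrable M (\<lambda>\<omega>. f \<omega> * h \<omega>)"
proof -
  have "integrable M (\<lambda>\<omega>. ((f \<omega> + h \<omega>)\<^sup>2 - (f \<omega>)\<^sup>2 - (h \<omega>)\<^sup>2) / 2)"
    using integrable_square add assms by (intro integrable_divide Bochner_Integration.integrable_diff) auto
  then show ?thesis by (simp add: power2_eq_square algebra_simps)
qed

lemma var_sum_orthogonal:
  assumes "f \<in> G" "h \<in> G" "(\<integral>\<omega>. f \<omega> * h \<omega> \<partial>M) = 0"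
  shows "(\<integral>\<omega>. (f \<omega> + h \<omega>)\<^sup>2 \<partial>M) = (\<integral>\<omega>. (f \<omega>)\<^sup>2 \<partial>M) + (\<integral>\<omega>. (h \<omega>)\<^sup>2 \<partial>M)"
proof -
  have "(\<integral>\<omega>. (f \<omega> + h \<omega>)\<^sup>2 \<partial>M) = (\<integral>\<omega>. ((f \<omega>)\<^sup>2 + (h \<omega>)\<^sup>2) + 2 * (f \<omega> * h \<omega>) \<partial>M)"
    by (simp add: power2_sum mult.assoc)
  also have "\<dots> = (\<integral>\<omega>. (f \<omega>)\<^sup>2 \<partial>M) + (\<integral>\<omega>. (h \<omega>)\<^sup>2 \<partial>M) + 2 * (\<integral>\<omega>. f \<omega> * h \<omega> \<partial>M)"
    using assms integrable_square integrable_mult by simp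
  finally show ?thesis using assms(3) by simp
qed

text \<open>One vector is projected out at each step of the induction.\<close>

lemma lower_frame_bound:
  assumes "finite S" "\<And>s. s \<in> S \<Longrightarrow> X s \<in> G"
    and "\<And>c. \<exists>s\<in>S. c s \<noteq> 0 \<Longrightarrow> (\<integral>\<omega>. (\<Sum>s\<in>S. c s * X s \<omega>)\<^sup>2 \<partial>M) \<noteq> 0"
  shows "\<exists>\<kappa>>0. \<forall>c. \<kappa> * (\<Sum>s\<in>S. (c s)\<^sup>2) \<le> (\<integral>\<omega>. (\<Sum>s\<in>S. c s * X s \<omega>)\<^sup>2 \<partial>M)"
  using assms
proof (induction S arbitrary: X rule: finite_induct)
  case empty
  then show ?case by (intro exI[of _ 1]) simp
next
  case (insert s S)
  have XG: "X r \<in> G" if "r \<in> insert s S" for r using insert.prems(1) that .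
  define p where "p = (\<integral>\<omega>. (X s \<omega>)\<^sup>2 \<partial>M)"
  have p: "0 < p"
  proof -
    have "(\<Sum>r\<in>insert s S. (if r = s then 1 else 0) * X r \<omega>) = X s \<omega>" for \<omega>
      using insert.hyps by (simp add: sum.neutral)
    then have "p \<noteq> 0" using insert.prems(2)[of "\<lambda>r. if r = s then 1 else 0"] by (simp add: p_def)
    moreover have "0 \<le> p" by (simp add: p_def)
    ultimately show ?thesis by simp
  qed
  define u where "u r = (\<integral>\<omega>. X r \<omega> * X s \<omega> \<partial>M) / p" for r
  define X' where "X' r = (\<lambda>\<omega>. X r \<omega> - u r * X s \<omega>)" for r
  have X'G: "X' r \<in> G" if "r \<in> S" for r
    unfolding X'_def using XG that by (intro diff scale) auto
  have orth: "(\<integral>\<omega>. X' r \<omega> * X s \<omega> \<partial>M) = 0" if "r \<in> S" for r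
  proof -
    have "(\<integral>\<omega>. X' r \<omega> * X s \<omega> \<partial>M) = (\<integral>\<omega>. X r \<omega> * X s \<omega> - u r * (X s \<omega>)\<^sup>2 \<partial>M)"
      by (simp add: X'_def power2_eq_square algebra_simps)
    also have "\<dots> = (\<integral>\<omega>. X r \<omega> * X s \<omega> \<partial>M) - u r * p"
      using XG that integrable_square integrable_mult by (simp add: p_def)
    finally show ?thesis using p by (simp add: u_def)
  qed
  \<comment> \<open>The \<open>X' r\<close> are the residuals after projection onto
    \<open>X s\<close>; the coefficient of \<open>X s\<close> collects the projected parts.\<close>
  have dec: "(\<integral>\<omega>. (\<Sum>r\<in>insert s S. c r * X r \<omega>)\<^sup>2 \<partial>M) =
      (\<integral>\<omega>. (\<Sum>r\<in>S. c r * X' r \<omega>)\<^sup>2 \<partial>M) + (c s + (\<Sum>r\<in>S. c r * u r))\<^sup>2 * p" for c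
  proof -
    define d where "d = c s + (\<Sum>r\<in>S. c r * u r)"
    have "(\<Sum>r\<in>insert s S. c r * X r \<omega>) = (\<Sum>r\<in>S. c r * X' r \<omega>) + d * X s \<omega>" for \<omega>
      using insert.hyps by (simp add: X'_def d_def sum_subtractf right_diff_distrib distrib_right sum_distrib_right mult.assoc)
    moreover have "(\<integral>\<omega>. (\<Sum>r\<in>S. c r * X' r \<omega>) * (d * X s \<omega>) \<partial>M) = 0"
    proof -
      have "(\<integral>\<omega>. (\<Sum>r\<in>S. c r * X' r \<omega>) * (d * X s \<omega>) \<partial>M) = (\<integral>\<omega>. (\<Sum>r\<in>S. (c r * d) * (X' r \<omega> * X s \<omega>)) \<partial>M)"
      proof -
        have "(\<Sum>r\<in>S. c r * X' r \<omega>) * (d * X s \<omega>) = (\<Sum>r\<in>S. (c r * d) * (X' r \<omega> * X s \<omega>))" for \<omega>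
          unfolding sum_distrib_right by (intro sum.cong refl) (simp only: mult_ac)
        then show ?thesis by simp
      qed
      also have "\<dots> = (\<Sum>r\<in>S. (c r * d) * (\<integral>\<omega>. X' r \<omega> * X s \<omega> \<partial>M))"
        using X'G XG by (subst Bochner_Integration.integral_sum) (auto intro!: integrable_mult)
      also have "\<dots> = 0" using orth by simp
      finally show ?thesis .
    qed
    ultimately have "(\<integral>\<omega>. (\<Sum>r\<in>insert s S. c r * X r \<omega>)\<^sup>2 \<partial>M) =
        (\<integral>\<omega>. (\<Sum>r\<in>S. c r * X' r \<omega>)\<^sup>2 \<partial>M) + (\<integral>\<omega>. (d * X s \<omega>)\<^sup>2 \<partial>M)"
      using var_sum_orthogonal[OF lincomb[of S X' c] scale[of "X s" d]] X'G XG by simp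
    then show ?thesis by (simp add: power_mult_distrib p_def d_def)
  qed
  have "\<exists>\<kappa>>0. \<forall>c. \<kappa> * (\<Sum>r\<in>S. (c r)\<^sup>2) \<le> (\<integral>\<omega>. (\<Sum>r\<in>S. c r * X' r \<omega>)\<^sup>2 \<partial>M)"
  proof (rule insert.IH[OF X'G])
    fix c :: "_ \<Rightarrow> real" assume c: "\<exists>r\<in>S. c r \<noteq> 0"
    \<comment> \<open>The coefficient at \<open>s\<close> cancels the projected parts, so
      nondegeneracy passes to the residuals.\<close>
    define c' where "c' = c(s := - (\<Sum>r\<in>S. c r * u r))"
    have c'S: "c' r = c r" if "r \<in> S" for r using that insert.hyps by (auto simp: c'_def)
    have "(\<integral>\<omega>. (\<Sum>r\<in>insert s S. c' r * X r \<omega>)\<^sup>2 \<partial>M) \<noteq> 0"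
      using c c'S by (intro insert.prems(2)) fastforce
    then show "(\<integral>\<omega>. (\<Sum>r\<in>S. c r * X' r \<omega>)\<^sup>2 \<partial>M) \<noteq> 0"
      unfolding dec using c'S by (simp add: c'_def[THEN fun_cong, of s])
  qed
  then obtain \<kappa> where \<kappa>: "0 < \<kappa>" "\<And>c. \<kappa> * (\<Sum>r\<in>S. (c r)\<^sup>2) \<le> (\<integral>\<omega>. (\<Sum>r\<in>S. c r * X' r \<omega>)\<^sup>2 \<partial>M)"
    by blast
  \<comment> \<open>\<open>B\<close> measures, through Cauchy-Schwarz, how much of
    \<open>c s\<close> the projected parts \<open>y\<close> can hide: \<open>(c s)^2\<close> is at
    most \<open>2 * d^2 + 2 * y^2\<close>, with \<open>y^2\<close> at most
    \<open>C * B\<close>.\<close>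
  define B where "B = (\<Sum>r\<in>S. (u r)\<^sup>2)"
  have B: "0 \<le> B" by (simp add: B_def sum_nonneg)
  define \<kappa>' where "\<kappa>' = min (\<kappa> / (1 + 2 * B)) (p / 2)"
  have \<kappa>': "0 < \<kappa>'" "\<kappa>' * (1 + 2 * B) \<le> \<kappa>" "2 * \<kappa>' \<le> p"
  proof -
    show "0 < \<kappa>'" using \<kappa> B p by (simp add: \<kappa>'_def)
    have "\<kappa>' \<le> \<kappa> / (1 + 2 * B)" unfolding \<kappa>'_def by (rule min.cobounded1)
    then show "\<kappa>' * (1 + 2 * B) \<le> \<kappa>" using B by (simp add: pos_le_divide_eq)
    have "\<kappa>' \<le> p / 2" unfolding \<kappa>'_def by (rule min.cobounded2)
    then show "2 * \<kappa>' \<le> p" by simp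
  qed
  have "\<kappa>' * (\<Sum>r\<in>insert s S. (c r)\<^sup>2) \<le> (\<integral>\<omega>. (\<Sum>r\<in>insert s S. c r * X r \<omega>)\<^sup>2 \<partial>M)" for c
  proof -
    define C where "C = (\<Sum>r\<in>S. (c r)\<^sup>2)"
    define y where "y = (\<Sum>r\<in>S. c r * u r)"
    define d where "d = c s + y"
    have C: "0 \<le> C" by (simp add: C_def sum_nonneg)
    have y2: "y\<^sup>2 \<le> C * B" unfolding y_def C_def B_def by (rule Cauchy_Schwarz_ineq_sum)
    have "(c s)\<^sup>2 \<le> 2 * d\<^sup>2 + 2 * y\<^sup>2"
    proof -
      have "0 \<le> (c s + 2 * y)\<^sup>2" by simp
      then show ?thesis by (simp add: d_def power2_eq_square algebra_simps)
    qed
    then have "(c s)\<^sup>2 + C \<le> 2 * d\<^sup>2 + (1 + 2 * B) * C" using y2 by (simp add: algebra_simps)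
    then have "\<kappa>' * ((c s)\<^sup>2 + C) \<le> \<kappa>' * (2 * d\<^sup>2 + (1 + 2 * B) * C)"
      using \<kappa>'(1) by (intro mult_left_mono) auto
    also have "\<dots> = (2 * \<kappa>') * d\<^sup>2 + (\<kappa>' * (1 + 2 * B)) * C" by (simp add: algebra_simps)
    also have "\<dots> \<le> p * d\<^sup>2 + \<kappa> * C" using \<kappa>' C by (intro add_mono mult_right_mono) auto
    also have "\<dots> \<le> (\<integral>\<omega>. (\<Sum>r\<in>S. c r * X' r \<omega>)\<^sup>2 \<partial>M) + d\<^sup>2 * p"
      using \<kappa>(2)[of c] by (simp add: C_def mult.commute)
    finally show ?thesis
      using insert.hyps unfolding dec by (simp add: C_def d_def y_def)
  qed
  then show ?case using \<kappa>'(1) by blast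
qed

lemma component_le_L2norm:
  fixes X :: "'w \<Rightarrow> real^'n"
  assumes "\<And>i. (\<lambda>\<omega>. X \<omega> $ i) \<in> G"
  shows "(\<integral>\<omega>. (X \<omega> $ i)\<^sup>2 \<partial>M) \<le> (L2norm M X)\<^sup>2"
proof -
  have n: "(norm (X \<omega>))\<^sup>2 = (\<Sum>i\<in>UNIV. (X \<omega> $ i)\<^sup>2)" for \<omega>
    unfolding power2_norm_eq_inner inner_vec_def by (simp add: power2_eq_square)
  have "(\<integral>\<omega>. (X \<omega> $ i)\<^sup>2 \<partial>M) \<le> (\<integral>\<omega>. (norm (X \<omega>))\<^sup>2 \<partial>M)"
    unfolding n using assms integrable_square
    by (intro integral_mono Bochner_Integration.integrable_sum member_le_sum) auto
  also have "\<dots> = (L2norm M X)\<^sup>2"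
    by (simp add: L2norm_def)
  finally show ?thesis .
qed

end

section \<open>The linear span of a Gaussian family\<close>

definition gspan :: "'i set \<Rightarrow> ('i \<Rightarrow> 'w \<Rightarrow> real) \<Rightarrow> ('w \<Rightarrow> real) set" where
  "gspan I X = {f. \<exists>F c. finite F \<and> F \<subseteq> I \<and> f = (\<lambda>\<omega>. \<Sum>i\<in>F. c i * X i \<omega>)}"

lemma gspanI:
  assumes "finite F" "F \<subseteq> I" "\<And>\<omega>. f \<omega> = (\<Sum>i\<in>F. c i * X i \<omega>)"
  shows "f \<in> gspan I X"
  unfolding gspan_def using assms(1,2)
  by (intro CollectI exI[of _ F] exI[of _ c] conjI ext assms(3))

lemma gspanD:
  assumes "f \<in> gspan I X"
  shows "\<exists>F c. finite F \<and> F \<subseteq> I \<and> (\<forall>\<omega>. f \<omega> = (\<Sum>i\<in>F. c i * X i \<omega>))"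
  using assms unfolding gspan_def by blast

lemma gspan_base: "i \<in> I \<Longrightarrow> X i \<in> gspan I X"
  by (rule gspanI[of "{i}" _ _ "\<lambda>_. 1"]) auto

lemma gspan_gaussian_space:
  assumes "prob_space M" "centered_gaussian_family M I X"
  shows "gaussian_space M (gspan I X)"
proof -
  interpret prob_space M by fact
  show ?thesis
  proof
    show "centered_gaussian_rv M f" if f: "f \<in> gspan I X" for f
    proof -
      obtain F c where F: "finite F" "F \<subseteq> I" "\<And>\<omega>. f \<omega> = (\<Sum>i\<in>F. c i * X i \<omega>)" using gspanD[OF f] by blast
      then have "f = (\<lambda>\<omega>. \<Sum>i\<in>F. c i * X i \<omega>)" by (intro ext)
      then show ?thesis using assms(2) F(1,2) unfolding centered_gaussian_family_def by simp
    qed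
    show "(\<lambda>\<omega>. 0) \<in> gspan I X"
      by (rule gspanI[of "{}"]) auto
    show "(\<lambda>\<omega>. f \<omega> + g \<omega>) \<in> gspan I X" if f: "f \<in> gspan I X" and g: "g \<in> gspan I X" for f g
    proof -
      obtain F c where F: "finite F" "F \<subseteq> I" "\<And>\<omega>. f \<omega> = (\<Sum>i\<in>F. c i * X i \<omega>)" using gspanD[OF f] by blast
      obtain F' c' where F': "finite F'" "F' \<subseteq> I" "\<And>\<omega>. g \<omega> = (\<Sum>i\<in>F'. c' i * X i \<omega>)" using gspanD[OF g] by blast
      have e: "(\<Sum>i\<in>F \<union> F'. (if i \<in> F then c i else 0) * X i \<omega>) = f \<omega>" for \<omega>
        unfolding F(3) using F(1) F'(1) by (intro sum.mono_neutral_cong_right) auto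
      have e': "(\<Sum>i\<in>F \<union> F'. (if i \<in> F' then c' i else 0) * X i \<omega>) = g \<omega>" for \<omega>
        unfolding F'(3) using F(1) F'(1) by (intro sum.mono_neutral_cong_right) auto
      show ?thesis
      proof (rule gspanI)
        show "finite (F \<union> F')" "F \<union> F' \<subseteq> I" using F(1,2) F'(1,2) by auto
        show "f \<omega> + g \<omega> = (\<Sum>i\<in>F \<union> F'. ((if i \<in> F then c i else 0) + (if i \<in> F' then c' i else 0)) * X i \<omega>)" for \<omega>
          unfolding distrib_right sum.distrib e e' ..
      qed
    qed
    show "(\<lambda>\<omega>. k * f \<omega>) \<in> gspan I X" if f: "f \<in> gspan I X" for f k
    proof -
      obtain F c where F: "finite F" "F \<subseteq> I" "\<And>\<omega>. f \<omega> = (\<Sum>i\<in>F. c i * X i \<omega>)" using gspanD[OF f] by blast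
      show ?thesis
      proof (rule gspanI[OF F(1,2)])
        show "k * f \<omega> = (\<Sum>i\<in>F. (k * c i) * X i \<omega>)" for \<omega>
          unfolding F(3) sum_distrib_left mult.assoc ..
      qed
    qed
  qed
qed

text \<open>Such boxes form a countable family that also reaches points on the boundary of the given box.\<close>

lemma rational_subbox:
  fixes p q x :: "real^'k"
  assumes "\<And>j. p$j < q$j" "x \<in> cbox p q" "0 < e"
  obtains a b where "\<And>j. a$j \<in> insert (p$j) \<rat>" "\<And>j. b$j \<in> insert (q$j) \<rat>" "\<And>j. a$j < b$j"
    "x \<in> cbox a b" "cbox a b \<subseteq> cbox p q" "\<And>y j. y \<in> cbox a b \<Longrightarrow> \<bar>y$j - x$j\<bar> < e"
proof -
  have x: "p$j \<le> x$j" "x$j \<le> q$j" for j using assms(2) by (auto simp: mem_box_cart)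
  have "\<exists>r. r \<in> insert (p$j) \<rat> \<and> p$j \<le> r \<and> r \<le> x$j \<and> x$j - e < r \<and> (r = x$j \<longrightarrow> x$j = p$j)" for j
  proof (cases "x$j = p$j")
    case False
    then have "max (p$j) (x$j - e) < x$j" using x[of j] assms(3) by simp
    then obtain r where "r \<in> \<rat>" "max (p$j) (x$j - e) < r" "r < x$j" using Rats_dense_in_real by blast
    then show ?thesis by (intro exI[of _ r]) auto
  qed (use assms(3) in auto)
  then obtain a' where a': "\<And>j. a' j \<in> insert (p$j) \<rat> \<and> p$j \<le> a' j \<and> a' j \<le> x$j \<and> x$j - e < a' j \<and> (a' j = x$j \<longrightarrow> x$j = p$j)"
    by metis
  have "\<exists>r. r \<in> insert (q$j) \<rat> \<and> r \<le> q$j \<and> x$j \<le> r \<and> r < x$j + e \<and> (r = x$j \<longrightarrow> x$j = q$j)" for j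
  proof (cases "x$j = q$j")
    case False
    then have "x$j < min (q$j) (x$j + e)" using x[of j] assms(3) by simp
    then obtain r where "r \<in> \<rat>" "r < min (q$j) (x$j + e)" "x$j < r" using Rats_dense_in_real by blast
    then show ?thesis by (intro exI[of _ r]) auto
  qed (use assms(3) in auto)
  then obtain b' where b': "\<And>j. b' j \<in> insert (q$j) \<rat> \<and> b' j \<le> q$j \<and> x$j \<le> b' j \<and> b' j < x$j + e \<and> (b' j = x$j \<longrightarrow> x$j = q$j)"
    by metis
  show ?thesis
  proof (rule that[of "\<chi> j. a' j" "\<chi> j. b' j"])
    show "(\<chi> j. a' j) $ j \<in> insert (p$j) \<rat>" "(\<chi> j. b' j) $ j \<in> insert (q$j) \<rat>" for j using a' b' by simp_all
    show "(\<chi> j. a' j) $ j < (\<chi> j. b' j) $ j" for j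
    proof -
      have "a' j \<le> x$j" "x$j \<le> b' j" using a' b' by auto
      moreover have "\<not> (a' j = x$j \<and> b' j = x$j)" using a'[of j] b'[of j] assms(1)[of j] by auto
      ultimately have "a' j < b' j" by linarith
      then show ?thesis by simp
    qed
    show "x \<in> cbox (\<chi> j. a' j) (\<chi> j. b' j)" using a' b' by (simp add: mem_box_cart)
    show "cbox (\<chi> j. a' j) (\<chi> j. b' j) \<subseteq> cbox p q"
    proof
      fix y assume "y \<in> cbox (\<chi> j. a' j) (\<chi> j. b' j)"
      then have y: "a' j \<le> y$j" "y$j \<le> b' j" for j by (simp_all add: mem_box_cart)
      have "p$j \<le> y$j \<and> y$j \<le> q$j" for j
        using conjunct1[OF conjunct2[OF a'[of j]]] conjunct1[OF conjunct2[OF b'[of j]]] y[of j] by linarith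
      then show "y \<in> cbox p q" by (simp add: mem_box_cart)
    qed
    fix y j assume "y \<in> cbox (\<chi> j. a' j) (\<chi> j. b' j)"
    then have "a' j \<le> y$j" "y$j \<le> b' j" by (simp_all add: mem_box_cart)
    moreover have "x$j - e < a' j" "b' j < x$j + e" using a' b' by blast+
    ultimately show "\<bar>y$j - x$j\<bar> < e" by linarith
  qed
qed

lemma countable_vec:
  fixes C :: "'k::finite \<Rightarrow> real set"
  assumes "\<And>j. countable (C j)"
  shows "countable {x :: real^'k. \<forall>j. x$j \<in> C j}"
proof (rule countable_subset)
  show "{x :: real^'k. \<forall>j. x$j \<in> C j} \<subseteq> (\<lambda>f. \<chi> j. f j) ` (\<Pi>\<^sub>E j\<in>UNIV. C j)"
  proof
    fix x :: "real^'k" assume "x \<in> {x. \<forall>j. x$j \<in> C j}"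
    then have "vec_nth x \<in> (\<Pi>\<^sub>E j\<in>UNIV. C j)" by auto
    moreover have "x = (\<chi> j. vec_nth x j)" by simp
    ultimately show "x \<in> (\<lambda>f. \<chi> j. f j) ` (\<Pi>\<^sub>E j\<in>UNIV. C j)" by blast
  qed
  show "countable ((\<lambda>f. \<chi> j. f j :: real^'k) ` (\<Pi>\<^sub>E j\<in>UNIV. C j))"
    using assms by (intro countable_image countable_PiE) auto
qed

subsection \<open>From the noise representation to boxes\<close>

locale noise_field = prob_space M for M :: "'w measure" +
  fixes v :: "real^'k \<Rightarrow> 'w \<Rightarrow> real^'d"
    and T :: "(real^'k) set"
    and N :: "real set \<Rightarrow> real^'k \<Rightarrow> 'w \<Rightarrow> real^'d"
    and \<gamma> :: "'k \<Rightarrow> real"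
    and m :: nat
  assumes field: "centered_cont_gaussian_field_iid M v"
    and m2: "m \<ge> 2"
    and assm1: "assumption1 M v T N \<gamma>"
    and assm3: "assumption3 M v T m"
    and crit: "real m * Qdim \<gamma> \<le> real (m - 1) * real CARD('d)"
begin

text \<open>The span of the noise alone; the field \<open>v\<close> is represented in it by
  \<open>N {0..}\<close>, which agrees with \<open>v\<close> almost surely at each point of
  \<open>T\<close>.\<close>

definition G :: "('w \<Rightarrow> real) set" where
  "G = gspan {(A, x, i). A \<in> borel_Rplus \<and> x \<in> T} (\<lambda>(A, x, i) \<omega>. N A x \<omega> $ i)"

lemma \<gamma>_pos: "0 < \<gamma> j"
  using assm1 by (simp add: assumption1_def)

lemma noise: "x \<in> T \<Longrightarrow> indep_scattered_gaussian_noise M (\<lambda>A. N A x)"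
  using assm1 by (simp add: assumption1_def)

lemma N_v: "x \<in> T \<Longrightarrow> AE \<omega> in M. N {0..} x \<omega> = v x \<omega>"
  using assm1 by (simp add: assumption1_def)

lemma N_indep: "A \<in> borel_Rplus \<Longrightarrow> B \<in> borel_Rplus \<Longrightarrow> A \<inter> B = {} \<Longrightarrow>
  indep_var (Pi\<^sub>M T (\<lambda>_. borel)) (\<lambda>\<omega>. restrict (\<lambda>x. N A x \<omega>) T)
            (Pi\<^sub>M T (\<lambda>_. borel)) (\<lambda>\<omega>. restrict (\<lambda>x. N B x \<omega>) T)"
  using assm1 by (simp add: assumption1_def)

sublocale gaussian_space M G
  unfolding G_def
  by (rule gspan_gaussian_space[OF prob_space_axioms]) (use assm1 in \<open>simp add: assumption1_def\<close>)

sublocale grid \<gamma>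
  by standard (rule \<gamma>_pos)

lemma N_G: "A \<in> borel_Rplus \<Longrightarrow> x \<in> T \<Longrightarrow> (\<lambda>\<omega>. N A x \<omega> $ e) \<in> G"
  unfolding G_def
  using gspan_base[of "(A, x, e)" "{(A, x, i). A \<in> borel_Rplus \<and> x \<in> T}" "\<lambda>(A, x, i) \<omega>. N A x \<omega> $ i"] by simp

lemma N_add: "A \<in> borel_Rplus \<Longrightarrow> B \<in> borel_Rplus \<Longrightarrow> A \<inter> B = {} \<Longrightarrow> x \<in> T \<Longrightarrow>
  AE \<omega> in M. N (A \<union> B) x \<omega> = N A x \<omega> + N B x \<omega>"
  using noise[of x] by (simp add: indep_scattered_gaussian_noise_def)

lemma N_empty: "x \<in> T \<Longrightarrow> AE \<omega> in M. N {} x \<omega> = 0"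
proof -
  assume "x \<in> T"
  moreover have "{} \<in> borel_Rplus" by (simp add: borel_Rplus_def)
  ultimately have "AE \<omega> in M. N ({} \<union> {}) x \<omega> = N {} x \<omega> + N {} x \<omega>" by (intro N_add) auto
  then show ?thesis by eventually_elim simp
qed

lemma N_split: 
  assumes "0 \<le> a" "x \<in> T"
  shows "AE \<omega> in M. N {0..} x \<omega> = N {0..<a} x \<omega> + N {a..} x \<omega>"
proof -
  have u: "{0..<a} \<union> {a..} = {0..}" and i: "{0..<a} \<inter> {a..} = {}" using assms(1) by auto
  show ?thesis
    using N_add[OF borel_Rplus_intervals(1) borel_Rplus_intervals(3)[OF assms(1)] i assms(2)] unfolding u .
qed

lemma v_comp_meas: "(\<lambda>\<omega>. v x \<omega> $ e) \<in> borel_measurable M"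
proof -
  interpret V: gaussian_space M "gspan UNIV (\<lambda>(x, i) \<omega>. v x \<omega> $ i)"
    by (rule gspan_gaussian_space[OF prob_space_axioms]) (use field in \<open>simp add: centered_cont_gaussian_field_iid_def\<close>)
  show ?thesis
    using V.meas[OF gspan_base[of "(x, e)"]] by simp
qed

definition D :: "real set \<Rightarrow> real^'k \<Rightarrow> real^'k \<Rightarrow> 'd \<Rightarrow> 'w \<Rightarrow> real" where
  "D A x y e \<omega> = N A x \<omega> $ e - N A y \<omega> $ e"

lemma D_G: "A \<in> borel_Rplus \<Longrightarrow> x \<in> T \<Longrightarrow> y \<in> T \<Longrightarrow> D A x y e \<in> G"
  unfolding D_def[abs_def] by (intro diff N_G)

text \<open>The assumption speaks of \<open>v\<close> and of the Euclidean norm. Replacing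
  \<open>v\<close> by the almost surely equal \<open>N {0..}\<close> puts the variables into
  \<open>G\<close>, and a component is dominated by the norm.\<close>

lemma component_increment_le:
  assumes A: "A \<in> borel_Rplus" and xy: "x \<in> T" "y \<in> T" and "0 \<le> B"
    and le: "L2norm M (\<lambda>\<omega>. N A x \<omega> - v x \<omega> - N A y \<omega> + v y \<omega>) \<le> B"
  shows "(\<integral>\<omega>. (D A x y e \<omega> - D {0..} x y e \<omega>)\<^sup>2 \<partial>M) \<le> B\<^sup>2"
proof -
  define X where "X \<omega> = N A x \<omega> - N {0..} x \<omega> - N A y \<omega> + N {0..} y \<omega>" for \<omega>
  have n: "(norm z)\<^sup>2 = (\<Sum>i\<in>UNIV. (z $ i)\<^sup>2)" for z :: "real^'d"
    unfolding power2_norm_eq_inner inner_vec_def by (simp add: power2_eq_square)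
  note [measurable] = N_G[OF A xy(1), THEN meas] N_G[OF A xy(2), THEN meas]
    N_G[OF borel_Rplus_intervals(2) xy(1), THEN meas] N_G[OF borel_Rplus_intervals(2) xy(2), THEN meas] v_comp_meas
  have ae: "AE \<omega> in M. (\<Sum>i\<in>UNIV. (X \<omega> $ i)\<^sup>2) = (\<Sum>i\<in>UNIV. ((N A x \<omega> - v x \<omega> - N A y \<omega> + v y \<omega>) $ i)\<^sup>2)"
    using N_v[OF xy(1)] N_v[OF xy(2)] by eventually_elim (simp add: X_def)
  have "L2norm M X = L2norm M (\<lambda>\<omega>. N A x \<omega> - v x \<omega> - N A y \<omega> + v y \<omega>)"
    unfolding L2norm_def n
    by (intro arg_cong[where f = sqrt] integral_cong_AE[OF _ _ ae]) (simp_all add: X_def)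
  then have "L2norm M X \<le> B" using le by simp
  moreover have "0 \<le> L2norm M X" by (simp add: L2norm_def)
  ultimately have "(L2norm M X)\<^sup>2 \<le> B\<^sup>2" by (intro power_mono) auto
  moreover have "(\<lambda>\<omega>. X \<omega> $ i) \<in> G" for i
  proof -
    have "(\<lambda>\<omega>. N A x \<omega> $ i - N {0..} x \<omega> $ i - N A y \<omega> $ i + N {0..} y \<omega> $ i) \<in> G"
      using A xy by (intro add diff N_G) auto
    then show ?thesis by (simp add: X_def)
  qed
  then have "(\<integral>\<omega>. (X \<omega> $ e)\<^sup>2 \<partial>M) \<le> (L2norm M X)\<^sup>2" by (rule component_le_L2norm)
  moreover have "X \<omega> $ e = D A x y e \<omega> - D {0..} x y e \<omega>" for \<omega> by (simp add: X_def D_def)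
  ultimately show ?thesis by simp
qed

text \<open>Part (b) of Assumption 1 in three guises. A half-line in place of the band leaves minus
  the noise on \<open>[0, a)\<close>. The empty band \<open>[a, a)\<close>, on which the noise
  vanishes almost surely, leaves the field itself.\<close>

lemma increment_bounds:
  assumes "compact_interval F" "F \<subseteq> T"
  shows "\<exists>c0>0. \<exists>a0\<ge>0.
    (\<forall>a b x y e. a0 \<le> a \<and> a \<le> b \<and> 0 < b \<and> x \<in> F \<and> y \<in> F \<longrightarrow>
      (\<integral>\<omega>. (D {a..<b} x y e \<omega> - D {0..} x y e \<omega>)\<^sup>2 \<partial>M) \<le> (c0 * ((\<Sum>j\<in>UNIV. a powr \<gamma> j * \<bar>x$j - y$j\<bar>) + 1 / b))\<^sup>2) \<and>
    (\<forall>a x y e. a0 \<le> a \<and> x \<in> F \<and> y \<in> F \<longrightarrow>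
      (\<integral>\<omega>. (D {0..<a} x y e \<omega>)\<^sup>2 \<partial>M) \<le> (c0 * (\<Sum>j\<in>UNIV. a powr \<gamma> j * \<bar>x$j - y$j\<bar>))\<^sup>2) \<and>
    (\<forall>a x y e. a0 \<le> a \<and> 0 < a \<and> x \<in> F \<and> y \<in> F \<longrightarrow>
      (\<integral>\<omega>. (D {0..} x y e \<omega>)\<^sup>2 \<partial>M) \<le> (c0 * ((\<Sum>j\<in>UNIV. a powr \<gamma> j * \<bar>x$j - y$j\<bar>) + 1 / a))\<^sup>2)"
proof -
  note b = assm1[unfolded assumption1_def, THEN conjunct2, THEN conjunct2, THEN conjunct2, THEN conjunct2,
      THEN conjunct2, THEN spec[of _ F], THEN mp, OF conjI[OF assms]]
  obtain c0 a0 where c0: "0 < c0" "0 \<le> a0"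
    and 1: "\<forall>a b x y. a0 \<le> a \<and> a \<le> b \<and> 0 < b \<and> x \<in> F \<and> y \<in> F \<longrightarrow>
              L2norm M (\<lambda>\<omega>. N {a..<b} x \<omega> - v x \<omega> - N {a..<b} y \<omega> + v y \<omega>)
                \<le> c0 * ((\<Sum>j\<in>UNIV. a powr \<gamma> j * \<bar>x$j - y$j\<bar>) + 1 / b)"
    and 2: "\<forall>a x y. a0 \<le> a \<and> x \<in> F \<and> y \<in> F \<longrightarrow>
              L2norm M (\<lambda>\<omega>. N {a..} x \<omega> - v x \<omega> - N {a..} y \<omega> + v y \<omega>)
                \<le> c0 * (\<Sum>j\<in>UNIV. a powr \<gamma> j * \<bar>x$j - y$j\<bar>)"
    using b by (elim exE conjE) (rule that, assumption+)
  note 1 = 1[rule_format, OF conjI[OF _ conjI[OF _ conjI[OF _ conjI]]]]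
  note 2 = 2[rule_format, OF conjI[OF _ conjI]]
  have s0: "0 \<le> (\<Sum>j\<in>UNIV. a powr \<gamma> j * \<bar>x$j - y$j\<bar>)" for a and x y :: "real^'k"
    by (intro sum_nonneg) auto
  have FT: "x \<in> T" if "x \<in> F" for x using assms(2) that by auto
  have r1: "(\<integral>\<omega>. (D {a..<b} x y e \<omega> - D {0..} x y e \<omega>)\<^sup>2 \<partial>M) \<le> (c0 * ((\<Sum>j\<in>UNIV. a powr \<gamma> j * \<bar>x$j - y$j\<bar>) + 1 / b))\<^sup>2"
    if "a0 \<le> a" "a \<le> b" "0 < b" "x \<in> F" "y \<in> F" for a b x y e
    using that c0 s0 by (intro component_increment_le 1 FT) auto
  have r2: "(\<integral>\<omega>. (D {0..<a} x y e \<omega>)\<^sup>2 \<partial>M) \<le> (c0 * (\<Sum>j\<in>UNIV. a powr \<gamma> j * \<bar>x$j - y$j\<bar>))\<^sup>2"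
    if a: "a0 \<le> a" and xy: "x \<in> F" "y \<in> F" for a x y e
  proof -
    have a0: "0 \<le> a" using a c0 by simp
    note [measurable] = D_G[OF _ FT[OF xy(1)] FT[OF xy(2)], THEN meas]
    have "(\<integral>\<omega>. (D {0..<a} x y e \<omega>)\<^sup>2 \<partial>M) = (\<integral>\<omega>. (D {a..} x y e \<omega> - D {0..} x y e \<omega>)\<^sup>2 \<partial>M)"
    proof (rule integral_cong_AE)
      show "AE \<omega> in M. (D {0..<a} x y e \<omega>)\<^sup>2 = (D {a..} x y e \<omega> - D {0..} x y e \<omega>)\<^sup>2"
        using N_split[OF a0 FT[OF xy(1)]] N_split[OF a0 FT[OF xy(2)]]
      proof eventually_elim
        case (elim \<omega>)
        then have "D {a..} x y e \<omega> - D {0..} x y e \<omega> = - D {0..<a} x y e \<omega>" by (simp add: D_def)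
        then show ?case by simp
      qed
    qed (use a0 in auto)
    also have "\<dots> \<le> (c0 * (\<Sum>j\<in>UNIV. a powr \<gamma> j * \<bar>x$j - y$j\<bar>))\<^sup>2"
      using a a0 xy c0 s0 by (intro component_increment_le 2 FT) auto
    finally show ?thesis .
  qed
  have r3: "(\<integral>\<omega>. (D {0..} x y e \<omega>)\<^sup>2 \<partial>M) \<le> (c0 * ((\<Sum>j\<in>UNIV. a powr \<gamma> j * \<bar>x$j - y$j\<bar>) + 1 / a))\<^sup>2"
    if a: "a0 \<le> a" "0 < a" and xy: "x \<in> F" "y \<in> F" for a x y e
  proof -
    note [measurable] = D_G[OF _ FT[OF xy(1)] FT[OF xy(2)], THEN meas]
    have e: "{} \<in> borel_Rplus" by (simp add: borel_Rplus_def)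
    have "(\<integral>\<omega>. (D {0..} x y e \<omega>)\<^sup>2 \<partial>M) = (\<integral>\<omega>. (D {a..<a} x y e \<omega> - D {0..} x y e \<omega>)\<^sup>2 \<partial>M)"
    proof (rule integral_cong_AE)
      show "AE \<omega> in M. (D {0..} x y e \<omega>)\<^sup>2 = (D {a..<a} x y e \<omega> - D {0..} x y e \<omega>)\<^sup>2"
        using N_empty[OF FT[OF xy(1)]] N_empty[OF FT[OF xy(2)]] by eventually_elim (simp add: D_def power2_commute)
    qed (use e in auto)
    also have "\<dots> \<le> (c0 * ((\<Sum>j\<in>UNIV. a powr \<gamma> j * \<bar>x$j - y$j\<bar>) + 1 / a))\<^sup>2"
      using r1[OF a(1) order_refl a(2) xy] .
    finally show ?thesis .
  qed
  show ?thesis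
    by (rule exI[of _ c0], rule conjI[OF c0(1)], rule exI[of _ a0], rule conjI[OF c0(2)], intro conjI allI impI; elim conjE)
       (rule r1 r2 r3; assumption)+
qed

text \<open>Increments of the noise on \<open>[0, a)\<close> and on its complement are independent
  and centered, so their variances add up.\<close>

lemma D_low_le:
  assumes "0 \<le> a" "x \<in> T" "y \<in> T"
  shows "(\<integral>\<omega>. (D {0..<a} x y e \<omega>)\<^sup>2 \<partial>M) \<le> (\<integral>\<omega>. (D {0..} x y e \<omega>)\<^sup>2 \<partial>M)"
proof -
  let ?P = "Pi\<^sub>M T (\<lambda>_. borel) :: (real^'k \<Rightarrow> real^'d) measure"
  define \<phi> where "\<phi> f = f x $ e - f y $ e" for f :: "real^'k \<Rightarrow> real^'d"
  have [measurable]: "\<phi> \<in> borel_measurable ?P"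
  proof -
    have "(\<lambda>f :: real^'k \<Rightarrow> real^'d. f z $ e) \<in> borel_measurable ?P" if "z \<in> T" for z
      using that by (rule measurable_compose[OF measurable_component_singleton])
        (auto intro!: borel_measurable_continuous_onI continuous_intros)
    then show ?thesis unfolding \<phi>_def[abs_def] using assms by (intro borel_measurable_diff)
  qed
  have G: "D {0..<a} x y e \<in> G" "D {a..} x y e \<in> G" "D {0..} x y e \<in> G" using assms by (auto intro: D_G)
  note [measurable] = G[THEN meas]
  have "{0..<a} \<inter> {a..} = {}" by auto
  then have "indep_var borel (\<phi> \<circ> (\<lambda>\<omega>. restrict (\<lambda>x. N {0..<a} x \<omega>) T)) borel (\<phi> \<circ> (\<lambda>\<omega>. restrict (\<lambda>x. N {a..} x \<omega>) T))"
    using assms by (intro indep_var_compose[OF N_indep]) auto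
  moreover have "\<phi> \<circ> (\<lambda>\<omega>. restrict (\<lambda>x. N A x \<omega>) T) = D A x y e" for A
    using assms by (auto simp: \<phi>_def D_def fun_eq_iff)
  ultimately have "indep_var borel (D {0..<a} x y e) borel (D {a..} x y e)" by simp
  then have "(\<integral>\<omega>. D {0..<a} x y e \<omega> * D {a..} x y e \<omega> \<partial>M) = (\<integral>\<omega>. D {0..<a} x y e \<omega> \<partial>M) * (\<integral>\<omega>. D {a..} x y e \<omega> \<partial>M)"
    using centered_gaussian_rv_moments(4)[OF prob_space_axioms gaussian[OF G(1)]]
      centered_gaussian_rv_moments(4)[OF prob_space_axioms gaussian[OF G(2)]]
    by (rule indep_var_lebesgue_integral)
  also have "\<dots> = 0" using centered_gaussian_rv_moments(5)[OF prob_space_axioms gaussian[OF G(1)]] by simp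
  finally have "(\<integral>\<omega>. (D {0..<a} x y e \<omega> + D {a..} x y e \<omega>)\<^sup>2 \<partial>M) =
      (\<integral>\<omega>. (D {0..<a} x y e \<omega>)\<^sup>2 \<partial>M) + (\<integral>\<omega>. (D {a..} x y e \<omega>)\<^sup>2 \<partial>M)"
    by (rule var_sum_orthogonal[OF G(1,2)])
  moreover have "(\<integral>\<omega>. (D {0..} x y e \<omega>)\<^sup>2 \<partial>M) = (\<integral>\<omega>. (D {0..<a} x y e \<omega> + D {a..} x y e \<omega>)\<^sup>2 \<partial>M)"
  proof (rule integral_cong_AE)
    show "AE \<omega> in M. (D {0..} x y e \<omega>)\<^sup>2 = (D {0..<a} x y e \<omega> + D {a..} x y e \<omega>)\<^sup>2"
      using N_split[OF assms(1,2)] N_split[OF assms(1,3)] by eventually_elim (simp add: D_def algebra_simps)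
  qed auto
  moreover have "0 \<le> (\<integral>\<omega>. (D {a..} x y e \<omega>)\<^sup>2 \<partial>M)" by simp
  ultimately show ?thesis by linarith
qed

text \<open>The variance is the control measure of a half-line, which is finite, and the half-lines
  decrease to the empty set.\<close>

lemma high_noise_tendsto:
  assumes "x \<in> T"
  shows "(\<lambda>t. \<integral>\<omega>. (N {2^t..} x \<omega> $ e)\<^sup>2 \<partial>M) \<longlonglongrightarrow> 0"
proof -
  note n = noise[OF assms, unfolded indep_scattered_gaussian_noise_def, THEN conjunct1]
  obtain \<mu> :: "real measure" where s: "sets \<mu> = sets borel"
    and a: "\<forall>A\<in>borel_Rplus. emeasure \<mu> A < \<infinity> \<and> (\<forall>i. centered_gaussian_rv M (\<lambda>\<omega>. N A x \<omega> $ i) \<and>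
      (\<integral>\<omega>. (N A x \<omega> $ i)\<^sup>2 \<partial>M) = measure \<mu> A)"
    using n by (elim exE conjE) (rule that, assumption+)
  have fin: "emeasure \<mu> A < \<infinity>" and var: "(\<integral>\<omega>. (N A x \<omega> $ e)\<^sup>2 \<partial>M) = measure \<mu> A" if "A \<in> borel_Rplus" for A
    by (rule conjunct1[OF bspec[OF a that]], rule conjunct2[OF spec[OF conjunct2[OF bspec[OF a that]]]])
  define A where "A t = {(2::real)^t..}" for t :: nat
  have A: "A t \<in> borel_Rplus" for t by (simp add: A_def)
  have "(\<lambda>t. measure \<mu> (A t)) \<longlonglongrightarrow> measure \<mu> (\<Inter>t. A t)"
  proof (rule Lim_measure_decseq)
    have "A t \<in> sets \<mu>" for t using A[of t] unfolding s borel_Rplus_def by blast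
    then show "range A \<subseteq> sets \<mu>" by blast
    have "A (Suc t) \<subseteq> A t" for t by (simp add: A_def)
    then show "decseq A" by (rule decseq_SucI)
    show "emeasure \<mu> (A t) \<noteq> \<infinity>" for t using fin[OF A[of t]] by (rule less_imp_neq)
  qed
  moreover have "(\<Inter>t. A t) = {}"
  proof -
    have "\<exists>t. y \<notin> A t" for y using real_arch_pow[of 2 y] by (auto simp: A_def not_le)
    then show ?thesis by blast
  qed
  ultimately have "(\<lambda>t. measure \<mu> (A t)) \<longlonglongrightarrow> 0" by (simp only: measure_empty)
  then show ?thesis unfolding var[OF A, symmetric] by (simp only: A_def)
qed

text \<open>The bound for the full field contains a free frequency. It is first taken so large that
  \<open>c0 / a\<close> is at most half of \<open>s = sqrt \<eta>\<close>; then the distance is made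
  so small that the sum weighted by \<open>a powr \<gamma> j\<close> stays below the other
  half.\<close>

lemma D_continuous:
  assumes "compact_interval F" "F \<subseteq> T" "x \<in> F" "0 < \<eta>"
  obtains \<rho> where "0 < \<rho>"
    "\<And>y e. y \<in> F \<Longrightarrow> (\<And>j. \<bar>y$j - x$j\<bar> < \<rho>) \<Longrightarrow> (\<integral>\<omega>. (D {0..} y x e \<omega>)\<^sup>2 \<partial>M) \<le> \<eta>"
proof -
  obtain c0 a0 where c0: "0 < c0" "0 \<le> a0"
    and b: "\<forall>a x y e. a0 \<le> a \<and> 0 < a \<and> x \<in> F \<and> y \<in> F \<longrightarrow>
      (\<integral>\<omega>. (D {0..} x y e \<omega>)\<^sup>2 \<partial>M) \<le> (c0 * ((\<Sum>j\<in>UNIV. a powr \<gamma> j * \<bar>x$j - y$j\<bar>) + 1 / a))\<^sup>2"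
    using increment_bounds[OF assms(1,2)] by (elim exE conjE) (rule that, assumption+)
  note b = b[rule_format, OF conjI[OF _ conjI[OF _ conjI]]]
  define s where "s = sqrt \<eta>"
  have s: "0 < s" "s\<^sup>2 = \<eta>" using assms(4) by (auto simp: s_def)
  define a where "a = max (max a0 1) (2 * c0 / s)"
  have a: "a0 \<le> a" "0 < a" "c0 * (1 / a) \<le> s / 2"
  proof -
    show "a0 \<le> a" "0 < a" by (auto simp: a_def)
    have "2 * c0 / s \<le> a" by (simp add: a_def)
    then show "c0 * (1 / a) \<le> s / 2" using s \<open>0 < a\<close> by (simp add: field_simps)
  qed
  define P where "P = (\<Sum>j\<in>UNIV. a powr \<gamma> j)"
  have P: "0 < P" unfolding P_def using a by (intro sum_pos) auto
  define \<rho> where "\<rho> = s / (2 * c0 * P)"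
  have \<rho>: "0 < \<rho>" "c0 * (P * \<rho>) = s / 2" using s c0 P by (auto simp: \<rho>_def)
  show ?thesis
  proof (rule that[OF \<rho>(1)])
    fix y e assume y: "y \<in> F" "\<And>j. \<bar>y$j - x$j\<bar> < \<rho>"
    have "(\<Sum>j\<in>UNIV. a powr \<gamma> j * \<bar>y$j - x$j\<bar>) \<le> P * \<rho>"
      unfolding P_def sum_distrib_right using y(2) by (intro sum_mono mult_left_mono) (auto intro: less_imp_le)
    then have "c0 * (\<Sum>j\<in>UNIV. a powr \<gamma> j * \<bar>y$j - x$j\<bar>) \<le> s / 2"
      unfolding \<rho>(2)[symmetric] using c0 by (intro mult_left_mono) auto
    then have "c0 * ((\<Sum>j\<in>UNIV. a powr \<gamma> j * \<bar>y$j - x$j\<bar>) + 1 / a) \<le> s"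
      using a(3) unfolding distrib_left by linarith
    moreover have "0 \<le> c0 * ((\<Sum>j\<in>UNIV. a powr \<gamma> j * \<bar>y$j - x$j\<bar>) + 1 / a)"
      using c0 a by (intro mult_nonneg_nonneg add_nonneg_nonneg sum_nonneg) auto
    ultimately have "(c0 * ((\<Sum>j\<in>UNIV. a powr \<gamma> j * \<bar>y$j - x$j\<bar>) + 1 / a))\<^sup>2 \<le> s\<^sup>2"
      by (intro power_mono)
    then show "(\<integral>\<omega>. (D {0..} y x e \<omega>)\<^sup>2 \<partial>M) \<le> \<eta>"
      using b[OF a(1,2) y(1) assms(3), of e] s(2) by linarith
  qed
qed

text \<open>Assumption 3 treats one component at a time. Different components are independent and
  centered, hence orthogonal, so the variance of a combination over all components is the sum of the
  componentwise variances and vanishes only with all coefficients. The lower bound is obtained for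
  \<open>v\<close> in its own span and then carried over to \<open>N {0..}\<close>.\<close>

lemma nondegenerate_at:
  assumes xs: "\<And>l. l < m \<Longrightarrow> xs l \<in> T" "inj_on xs {..<m}"
  obtains \<kappa> where "0 < \<kappa>"
    "\<And>c. \<kappa> * (\<Sum>l<m. \<Sum>e\<in>UNIV. (c l e)\<^sup>2) \<le> (\<integral>\<omega>. (\<Sum>l<m. \<Sum>e\<in>UNIV. c l e * N {0..} (xs l) \<omega> $ e)\<^sup>2 \<partial>M)"
proof -
  interpret V: gaussian_space M "gspan UNIV (\<lambda>(x, i) \<omega>. v x \<omega> $ i)"
    by (rule gspan_gaussian_space[OF prob_space_axioms]) (use field in \<open>simp add: centered_cont_gaussian_field_iid_def\<close>)
  let ?V = "gspan UNIV (\<lambda>(x, i) \<omega>. v x \<omega> $ i)"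
  have vG: "(\<lambda>\<omega>. v x \<omega> $ i) \<in> ?V" for x i
    using gspan_base[of "(x, i)" UNIV "\<lambda>(x, i) \<omega>. v x \<omega> $ i"] by simp
  let ?S = "{..<m} \<times> (UNIV :: 'd set)"
  define X where "X = (\<lambda>(l, e) \<omega>. v (xs l) \<omega> $ e)"
  have XG: "X s \<in> ?V" for s unfolding X_def using vG by (cases s) simp
  have "\<exists>\<kappa>>0. \<forall>c. \<kappa> * (\<Sum>s\<in>?S. (c s)\<^sup>2) \<le> (\<integral>\<omega>. (\<Sum>s\<in>?S. c s * X s \<omega>)\<^sup>2 \<partial>M)"
  proof (rule V.lower_frame_bound)
    fix c :: "nat \<times> 'd \<Rightarrow> real" assume "\<exists>s\<in>?S. c s \<noteq> 0"
    then obtain l0 e0 where le0: "l0 < m" "c (l0, e0) \<noteq> 0" by auto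
    define f where "f e \<omega> = (\<Sum>l<m. c (l, e) * v (xs l) \<omega> $ e)" for e \<omega>
    have fG: "f e \<in> ?V" for e unfolding f_def using vG by (intro V.lincomb)
    have orth: "(\<integral>\<omega>. f e \<omega> * f e' \<omega> \<partial>M) = 0" if "e \<noteq> e'" for e e'
    proof -
      let ?P = "Pi\<^sub>M UNIV (\<lambda>_. borel) :: (real^'k \<Rightarrow> real) measure"
      have iv: "indep_vars (\<lambda>_. ?P) (\<lambda>i \<omega>. (\<lambda>x. v x \<omega> $ i)) UNIV"
        using field by (simp add: centered_cont_gaussian_field_iid_def)
      define \<psi> where "\<psi> i F = (\<Sum>l<m. c (l, i) * F i (xs l))" for i :: 'd and F :: "'d \<Rightarrow> real^'k \<Rightarrow> real"
      have \<psi>: "\<psi> i \<in> borel_measurable (Pi\<^sub>M {i} (\<lambda>_. ?P))" for i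
      proof -
        have "(\<lambda>F. F i z) \<in> borel_measurable (Pi\<^sub>M {i} (\<lambda>_. ?P))" for z
        proof -
          have a: "(\<lambda>F. F i) \<in> measurable (Pi\<^sub>M {i} (\<lambda>_. ?P)) ?P" by (rule measurable_component_singleton) simp
          have b: "(\<lambda>h. h z) \<in> borel_measurable ?P" by (rule measurable_component_singleton) simp
          show ?thesis by (rule measurable_compose[OF a b])
        qed
        then show ?thesis unfolding \<psi>_def by (intro borel_measurable_sum borel_measurable_times) auto
      qed
      have "indep_var borel (\<psi> e \<circ> (\<lambda>\<omega>. restrict (\<lambda>i x. v x \<omega> $ i) {e})) borel (\<psi> e' \<circ> (\<lambda>\<omega>. restrict (\<lambda>i x. v x \<omega> $ i) {e'}))"
        by (rule indep_var_compose[OF indep_var_restrict[OF iv] \<psi> \<psi>]) (use that in auto)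
      moreover have "\<psi> i \<circ> (\<lambda>\<omega>. restrict (\<lambda>i x. v x \<omega> $ i) {i}) = f i" for i
        by (rule ext) (simp add: \<psi>_def f_def)
      ultimately have "indep_var borel (f e) borel (f e')" by simp
      then have "(\<integral>\<omega>. f e \<omega> * f e' \<omega> \<partial>M) = (\<integral>\<omega>. f e \<omega> \<partial>M) * (\<integral>\<omega>. f e' \<omega> \<partial>M)"
        using centered_gaussian_rv_moments(4)[OF prob_space_axioms V.gaussian[OF fG]]
        by (intro indep_var_lebesgue_integral)
      then show ?thesis using centered_gaussian_rv_moments(5)[OF prob_space_axioms V.gaussian[OF fG]] by simp
    qed
    have "(\<Sum>s\<in>?S. c s * X s \<omega>) = (\<Sum>e\<in>UNIV. f e \<omega>)" for \<omega>
      unfolding X_def f_def by (subst sum.swap) (simp add: sum.cartesian_product case_prod_beta)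
    then have "(\<integral>\<omega>. (\<Sum>s\<in>?S. c s * X s \<omega>)\<^sup>2 \<partial>M) = (\<integral>\<omega>. (\<Sum>e\<in>UNIV. \<Sum>e'\<in>UNIV. f e \<omega> * f e' \<omega>) \<partial>M)"
      by (simp add: power2_eq_square sum_product)
    also have "\<dots> = (\<Sum>e\<in>UNIV. \<Sum>e'\<in>UNIV. \<integral>\<omega>. f e \<omega> * f e' \<omega> \<partial>M)"
      using V.integrable_mult[OF fG fG]
      by (subst Bochner_Integration.integral_sum) (auto intro!: Bochner_Integration.integrable_sum sum.cong Bochner_Integration.integral_sum)
    also have "\<dots> = (\<Sum>e\<in>UNIV. \<integral>\<omega>. (f e \<omega>)\<^sup>2 \<partial>M)"
    proof (rule sum.cong[OF refl])
      fix e
      have "(\<Sum>e'\<in>UNIV. \<integral>\<omega>. f e \<omega> * f e' \<omega> \<partial>M) = (\<Sum>e'\<in>{e}. \<integral>\<omega>. f e \<omega> * f e' \<omega> \<partial>M)"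
        using orth by (intro sum.mono_neutral_right) auto
      then show "(\<Sum>e'\<in>UNIV. \<integral>\<omega>. f e \<omega> * f e' \<omega> \<partial>M) = (\<integral>\<omega>. (f e \<omega>)\<^sup>2 \<partial>M)"
        by (simp add: power2_eq_square)
    qed
    also have "\<dots> \<noteq> 0"
    proof
      assume "(\<Sum>e\<in>UNIV. \<integral>\<omega>. (f e \<omega>)\<^sup>2 \<partial>M) = 0"
      then have "(\<integral>\<omega>. (f e0 \<omega>)\<^sup>2 \<partial>M) = 0" by (subst (asm) sum_nonneg_eq_0_iff) auto
      then have "AE \<omega> in M. f e0 \<omega> = 0"
        using V.integrable_square[OF fG[of e0]] by (subst (asm) integral_nonneg_eq_0_iff_AE) auto
      moreover have "(\<forall>l<m. xs l \<in> T) \<and> inj_on xs {..<m}" using xs by blast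
      note assm3[unfolded assumption3_def, THEN spec[of _ xs], THEN mp, OF this,
        THEN spec[of _ e0], THEN spec[of _ "\<lambda>l. c (l, e0)"], THEN mp]
      then have "\<not> (AE \<omega> in M. f e0 \<omega> = 0)" unfolding f_def using le0 by blast
      ultimately show False by contradiction
    qed
    finally show "(\<integral>\<omega>. (\<Sum>s\<in>?S. c s * X s \<omega>)\<^sup>2 \<partial>M) \<noteq> 0" .
  qed (use XG in auto)
  then obtain \<kappa> where \<kappa>: "0 < \<kappa>" "\<And>c. \<kappa> * (\<Sum>s\<in>?S. (c s)\<^sup>2) \<le> (\<integral>\<omega>. (\<Sum>s\<in>?S. c s * X s \<omega>)\<^sup>2 \<partial>M)" by blast
  show thesis
  proof (rule that[OF \<kappa>(1)])
    fix c :: "nat \<Rightarrow> 'd \<Rightarrow> real"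
    have "AE \<omega> in M. \<forall>l\<in>{..<m}. N {0..} (xs l) \<omega> = v (xs l) \<omega>"
      using N_v xs(1) by (subst AE_ball_countable) auto
    then have ae: "AE \<omega> in M. (\<Sum>l<m. \<Sum>e\<in>UNIV. c l e * N {0..} (xs l) \<omega> $ e)\<^sup>2 = (\<Sum>l<m. \<Sum>e\<in>UNIV. c l e * v (xs l) \<omega> $ e)\<^sup>2"
      by eventually_elim simp
    have [measurable]: "(\<lambda>\<omega>. N {0..} (xs l) \<omega> $ e) \<in> borel_measurable M" if "l \<in> {..<m}" for l e
      using N_G[of "{0..}" "xs l" e] xs(1) that by simp
    note [measurable] = v_comp_meas
    have "(\<integral>\<omega>. (\<Sum>l<m. \<Sum>e\<in>UNIV. c l e * N {0..} (xs l) \<omega> $ e)\<^sup>2 \<partial>M) = (\<integral>\<omega>. (\<Sum>l<m. \<Sum>e\<in>UNIV. c l e * v (xs l) \<omega> $ e)\<^sup>2 \<partial>M)"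
      by (rule integral_cong_AE[OF _ _ ae]) measurable
    then show "\<kappa> * (\<Sum>l<m. \<Sum>e\<in>UNIV. (c l e)\<^sup>2) \<le> (\<integral>\<omega>. (\<Sum>l<m. \<Sum>e\<in>UNIV. c l e * N {0..} (xs l) \<omega> $ e)\<^sup>2 \<partial>M)"
      using \<kappa>(2)[of "\<lambda>(l, e). c l e"] by (simp add: sum.cartesian_product X_def case_prod_beta)
  qed
qed

section \<open>Links of the noise, and nondegeneracy near distinct points\<close>

lemma link_eq_D: "link \<gamma> a b n i (\<lambda>x. N A x \<omega> $ e) = D A (pt \<gamma> a b (Suc n) i) (pt \<gamma> a b n (coarsen \<gamma> n (Suc n) i)) e \<omega>"
  by (simp add: link_def D_def)

text \<open>The anisotropic grid is made for this cancellation: with \<open>\<gamma>\<close> the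
  exponent of one coordinate, \<open>2^(t \<gamma>)\<close> times the mesh
  \<open>2^(-n (1 + \<gamma>))\<close> equals \<open>2^(-n - \<gamma> (n - t))\<close>, and as
  \<open>t \<le> n\<close> a common lower bound \<open>g\<close> may replace the exponent.\<close>

lemma link_weight_le:
  assumes ab: "\<And>j. a$j < b$j" and "t \<le> n" and g: "\<And>j. g \<le> \<gamma> j"
  shows "(\<Sum>j\<in>UNIV. (2^t) powr \<gamma> j * \<bar>pt \<gamma> a b (Suc n) i $ j - pt \<gamma> a b n (coarsen \<gamma> n (Suc n) i) $ j\<bar>)
    \<le> (\<Sum>j\<in>UNIV. 2 * (b$j - a$j)) * 2 powr (- real n - g * (real n - real t))"
  unfolding sum_distrib_right
proof (rule sum_mono)
  fix j
  have ab': "0 \<le> 2 * (b$j - a$j)" using ab[of j] by simp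
  have p: "(2^t) powr \<gamma> j = 2 powr (real t * \<gamma> j)" by (simp add: powr_powr flip: powr_realpow)
  have "(2^t) powr \<gamma> j * \<bar>pt \<gamma> a b (Suc n) i $ j - pt \<gamma> a b n (coarsen \<gamma> n (Suc n) i) $ j\<bar>
      \<le> 2 powr (real t * \<gamma> j) * (2 * (b$j - a$j) * 2 powr - (real n * (1 + \<gamma> j)))"
    unfolding p by (rule mult_left_mono[OF pt_link_dist[OF ab]]) simp
  also have "\<dots> = 2 * (b$j - a$j) * (2 powr (real t * \<gamma> j) * 2 powr - (real n * (1 + \<gamma> j)))"
    by (simp only: mult_ac)
  also have "\<dots> \<le> 2 * (b$j - a$j) * 2 powr (- real n - g * (real n - real t))"
  proof (rule mult_left_mono[OF _ ab'])
    have "g * (real n - real t) \<le> \<gamma> j * (real n - real t)"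
      using g[of j] assms(2) by (intro mult_right_mono) auto
    then have "real t * \<gamma> j + - (real n * (1 + \<gamma> j)) \<le> - real n - g * (real n - real t)"
      by (simp add: algebra_simps)
    then show "2 powr (real t * \<gamma> j) * 2 powr - (real n * (1 + \<gamma> j)) \<le> 2 powr (- real n - g * (real n - real t))"
      unfolding powr_add[symmetric] by (intro powr_mono) auto
  qed
  finally show "(2^t) powr \<gamma> j * \<bar>pt \<gamma> a b (Suc n) i $ j - pt \<gamma> a b n (coarsen \<gamma> n (Suc n) i) $ j\<bar>
      \<le> 2 * (b$j - a$j) * 2 powr (- real n - g * (real n - real t))" .
qed

lemma link_bounds:
  assumes ab: "\<And>j. a$j < b$j" and T: "cbox a b \<subseteq> T" and g: "\<And>j. g \<le> \<gamma> j"
  shows "\<exists>c>0. \<exists>t0.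
    (\<forall>t n i e. t0 \<le> t \<and> t \<le> n \<longrightarrow>
      (\<integral>\<omega>. (link \<gamma> a b n i (\<lambda>x. N {0..<2^t} x \<omega> $ e))\<^sup>2 \<partial>M) \<le> (c * 2 powr (- real n - g * (real n - real t)))\<^sup>2) \<and>
    (\<forall>t n s i e. t0 \<le> t \<and> t \<le> n \<and> t \<le> s \<longrightarrow>
      (\<integral>\<omega>. (link \<gamma> a b n i (\<lambda>x. N {2^t..<2^s} x \<omega> $ e) - link \<gamma> a b n i (\<lambda>x. N {0..} x \<omega> $ e))\<^sup>2 \<partial>M)
        \<le> (c * (2 powr (- real n - g * (real n - real t)) + 2 powr - real s))\<^sup>2) \<and>
    (\<forall>n i e. t0 \<le> n \<longrightarrow>
      (\<integral>\<omega>. (link \<gamma> a b n i (\<lambda>x. N {0..} x \<omega> $ e))\<^sup>2 \<partial>M) \<le> (c * 2 powr - real n)\<^sup>2)"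
proof -
  have "compact_interval (cbox a b)" using ab unfolding compact_interval_def by blast
  note ib = increment_bounds[OF this T]
  obtain c0 a0 where c0: "0 < c0" "0 \<le> a0"
    and b1: "\<forall>a' b' x y e. a0 \<le> a' \<and> a' \<le> b' \<and> 0 < b' \<and> x \<in> cbox a b \<and> y \<in> cbox a b \<longrightarrow>
      (\<integral>\<omega>. (D {a'..<b'} x y e \<omega> - D {0..} x y e \<omega>)\<^sup>2 \<partial>M) \<le> (c0 * ((\<Sum>j\<in>UNIV. a' powr \<gamma> j * \<bar>x$j - y$j\<bar>) + 1 / b'))\<^sup>2"
    and b2: "\<forall>a' x y e. a0 \<le> a' \<and> x \<in> cbox a b \<and> y \<in> cbox a b \<longrightarrow>
      (\<integral>\<omega>. (D {0..<a'} x y e \<omega>)\<^sup>2 \<partial>M) \<le> (c0 * (\<Sum>j\<in>UNIV. a' powr \<gamma> j * \<bar>x$j - y$j\<bar>))\<^sup>2"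
    and b3: "\<forall>a' x y e. a0 \<le> a' \<and> 0 < a' \<and> x \<in> cbox a b \<and> y \<in> cbox a b \<longrightarrow>
      (\<integral>\<omega>. (D {0..} x y e \<omega>)\<^sup>2 \<partial>M) \<le> (c0 * ((\<Sum>j\<in>UNIV. a' powr \<gamma> j * \<bar>x$j - y$j\<bar>) + 1 / a'))\<^sup>2"
    using ib by (elim exE conjE) (rule that, assumption+)
  note b1 = b1[rule_format, OF conjI[OF _ conjI[OF _ conjI[OF _ conjI]]]]
  note b2 = b2[rule_format, OF conjI[OF _ conjI]]
  note b3 = b3[rule_format, OF conjI[OF _ conjI[OF _ conjI]]]
  define \<Lambda> where "\<Lambda> = (\<Sum>j\<in>UNIV. 2 * (b$j - a$j))"
  have \<Lambda>: "0 \<le> \<Lambda>" unfolding \<Lambda>_def using ab by (intro sum_nonneg) (simp add: less_imp_le)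
  define c where "c = c0 * (\<Lambda> + 1)"
  have c: "0 < c" using c0 \<Lambda> by (simp add: c_def)
  obtain t0 where t0: "a0 < 2 ^ t0" using real_arch_pow[of 2 a0] by auto
  have a0: "a0 \<le> 2 ^ t" if "t0 \<le> t" for t
    using order_trans[OF less_imp_le[OF t0] power_increasing[OF that, of "2::real"]] by simp
  define w where "w i n j = \<bar>pt \<gamma> a b (Suc n) i $ j - pt \<gamma> a b n (coarsen \<gamma> n (Suc n) i) $ j\<bar>" for i n j
  have W: "(\<Sum>j\<in>UNIV. (2^t) powr \<gamma> j * w i n j) \<le> \<Lambda> * 2 powr (- real n - g * (real n - real t))" if "t \<le> n" for t n i
    unfolding w_def \<Lambda>_def by (rule link_weight_le[OF ab that g])
  have W0: "0 \<le> (\<Sum>j\<in>UNIV. (2^t) powr \<gamma> j * w i n j)" for t :: nat and i n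
    unfolding w_def by (intro sum_nonneg) auto
  have sq: "(c0 * S)\<^sup>2 \<le> (c * u)\<^sup>2" if "0 \<le> S" "S \<le> \<Lambda> * u + u" for S u
  proof (rule power_mono)
    show "c0 * S \<le> c * u"
      using mult_left_mono[OF that(2), of c0] c0 by (simp add: c_def algebra_simps)
  qed (use c0 that in auto)
  note pin = pt_in_box[OF ab]
  have e1: "(\<integral>\<omega>. (link \<gamma> a b n i (\<lambda>x. N {0..<2^t} x \<omega> $ e))\<^sup>2 \<partial>M) \<le> (c * 2 powr (- real n - g * (real n - real t)))\<^sup>2"
    if "t0 \<le> t" "t \<le> n" for t n i e
  proof -
    have "(\<integral>\<omega>. (link \<gamma> a b n i (\<lambda>x. N {0..<2^t} x \<omega> $ e))\<^sup>2 \<partial>M) \<le> (c0 * (\<Sum>j\<in>UNIV. (2^t) powr \<gamma> j * w i n j))\<^sup>2"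
      unfolding link_eq_D w_def by (rule b2[OF a0[OF that(1)] pin pin])
    also have "\<dots> \<le> (c * 2 powr (- real n - g * (real n - real t)))\<^sup>2"
      by (rule sq[OF W0]) (use W[OF that(2), of i] in \<open>simp add: add_increasing2\<close>)
    finally show ?thesis .
  qed
  have e2: "(\<integral>\<omega>. (link \<gamma> a b n i (\<lambda>x. N {2^t..<2^s} x \<omega> $ e) - link \<gamma> a b n i (\<lambda>x. N {0..} x \<omega> $ e))\<^sup>2 \<partial>M)
        \<le> (c * (2 powr (- real n - g * (real n - real t)) + 2 powr - real s))\<^sup>2"
    if "t0 \<le> t" "t \<le> n" "t \<le> s" for t n s i e
  proof -
    have ts: "(2::real)^t \<le> 2^s" using that by (intro power_increasing) auto
    have "(\<integral>\<omega>. (link \<gamma> a b n i (\<lambda>x. N {2^t..<2^s} x \<omega> $ e) - link \<gamma> a b n i (\<lambda>x. N {0..} x \<omega> $ e))\<^sup>2 \<partial>M)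
        \<le> (c0 * ((\<Sum>j\<in>UNIV. (2^t) powr \<gamma> j * w i n j) + 1 / 2^s))\<^sup>2"
      unfolding link_eq_D w_def by (rule b1[OF a0[OF that(1)] ts _ pin pin]) simp
    also have "\<dots> \<le> (c * (2 powr (- real n - g * (real n - real t)) + 2 powr - real s))\<^sup>2"
    proof (rule sq)
      show "0 \<le> (\<Sum>j\<in>UNIV. (2^t) powr \<gamma> j * w i n j) + 1 / 2^s" using W0 by (intro add_nonneg_nonneg) auto
      have "1 / 2 ^ s = (2::real) powr - real s" by (simp add: powr_minus_divide powr_realpow)
      moreover have "0 \<le> \<Lambda> * 2 powr - real s" "0 \<le> 2 powr (- real n - g * (real n - real t))" using \<Lambda> by simp_all
      ultimately show "(\<Sum>j\<in>UNIV. (2^t) powr \<gamma> j * w i n j) + 1 / 2^s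
        \<le> \<Lambda> * (2 powr (- real n - g * (real n - real t)) + 2 powr - real s) + (2 powr (- real n - g * (real n - real t)) + 2 powr - real s)"
        using W[OF that(2), of i] unfolding distrib_left by linarith
    qed
    finally show ?thesis .
  qed
  \<comment> \<open>The cut-off \<open>2^n\<close> balances the two terms of the bound, both of
    order \<open>2^(-n)\<close>.\<close>
  have e3: "(\<integral>\<omega>. (link \<gamma> a b n i (\<lambda>x. N {0..} x \<omega> $ e))\<^sup>2 \<partial>M) \<le> (c * 2 powr - real n)\<^sup>2"
    if "t0 \<le> n" for n i e
  proof -
    have "(\<integral>\<omega>. (link \<gamma> a b n i (\<lambda>x. N {0..} x \<omega> $ e))\<^sup>2 \<partial>M) \<le> (c0 * ((\<Sum>j\<in>UNIV. (2^n) powr \<gamma> j * w i n j) + 1 / 2^n))\<^sup>2"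
      unfolding link_eq_D w_def by (rule b3[OF a0[OF that] _ pin pin]) simp
    also have "\<dots> \<le> (c * 2 powr - real n)\<^sup>2"
    proof (rule sq)
      show "0 \<le> (\<Sum>j\<in>UNIV. (2^n) powr \<gamma> j * w i n j) + 1 / 2^n" using W0 by (intro add_nonneg_nonneg) auto
      have "1 / 2 ^ n = (2::real) powr - real n" by (simp add: powr_minus_divide powr_realpow)
      then show "(\<Sum>j\<in>UNIV. (2^n) powr \<gamma> j * w i n j) + 1 / 2^n \<le> \<Lambda> * 2 powr - real n + 2 powr - real n"
        using W[of n n i, OF order_refl] by simp
    qed
    finally show ?thesis .
  qed
  show ?thesis
    by (rule exI[of _ c], rule conjI[OF c], rule exI[of _ t0], intro conjI allI impI; (elim conjE)?)
       (rule e1 e2 e3; assumption)+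
qed

text \<open>A perturbation of \<open>nondegenerate_at\<close>: moving the points and discarding the
  noise above \<open>2^t\<close> change each variable by something of small variance.
  \<open>D_low_le\<close> makes the effect of moving the points uniform in \<open>t\<close>.\<close>

lemma nondegenerate_near:
  assumes xs: "\<And>l. l < m \<Longrightarrow> xs l \<in> T" "inj_on xs {..<m}"
    and F: "\<And>l. l < m \<Longrightarrow> compact_interval (F l)" "\<And>l. l < m \<Longrightarrow> F l \<subseteq> T" "\<And>l. l < m \<Longrightarrow> xs l \<in> F l"
  shows "\<exists>\<kappa>>0. \<exists>t0. \<exists>\<rho>>0. \<forall>t z c. t0 \<le> t \<and> (\<forall>l<m. z l \<in> F l \<and> (\<forall>j. \<bar>z l $ j - xs l $ j\<bar> < \<rho>)) \<longrightarrow>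
    \<kappa> * (\<Sum>l<m. \<Sum>e\<in>UNIV. (c l e)\<^sup>2) \<le> (\<integral>\<omega>. (\<Sum>l<m. \<Sum>e\<in>UNIV. c l e * N {0..<2^t} (z l) \<omega> $ e)\<^sup>2 \<partial>M)"
proof -
  have "\<exists>\<kappa>>0. \<forall>c. \<kappa> * (\<Sum>l<m. \<Sum>e\<in>UNIV. (c l e)\<^sup>2) \<le> (\<integral>\<omega>. (\<Sum>l<m. \<Sum>e\<in>UNIV. c l e * N {0..} (xs l) \<omega> $ e)\<^sup>2 \<partial>M)"
  proof (rule nondegenerate_at[OF xs])
    fix \<kappa> :: real
    assume k: "0 < \<kappa>" "\<And>c. \<kappa> * (\<Sum>l<m. \<Sum>e\<in>UNIV. (c l e)\<^sup>2) \<le> (\<integral>\<omega>. (\<Sum>l<m. \<Sum>e\<in>UNIV. c l e * N {0..} (xs l) \<omega> $ e)\<^sup>2 \<partial>M)"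
    show ?thesis by (intro exI[of _ \<kappa>] conjI allI k)
  qed
  then obtain \<kappa>0 where \<kappa>0p: "0 < \<kappa>0"
    and "\<forall>c. \<kappa>0 * (\<Sum>l<m. \<Sum>e\<in>UNIV. (c l e)\<^sup>2) \<le> (\<integral>\<omega>. (\<Sum>l<m. \<Sum>e\<in>UNIV. c l e * N {0..} (xs l) \<omega> $ e)\<^sup>2 \<partial>M)"
    by (elim exE conjE) (rule that, assumption+)
  note \<kappa>0 = this(1) spec[OF this(2)]
  define n where "n = real m * real CARD('d)"
  have n: "0 < n" using m2 by (simp add: n_def)
  \<comment> \<open>Each variable is perturbed by variance at most \<open>4 * \<eta>\<close>;
    Cauchy-Schwarz over the \<open>n\<close> variables turns this into \<open>\<kappa>0 / 4\<close>,
    and a quarter of \<open>\<kappa>0\<close> survives \<open>var_diff_le\<close>.\<close>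
  define \<eta> where "\<eta> = \<kappa>0 / (16 * n)"
  have \<eta>: "0 < \<eta>" "16 * n * \<eta> = \<kappa>0" using \<kappa>0 n by (simp_all add: \<eta>_def)
  have "\<exists>\<rho>>0. \<forall>y e. y \<in> F l \<and> (\<forall>j. \<bar>y$j - xs l$j\<bar> < \<rho>) \<longrightarrow> (\<integral>\<omega>. (D {0..} y (xs l) e \<omega>)\<^sup>2 \<partial>M) \<le> \<eta>" if "l < m" for l
  proof (rule D_continuous[OF F(1)[OF that] F(2)[OF that] F(3)[OF that] \<eta>(1)])
    fix \<rho> :: real
    assume r: "0 < \<rho>" "\<And>y e. y \<in> F l \<Longrightarrow> (\<And>j. \<bar>y$j - xs l$j\<bar> < \<rho>) \<Longrightarrow> (\<integral>\<omega>. (D {0..} y (xs l) e \<omega>)\<^sup>2 \<partial>M) \<le> \<eta>"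
    show ?thesis by (intro exI[of _ \<rho>] conjI r(1) allI impI, elim conjE, rule r(2)) auto
  qed
  then obtain \<rho>l where \<rho>l: "\<And>l. l < m \<Longrightarrow> 0 < \<rho>l l"
    "\<And>l y e. l < m \<Longrightarrow> y \<in> F l \<Longrightarrow> (\<And>j. \<bar>y$j - xs l$j\<bar> < \<rho>l l) \<Longrightarrow> (\<integral>\<omega>. (D {0..} y (xs l) e \<omega>)\<^sup>2 \<partial>M) \<le> \<eta>"
    by metis
  define \<rho> where "\<rho> = Min (\<rho>l ` {..<m})"
  have ne: "finite (\<rho>l ` {..<m})" "\<rho>l ` {..<m} \<noteq> {}" using m2 by (auto simp: lessThan_empty_iff)
  have \<rho>: "0 < \<rho>" unfolding \<rho>_def using ne \<rho>l(1) by (subst Min_gr_iff) auto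
  have \<rho>_le: "\<rho> \<le> \<rho>l l" if "l < m" for l unfolding \<rho>_def using ne that by (intro Min_le) auto
  have "\<forall>\<^sub>F t in sequentially. \<forall>l\<in>{..<m}. \<forall>e\<in>UNIV. (\<integral>\<omega>. (N {2^t..} (xs l) \<omega> $ e)\<^sup>2 \<partial>M) < \<eta>"
  proof (intro eventually_ball_finite ballI)
    fix l e assume "l \<in> {..<m}"
    then show "\<forall>\<^sub>F t in sequentially. (\<integral>\<omega>. (N {2^t..} (xs l) \<omega> $ e)\<^sup>2 \<partial>M) < \<eta>"
      using order_tendstoD(2)[OF high_noise_tendsto[OF xs(1)] \<eta>(1)] by simp
  qed auto
  then obtain t0 where t0: "\<And>t l e. t0 \<le> t \<Longrightarrow> l < m \<Longrightarrow> (\<integral>\<omega>. (N {2^t..} (xs l) \<omega> $ e)\<^sup>2 \<partial>M) < \<eta>"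
    unfolding eventually_sequentially by auto
  have "\<kappa>0 / 4 * (\<Sum>l<m. \<Sum>e\<in>UNIV. (c l e)\<^sup>2) \<le> (\<integral>\<omega>. (\<Sum>l<m. \<Sum>e\<in>UNIV. c l e * N {0..<2^t} (z l) \<omega> $ e)\<^sup>2 \<partial>M)"
    if t: "t0 \<le> t" and z: "\<And>l. l < m \<Longrightarrow> z l \<in> F l" "\<And>l j. l < m \<Longrightarrow> \<bar>z l $ j - xs l $ j\<bar> < \<rho>" for t z and c :: "nat \<Rightarrow> 'd \<Rightarrow> real"
  proof -
    have zT: "z l \<in> T" if "l < m" for l using z(1)[OF that] F(2)[OF that] by auto
    define Y where "Y l e \<omega> = N {0..<2^t} (z l) \<omega> $ e - N {0..} (xs l) \<omega> $ e" for l e \<omega>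
    have YG: "Y l e \<in> G" if "l < m" for l e
      unfolding Y_def using that zT xs(1) by (intro diff N_G) auto
    have Yv: "(\<integral>\<omega>. (Y l e \<omega>)\<^sup>2 \<partial>M) \<le> 4 * \<eta>" if l: "l < m" for l e
    proof -
      note GD = D_G[OF borel_Rplus_intervals(1)[of "2^t"] zT[OF l] xs(1)[OF l], of e]
      have pt: "(0::real) \<le> 2^t" by simp
      note GU = N_G[OF borel_Rplus_intervals(3)[OF pt] xs(1)[OF l], of e]
      note [measurable] = GD[THEN meas] GU[THEN meas] YG[OF l, THEN meas]
      have "(\<integral>\<omega>. (Y l e \<omega>)\<^sup>2 \<partial>M) = (\<integral>\<omega>. (D {0..<2^t} (z l) (xs l) e \<omega> - N {2^t..} (xs l) \<omega> $ e)\<^sup>2 \<partial>M)"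
      proof (rule var_cong_AE)
        show "AE \<omega> in M. Y l e \<omega> = D {0..<2^t} (z l) (xs l) e \<omega> - N {2^t..} (xs l) \<omega> $ e"
          using N_split[OF pt xs(1)[OF l]] by eventually_elim (simp add: Y_def D_def)
      qed measurable
      also have "\<dots> \<le> 2 * (\<integral>\<omega>. (D {0..<2^t} (z l) (xs l) e \<omega>)\<^sup>2 \<partial>M) + 2 * (\<integral>\<omega>. (N {2^t..} (xs l) \<omega> $ e)\<^sup>2 \<partial>M)"
        by (rule var_diff_le[OF GD GU])
      also have "(\<integral>\<omega>. (D {0..<2^t} (z l) (xs l) e \<omega>)\<^sup>2 \<partial>M) \<le> (\<integral>\<omega>. (D {0..} (z l) (xs l) e \<omega>)\<^sup>2 \<partial>M)"
        by (rule D_low_le[OF pt zT[OF l] xs(1)[OF l]])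
      also have "\<dots> \<le> \<eta>"
        by (rule \<rho>l(2)[OF l z(1)[OF l]]) (rule less_le_trans[OF z(2)[OF l] \<rho>_le[OF l]])
      also have "(\<integral>\<omega>. (N {2^t..} (xs l) \<omega> $ e)\<^sup>2 \<partial>M) \<le> \<eta>" using t0[OF t l, of e] by simp
      finally show ?thesis by simp
    qed
    let ?S = "{..<m} \<times> (UNIV :: 'd set)"
    define C where "C = (\<Sum>s\<in>?S. (c (fst s) (snd s))\<^sup>2)"
    have C: "C = (\<Sum>l<m. \<Sum>e\<in>UNIV. (c l e)\<^sup>2)" unfolding C_def by (simp add: sum.cartesian_product case_prod_beta)
    have C0: "0 \<le> C" unfolding C_def by (intro sum_nonneg) auto
    define f where "f \<omega> = (\<Sum>s\<in>?S. c (fst s) (snd s) * N {0..<2^t} (z (fst s)) \<omega> $ snd s)" for \<omega>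
    define y where "y \<omega> = (\<Sum>s\<in>?S. c (fst s) (snd s) * Y (fst s) (snd s) \<omega>)" for \<omega>
    have fG: "f \<in> G" unfolding f_def using zT by (intro lincomb N_G) auto
    have yG: "y \<in> G" unfolding y_def using YG by (intro lincomb) auto
    have feq: "f \<omega> = (\<Sum>l<m. \<Sum>e\<in>UNIV. c l e * N {0..<2^t} (z l) \<omega> $ e)" for \<omega>
      unfolding f_def by (simp add: sum.cartesian_product case_prod_beta)
    have xeq: "(\<Sum>l<m. \<Sum>e\<in>UNIV. c l e * N {0..} (xs l) \<omega> $ e) = f \<omega> - y \<omega>" for \<omega>
      unfolding f_def y_def Y_def by (simp add: sum.cartesian_product case_prod_beta right_diff_distrib sum_subtractf)
    have "(\<integral>\<omega>. (y \<omega>)\<^sup>2 \<partial>M) \<le> (\<integral>\<omega>. C * (\<Sum>s\<in>?S. (Y (fst s) (snd s) \<omega>)\<^sup>2) \<partial>M)"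
    proof (rule integral_mono)
      show "integrable M (\<lambda>\<omega>. (y \<omega>)\<^sup>2)" by (rule integrable_square[OF yG])
      show "integrable M (\<lambda>\<omega>. C * (\<Sum>s\<in>?S. (Y (fst s) (snd s) \<omega>)\<^sup>2))"
        using integrable_square YG by (intro integrable_mult_right Bochner_Integration.integrable_sum) auto
      show "(y \<omega>)\<^sup>2 \<le> C * (\<Sum>s\<in>?S. (Y (fst s) (snd s) \<omega>)\<^sup>2)" for \<omega>
        unfolding y_def C_def by (rule Cauchy_Schwarz_ineq_sum)
    qed
    also have "\<dots> = C * (\<Sum>s\<in>?S. \<integral>\<omega>. (Y (fst s) (snd s) \<omega>)\<^sup>2 \<partial>M)"
      using integrable_square YG by (subst integral_mult_right_zero, subst Bochner_Integration.integral_sum) auto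
    also have "\<dots> \<le> C * (\<Sum>s\<in>?S. 4 * \<eta>)"
      using C0 Yv by (intro mult_left_mono sum_mono) auto
    also have "\<dots> = C * (n * (4 * \<eta>))" by (simp add: n_def card_cartesian_product)
    finally have yv: "(\<integral>\<omega>. (y \<omega>)\<^sup>2 \<partial>M) \<le> \<kappa>0 / 4 * C" unfolding \<eta>(2)[symmetric] by (simp add: mult_ac)
    have "\<kappa>0 * C \<le> (\<integral>\<omega>. (f \<omega> - y \<omega>)\<^sup>2 \<partial>M)" using \<kappa>0(2)[of c] unfolding C xeq .
    also have "\<dots> \<le> 2 * (\<integral>\<omega>. (f \<omega>)\<^sup>2 \<partial>M) + 2 * (\<integral>\<omega>. (y \<omega>)\<^sup>2 \<partial>M)" by (rule var_diff_le[OF fG yG])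
    finally have "\<kappa>0 * C \<le> 2 * (\<integral>\<omega>. (f \<omega>)\<^sup>2 \<partial>M) + 2 * (\<kappa>0 / 4 * C)" using yv by linarith
    then have "\<kappa>0 / 4 * C \<le> (\<integral>\<omega>. (f \<omega>)\<^sup>2 \<partial>M)" by linarith
    then show ?thesis unfolding C feq .
  qed
  then show ?thesis
    using \<kappa>0(1) \<rho> by (intro exI[of _ "\<kappa>0 / 4"] conjI exI[of _ t0] exI[of _ \<rho>] allI impI) auto
qed

section \<open>Localisation to countably many tuples of boxes\<close>

definition multi :: "(nat \<Rightarrow> (real^'k) \<times> (real^'k)) \<Rightarrow> 'w \<Rightarrow> bool" where
  "multi B \<omega> \<longleftrightarrow> (\<exists>ys. (\<forall>l<m. ys l \<in> cbox (fst (B l)) (snd (B l))) \<and> (\<forall>l<m. v (ys l) \<omega> = v (ys 0) \<omega>))"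

text \<open>Around distinct points the boxes are shrunk until the requirements of
  \<open>nondegenerate_boxes\<close> hold. Corner coordinates are rational or inherited from the
  given boxes, so that countably many tuples of boxes can serve all choices of points.\<close>

lemma no_multi_near:
  assumes xs: "\<And>l. l < m \<Longrightarrow> xs l \<in> T" "inj_on xs {..<m}"
    and pq: "\<And>l j. l < m \<Longrightarrow> p l $ j < q l $ j" "\<And>l. l < m \<Longrightarrow> cbox (p l) (q l) \<subseteq> T" "\<And>l. l < m \<Longrightarrow> xs l \<in> cbox (p l) (q l)"
  shows "\<exists>B. (\<forall>l<m. (\<forall>j. fst (B l) $ j \<in> insert (p l $ j) \<rat>) \<and> (\<forall>j. snd (B l) $ j \<in> insert (q l $ j) \<rat>) \<and>
      xs l \<in> cbox (fst (B l)) (snd (B l))) \<and> (AE \<omega> in M. \<not> multi B \<omega>)"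
proof -
  have ci: "compact_interval (cbox (p l) (q l))" if "l < m" for l
    using pq(1)[OF that] unfolding compact_interval_def by blast
  have "\<exists>\<kappa>>0. \<exists>t0. \<exists>\<rho>>0. \<forall>t z c. t0 \<le> t \<and> (\<forall>l<m. z l \<in> cbox (p l) (q l) \<and> (\<forall>j. \<bar>z l $ j - xs l $ j\<bar> < \<rho>)) \<longrightarrow>
    \<kappa> * (\<Sum>l<m. \<Sum>e\<in>UNIV. (c l e)\<^sup>2) \<le> (\<integral>\<omega>. (\<Sum>l<m. \<Sum>e\<in>UNIV. c l e * N {0..<2^t} (z l) \<omega> $ e)\<^sup>2 \<partial>M)"
    by (rule nondegenerate_near[where F = "\<lambda>l. cbox (p l) (q l)"]) (rule xs ci pq; assumption?)+
  then obtain \<kappa> t1 \<rho> where \<kappa>: "0 < \<kappa>" and \<rho>: "0 < \<rho>"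
    and nd: "\<forall>t z c. t1 \<le> t \<and> (\<forall>l<m. z l \<in> cbox (p l) (q l) \<and> (\<forall>j. \<bar>z l $ j - xs l $ j\<bar> < \<rho>)) \<longrightarrow>
    \<kappa> * (\<Sum>l<m. \<Sum>e\<in>UNIV. (c l e)\<^sup>2) \<le> (\<integral>\<omega>. (\<Sum>l<m. \<Sum>e\<in>UNIV. c l e * N {0..<2^t} (z l) \<omega> $ e)\<^sup>2 \<partial>M)"
    by (elim exE conjE) (rule that, assumption+)
  have "\<exists>a b. (\<forall>j. a$j \<in> insert (p l $ j) \<rat>) \<and> (\<forall>j. b$j \<in> insert (q l $ j) \<rat>) \<and> (\<forall>j. a$j < b$j) \<and>
      xs l \<in> cbox a b \<and> cbox a b \<subseteq> cbox (p l) (q l) \<and> (\<forall>y j. y \<in> cbox a b \<longrightarrow> \<bar>y$j - xs l $ j\<bar> < \<rho>)" if l: "l < m" for l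
    by (rule rational_subbox[OF pq(1)[OF l] pq(3)[OF l] \<rho>]) blast
  then obtain a b where ab: "\<And>l. l < m \<Longrightarrow> (\<forall>j. a l $ j \<in> insert (p l $ j) \<rat>) \<and> (\<forall>j. b l $ j \<in> insert (q l $ j) \<rat>) \<and> (\<forall>j. a l $ j < b l $ j) \<and>
      xs l \<in> cbox (a l) (b l) \<and> cbox (a l) (b l) \<subseteq> cbox (p l) (q l) \<and> (\<forall>y j. y \<in> cbox (a l) (b l) \<longrightarrow> \<bar>y$j - xs l $ j\<bar> < \<rho>)"
    by metis
  have ablt: "a l $ j < b l $ j" if "l < m" for l j using ab[OF that] by blast
  have abT: "cbox (a l) (b l) \<subseteq> T" if "l < m" for l using ab[OF that] pq(2)[OF that] by blast
  \<comment> \<open>The cap 1/4 is dictated by the exponent \<open>3 / 4\<close> in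
    \<open>linkvar\<close>.\<close>
  define g where "g = min (1 / 4) (Min (range \<gamma>))"
  have g: "0 < g" "g \<le> 1 / 4" "g \<le> \<gamma> j" for j
    unfolding g_def using \<gamma>_pos by (auto simp: Min_gr_iff min.coboundedI2)
  define P where "P l c t0 \<longleftrightarrow> 0 < c \<and>
    (\<forall>t n i e. t0 \<le> t \<and> t \<le> n \<longrightarrow>
      (\<integral>\<omega>. (link \<gamma> (a l) (b l) n i (\<lambda>x. N {0..<2^t} x \<omega> $ e))\<^sup>2 \<partial>M) \<le> (c * 2 powr (- real n - g * (real n - real t)))\<^sup>2) \<and>
    (\<forall>t n s i e. t0 \<le> t \<and> t \<le> n \<and> t \<le> s \<longrightarrow>
      (\<integral>\<omega>. (link \<gamma> (a l) (b l) n i (\<lambda>x. N {2^t..<2^s} x \<omega> $ e) - link \<gamma> (a l) (b l) n i (\<lambda>x. N {0..} x \<omega> $ e))\<^sup>2 \<partial>M)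
        \<le> (c * (2 powr (- real n - g * (real n - real t)) + 2 powr - real s))\<^sup>2) \<and>
    (\<forall>n i e. t0 \<le> n \<longrightarrow>
      (\<integral>\<omega>. (link \<gamma> (a l) (b l) n i (\<lambda>x. N {0..} x \<omega> $ e))\<^sup>2 \<partial>M) \<le> (c * 2 powr - real n)\<^sup>2)"
    for l :: nat and c :: real and t0 :: nat
  have "\<exists>c t0. P l c t0" if l: "l < m" for l
    using link_bounds[OF ablt[OF l] abT[OF l] g(3)] unfolding P_def by (elim exE conjE) (intro exI conjI; assumption)
  then obtain c t0 where P: "\<And>l. l < m \<Longrightarrow> P l (c l) (t0 l)" by metis
  have c0: "0 < c l" if "l < m" for l using P[OF that] unfolding P_def by (rule conjunct1)
  have L1: "(\<integral>\<omega>. (link \<gamma> (a l) (b l) n i (\<lambda>x. N {0..<2^t} x \<omega> $ e))\<^sup>2 \<partial>M) \<le> (c l * 2 powr (- real n - g * (real n - real t)))\<^sup>2"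
    if "l < m" "t0 l \<le> t" "t \<le> n" for l t n i e
    using P[OF that(1), unfolded P_def, THEN conjunct2, THEN conjunct1, rule_format, OF conjI[OF that(2,3)]] .
  have L2: "(\<integral>\<omega>. (link \<gamma> (a l) (b l) n i (\<lambda>x. N {2^t..<2^s} x \<omega> $ e) - link \<gamma> (a l) (b l) n i (\<lambda>x. N {0..} x \<omega> $ e))\<^sup>2 \<partial>M)
        \<le> (c l * (2 powr (- real n - g * (real n - real t)) + 2 powr - real s))\<^sup>2"
    if "l < m" "t0 l \<le> t" "t \<le> n" "t \<le> s" for l t n s i e
    using P[OF that(1), unfolded P_def, THEN conjunct2, THEN conjunct2, THEN conjunct1, rule_format, OF conjI[OF that(2) conjI[OF that(3,4)]]] .
  have L3: "(\<integral>\<omega>. (link \<gamma> (a l) (b l) n i (\<lambda>x. N {0..} x \<omega> $ e))\<^sup>2 \<partial>M) \<le> (c l * 2 powr - real n)\<^sup>2"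
    if "l < m" "t0 l \<le> n" for l n i e
    using P[OF that(1), unfolded P_def, THEN conjunct2, THEN conjunct2, THEN conjunct2, rule_format, OF that(2)] .
  \<comment> \<open>Sums serve as common upper bounds for the constants and starting levels of the
    finitely many boxes.\<close>
  define c1 where "c1 = (\<Sum>l<m. c l)"
  have m0: "0 < m" using m2 by simp
  have c1: "c l \<le> c1" if "l < m" for l
    unfolding c1_def using that c0 by (intro member_le_sum) (auto intro: less_imp_le)
  have c1_pos: "0 < c1" using c0[OF m0] c1[OF m0] by simp
  define t2 where "t2 = t1 + (\<Sum>l<m. t0 l)"
  have t2: "t0 l \<le> t2" if "l < m" for l
    unfolding t2_def using that member_le_sum[of l "{..<m}" t0] by simp
  have up: "X \<le> (c1 * u)\<^sup>2" if "X \<le> (c l * u)\<^sup>2" "l < m" "0 \<le> u" for X u l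
  proof -
    have "(c l * u)\<^sup>2 \<le> (c1 * u)\<^sup>2"
      using c0[OF that(2)] c1[OF that(2)] that(3) by (intro power_mono mult_right_mono) auto
    then show ?thesis using that(1) by (rule order_trans[rotated])
  qed
  have "nondegenerate_boxes M G \<gamma> m a b N T c1 g \<kappa> t2"
  proof (unfold_locales)
    show "a l $ j < b l $ j" if "l < m" for l j by (rule ablt[OF that])
    show "2 \<le> m" by (rule m2)
    show "cbox (a l) (b l) \<subseteq> T" if "l < m" for l by (rule abT[OF that])
    show "(\<lambda>\<omega>. N A x \<omega> $ e) \<in> G" if "A \<in> borel_Rplus" "x \<in> T" for A x e by (rule N_G[OF that])
    show "indep_var (Pi\<^sub>M T (\<lambda>_. borel)) (\<lambda>\<omega>. restrict (\<lambda>x. N A x \<omega>) T)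
                (Pi\<^sub>M T (\<lambda>_. borel)) (\<lambda>\<omega>. restrict (\<lambda>x. N B x \<omega>) T)"
      if "A \<in> borel_Rplus" "B \<in> borel_Rplus" "A \<inter> B = {}" for A B by (rule N_indep[OF that])
    show "AE \<omega> in M. N (A \<union> B) x \<omega> = N A x \<omega> + N B x \<omega>"
      if "A \<in> borel_Rplus" "B \<in> borel_Rplus" "A \<inter> B = {}" "x \<in> T" for A B x by (rule N_add[OF that])
    show "0 < c1" "0 < g" "g \<le> 1 / 4" "0 < \<kappa>" using c1_pos g(1,2) \<kappa> by auto
    show "(\<integral>\<omega>. (link \<gamma> (a l) (b l) n i (\<lambda>x. N {0..<2^t} x \<omega> $ e))\<^sup>2 \<partial>M)
        \<le> (c1 * 2 powr (- real n - g * (real n - real t)))\<^sup>2" if "l < m" "t2 \<le> t" "t \<le> n" for l t n i e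
      by (rule up[OF L1[OF that(1) order_trans[OF t2[OF that(1)] that(2)] that(3)] that(1)]) simp
    show "(\<integral>\<omega>. (link \<gamma> (a l) (b l) n i (\<lambda>x. N {2^t..<2^s} x \<omega> $ e) - link \<gamma> (a l) (b l) n i (\<lambda>x. N {0..} x \<omega> $ e))\<^sup>2 \<partial>M)
        \<le> (c1 * (2 powr (- real n - g * (real n - real t)) + 2 powr - real s))\<^sup>2"
      if "l < m" "t2 \<le> t" "t \<le> n" "t \<le> s" for l t n s i e
      by (rule up[OF L2[OF that(1) order_trans[OF t2[OF that(1)] that(2)] that(3,4)] that(1)]) simp
    show "(\<integral>\<omega>. (link \<gamma> (a l) (b l) n i (\<lambda>x. N {0..} x \<omega> $ e))\<^sup>2 \<partial>M) \<le> (c1 * 2 powr - real n)\<^sup>2"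
      if "l < m" "t2 \<le> n" for l n i e
      by (rule up[OF L3[OF that(1) order_trans[OF t2[OF that(1)] that(2)]] that(1)]) simp
    show "\<kappa> * (\<Sum>l<m. \<Sum>e\<in>UNIV. (c l e)\<^sup>2) \<le> (\<integral>\<omega>. (\<Sum>l<m. \<Sum>e\<in>UNIV. c l e * N {0..<2^t} (z l) \<omega> $ e)\<^sup>2 \<partial>M)"
      if t: "t2 \<le> t" and z: "\<And>l. l < m \<Longrightarrow> z l \<in> cbox (a l) (b l)" for t z c
    proof (rule nd[rule_format], intro conjI allI impI)
      show "t1 \<le> t" using t by (simp add: t2_def)
      show "z l \<in> cbox (p l) (q l)" if "l < m" for l using ab[OF that] z[OF that] by blast
      show "\<bar>z l $ j - xs l $ j\<bar> < \<rho>" if "l < m" for l j using ab[OF that] z[OF that] by blast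
    qed
    show "real m * Qdim \<gamma> \<le> real ((m - 1) * CARD('d))" using crit by simp
  qed
  then interpret X: nondegenerate_boxes M G \<gamma> m a b N T c1 g \<kappa> t2 .
  have "AE \<omega> in M. \<not> (\<exists>xs. (\<forall>l<m. xs l \<in> cbox (a l) (b l)) \<and> (\<forall>l<m. v (xs l) \<omega> = v (xs 0) \<omega>))"
    by (rule X.no_hit[OF _ N_v]) (use field in \<open>simp_all add: centered_cont_gaussian_field_iid_def\<close>)
  then have "AE \<omega> in M. \<not> multi (\<lambda>l. (a l, b l)) \<omega>" by (simp add: multi_def)
  then show ?thesis using ab by (intro exI[of _ "\<lambda>l. (a l, b l)"]) simp
qed

text \<open>The tuple of boxes depends on the points and thus on the outcome. Drawing it from a
  countable family fixed in advance allows all null sets to be removed before the points are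
  chosen.\<close>

lemma no_multiple_points:
  assumes T: "countable_union_of_compact_intervals T"
  shows "AE \<omega> in M. \<not> (\<exists>xs::nat \<Rightarrow> real^'k. (\<forall>l<m. xs l \<in> T) \<and> inj_on xs {..<m} \<and> (\<forall>l<m. v (xs l) \<omega> = v (xs 0) \<omega>))"
proof -
  obtain \<F> where \<F>: "countable \<F>" "\<And>F. F \<in> \<F> \<Longrightarrow> compact_interval F" "T = \<Union>\<F>"
    using T unfolding countable_union_of_compact_intervals_def by blast
  have "\<exists>a b. (\<forall>j. a$j < b$j) \<and> F = cbox a b" if "F \<in> \<F>" for F
    using \<F>(2)[OF that] unfolding compact_interval_def .
  then obtain p q where pq: "\<And>F. F \<in> \<F> \<Longrightarrow> (\<forall>j. p F $ j < q F $ j) \<and> F = cbox (p F) (q F)" by metis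
  define \<B> where "\<B> = (\<Union>F\<in>\<F>. {x. \<forall>j. x$j \<in> insert (p F $ j) \<rat>} \<times> {x. \<forall>j. x$j \<in> insert (q F $ j) \<rat>})"
  have "countable \<B>"
    unfolding \<B>_def using countable_rat by (intro countable_UN \<F>(1) countable_SIGMA countable_vec countable_insert)
  define \<C> where "\<C> = {B \<in> (\<Pi>\<^sub>E l\<in>{..<m}. \<B>). AE \<omega> in M. \<not> multi B \<omega>}"
  have "countable (\<Pi>\<^sub>E l\<in>{..<m}. \<B>)" using \<open>countable \<B>\<close> by (intro countable_PiE) auto
  then have "countable \<C>" by (rule countable_subset[rotated]) (auto simp: \<C>_def)
  then have "AE \<omega> in M. \<forall>B\<in>\<C>. \<not> multi B \<omega>"
    by (subst AE_ball_countable) (auto simp: \<C>_def)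
  then show ?thesis
  proof eventually_elim
    case (elim \<omega>)
    show ?case
    proof (rule notI, elim exE conjE)
      fix xs :: "nat \<Rightarrow> real^'k"
      assume xs: "\<forall>l<m. xs l \<in> T" "inj_on xs {..<m}" "\<forall>l<m. v (xs l) \<omega> = v (xs 0) \<omega>"
      have "\<exists>F\<in>\<F>. xs l \<in> F" if "l < m" for l using xs(1) that \<F>(3) by blast
      then obtain F where F: "\<And>l. l < m \<Longrightarrow> F l \<in> \<F>" "\<And>l. l < m \<Longrightarrow> xs l \<in> F l" by metis
      have Fc: "F l = cbox (p (F l)) (q (F l))" if "l < m" for l using pq[OF F(1)[OF that]] by blast
      have "\<exists>B. (\<forall>l<m. (\<forall>j. fst (B l) $ j \<in> insert (p (F l) $ j) \<rat>) \<and> (\<forall>j. snd (B l) $ j \<in> insert (q (F l) $ j) \<rat>) \<and>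
          xs l \<in> cbox (fst (B l)) (snd (B l))) \<and> (AE \<omega> in M. \<not> multi B \<omega>)"
      proof (rule no_multi_near)
        show "xs l \<in> T" if "l < m" for l using xs(1) that by blast
        show "inj_on xs {..<m}" by (rule xs(2))
        show "p (F l) $ j < q (F l) $ j" if "l < m" for l j using pq[OF F(1)[OF that]] by blast
        show "cbox (p (F l)) (q (F l)) \<subseteq> T" if "l < m" for l
          unfolding Fc[OF that, symmetric] \<F>(3) using F(1)[OF that] by blast
        show "xs l \<in> cbox (p (F l)) (q (F l))" if "l < m" for l
          unfolding Fc[OF that, symmetric] by (rule F(2)[OF that])
      qed
      then obtain B where B: "\<And>l. l < m \<Longrightarrow> (\<forall>j. fst (B l) $ j \<in> insert (p (F l) $ j) \<rat>) \<and> (\<forall>j. snd (B l) $ j \<in> insert (q (F l) $ j) \<rat>) \<and>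
          xs l \<in> cbox (fst (B l)) (snd (B l))" and AE: "AE \<omega> in M. \<not> multi B \<omega>"
        by blast
      \<comment> \<open>Restriction turns the tuple into an element of the countable extensional
        product.\<close>
      define B' where "B' = restrict B {..<m}"
      have m_eq: "multi B' = multi B" by (simp add: multi_def B'_def fun_eq_iff)
      have "B l \<in> \<B>" if "l < m" for l
        unfolding \<B>_def using B[OF that] F(1)[OF that] by (intro UN_I[of "F l"]) (simp_all add: mem_Times_iff)
      then have "B' \<in> \<C>" using AE unfolding \<C>_def m_eq[symmetric] by (auto simp: B'_def)
      then have "\<not> multi B \<omega>" using elim m_eq by auto
      moreover have "multi B \<omega>" unfolding multi_def using B xs(3) by blast
      ultimately show False by contradiction
    qed
  qed
qed

end

theorem theorem2p5:
  fixes M :: "'w measure"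
    and v :: "real^'k \<Rightarrow> 'w \<Rightarrow> real^'d"
    and T :: "(real^'k) set"
    and N :: "real set \<Rightarrow> real^'k \<Rightarrow> 'w \<Rightarrow> real^'d"
    and \<gamma> :: "'k \<Rightarrow> real"
    and m :: nat
  assumes "prob_space M"
    and "centered_cont_gaussian_field_iid M v"
    and "countable_union_of_compact_intervals T"
    and "m \<ge> 2"
    and "assumption1 M v T N \<gamma>"
    and "assumption2 M v T \<gamma>"
    and "assumption3 M v T m"
    and "real m * Qdim \<gamma> \<le> real (m - 1) * real CARD('d)"
  shows "AE \<omega> in M. \<not> (\<exists>xs::nat \<Rightarrow> real^'k. (\<forall>l<m. xs l \<in> T) \<and> inj_on xs {..<m} \<and>
                          (\<forall>l<m. v (xs l) \<omega> = v (xs 0) \<omega>))"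
proof -
  interpret noise_field M v T N \<gamma> m
    by (intro noise_field.intro noise_field_axioms.intro assms)
  show ?thesis by (rule no_multiple_points[OF assms(3)])
qed

end
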